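(* Let $N\ge 2$, $\omega\in\mathbb{R}$ and $0<s<1$. Let $\{u_{n}\}\subseteq W^{s}(\mathbb{R}^{N})$ be a minimizing sequence for $d(\omega)$. Then there exists a family $(y_{n})\subset\mathbb{R}^{N}$ such that $\{u_{n}(\cdot-y_{n})\}$ contains a subsequence that converges in $W^{s}(\mathbb{R}^{N})$. In particular, $\mathcal{G}_{\omega}$ is nonempty for any $\omega\in\mathbb{R}$.
   Context: All functions are complex valued; $\mathrm{Log}$ is the natural logarithm, with $|z|^{2}\mathrm{Log}|z|^{2}=0$ at $z=0$. The fractional Laplacian is $\mathcal{F}[(-\Delta)^{s}u](\xi)=|\xi|^{2s}\mathcal{F}u(\xi)$ with $\mathcal{F}u(\xi)=(2\pi)^{-N/2}\int_{\mathbb{R}^N}u(x)e^{-i\xi\cdot x}dx$. $H^{s}(\mathbb{R}^{N})$ is the fractional Sobolev space with norm $\|u\|_{H^{s}}^{2}=\|u\|_{L^{2}}^{2}+\|(-\Delta)^{s/2}u\|_{L^{2}}^{2}$. Let $A:[0,\infty)\to[0,\infty)$ be $A(r)=-r^{2}\mathrm{Log}(r^{2})$ for $0\le r\le e^{-3}$ (with $A(0)=0$) and $A(r)=3r^{2}+4e^{-3}r-e^{-6}$ for $r\ge e^{-3}$. The Orlicz space is $L^{A}(\mathbb{R}^{N})=\{u\in L^{1}_{\mathrm{loc}}(\mathbb{R}^{N}):A(|u|)\in L^{1}(\mathbb{R}^{N})\}$ with the Luxemburg norm $\|u\|_{L^{A}}=\inf\{k>0:\int_{\mathbb{R}^{N}}A(k^{-1}|u(x)|)dx\le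 1\}$. The energy space is $W^{s}(\mathbb{R}^{N})=H^{s}(\mathbb{R}^{N})\cap L^{A}(\mathbb{R}^{N})$ with norm $\|u\|_{W^{s}}=\|u\|_{H^{s}}+\|u\|_{L^{A}}$; as a set it equals $\{u\in H^{s}(\mathbb{R}^{N}):|u|^{2}\mathrm{Log}|u|^{2}\in L^{1}(\mathbb{R}^{N})\}$. For $u\in W^{s}(\mathbb{R}^{N})$ put $$S_{\omega}(u)=\tfrac12\int_{\mathbb{R}^{N}}|(-\Delta)^{s/2}u|^{2}dx+\tfrac{\omega+1}{2}\int_{\mathbb{R}^{N}}|u|^{2}dx-\tfrac12\int_{\mathbb{R}^{N}}|u|^{2}\mathrm{Log}|u|^{2}dx,$$ $$I_{\omega}(u)=\int_{\mathbb{R}^{N}}|(-\Delta)^{s/2}u|^{2}dx+\omega\int_{\mathbb{R}^{N}}|u|^{2}dx-\int_{\mathbb{R}^{N}}|u|^{2}\mathrm{Log}|u|^{2}dx,$$ $$d(\omega)=\inf\{S_{\omega}(u):u\in W^{s}(\mathbb{R}^{N})\setminus\{0\},\ I_{\omega}(u)=0\}=\tfrac12\inf\{\|u\|_{L^{2}}^{2}:u\in W^{s}(\mathbb{R}^{N})\setminus\{0\},\ I_{\omega}(u)=0\},$$ $$\mathcal{G}_{\omega}=\{\varphi\in W^{s}(\mathbb{R}^{N})\setminus\{0\}:S_{\omega}(\varphi)=d(\omega),\ I_{\omega}(\varphi)=0\}.$$ A minimizing sequence for $d(\omega)$ is a sequence $\{u_n\}\subset W^{s}(\mathbb{R}^{N})\setminus\{0\}$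 with $I_{\omega}(u_{n})=0$ for all $n$ and $S_{\omega}(u_{n})\to d(\omega)$. *)

theory Defs
  imports "HOL-Analysis.Analysis"
begin

text \<open>
  Elements of the function spaces below are represented by Borel functions, two functions being
  the same element when they agree almost everywhere (every Lebesgue measurable function has a
  Borel representative). In particular the zero element is represented by the functions that
  vanish almost everywhere.
\<close>

definition L1_loc :: "('a::euclidean_space \<Rightarrow> complex) set" where
  "L1_loc = {u. u \<in> borel_measurable lborel \<and> (\<forall>K. compact K \<longrightarrow> set_integrable lborel K u)}"

definition L2 :: "('a::euclidean_space \<Rightarrow> complex) set" where
  "L2 = {u. u \<in> borel_measurable lborel \<and> integrable lborel (\<lambda>x. (cmod (u x))\<^sup>2)}"

definition L2_norm :: "('a::euclidean_space \<Rightarrow> complex) \<Rightarrow> real" where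
  "L2_norm u = sqrt (LINT x|lborel. (cmod (u x))\<^sup>2)"

definition fourier_integral :: "('a::euclidean_space \<Rightarrow> complex) \<Rightarrow> 'a \<Rightarrow> complex" where
  "fourier_integral u \<xi> = of_real ((2 * pi) powr (- real DIM('a) / 2)) *
     (LINT x|lborel. u x * exp (- (\<i> * of_real (\<xi> \<bullet> x))))"

text \<open>
  The Fourier integral need not converge for square integrable functions. The Fourier transform
  on \<open>L\<^sup>2\<close> is the usual (Plancherel) extension, obtained as the limit in \<open>L\<^sup>2\<close> of the Fourier
  integrals of the truncations to balls of radius \<open>R\<close>; it is determined up to a null set.
\<close>

definition fourier :: "('a::euclidean_space \<Rightarrow> complex) \<Rightarrow> 'a \<Rightarrow> complex" where
  "fourier u = (SOME g. g \<in> L2 \<and>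
     ((\<lambda>R. L2_norm (\<lambda>\<xi>. fourier_integral (\<lambda>x. indicator (cball 0 R) x * u x) \<xi> - g \<xi>))
        \<longlongrightarrow> 0) at_top)"

text \<open>The operator \<open>(-\<Delta>)\<^sup>s\<close>, defined up to a null set on those \<open>u\<close> in \<open>L\<^sup>2\<close> for which the
  right-hand side of the defining identity is square integrable.\<close>

definition frac_laplacian :: "real \<Rightarrow> ('a::euclidean_space \<Rightarrow> complex) \<Rightarrow> 'a \<Rightarrow> complex" where
  "frac_laplacian s u = (SOME v. v \<in> L2 \<and>
     (AE \<xi> in lborel. fourier v \<xi> = of_real (norm \<xi> powr (2 * s)) * fourier u \<xi>))"

definition Hs :: "real \<Rightarrow> ('a::euclidean_space \<Rightarrow> complex) set" where
  "Hs s = {u \<in> L2. (\<lambda>\<xi>. of_real (norm \<xi> powr s) * fourier u \<xi>) \<in> L2}"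

definition Hs_norm :: "real \<Rightarrow> ('a::euclidean_space \<Rightarrow> complex) \<Rightarrow> real" where
  "Hs_norm s u = sqrt ((L2_norm u)\<^sup>2 + (L2_norm (frac_laplacian (s / 2) u))\<^sup>2)"

text \<open>Only arguments \<open>r \<ge> 0\<close> matter; as \<open>ln 0 = 0\<close>, the value at \<open>0\<close> is \<open>0\<close>.\<close>

definition orlicz_A :: "real \<Rightarrow> real" where
  "orlicz_A r = (if r \<le> exp (-3) then - (r\<^sup>2 * ln (r\<^sup>2))
                 else 3 * r\<^sup>2 + 4 * exp (-3) * r - exp (-6))"

definition LA :: "('a::euclidean_space \<Rightarrow> complex) set" where
  "LA = {u \<in> L1_loc. integrable lborel (\<lambda>x. orlicz_A (cmod (u x)))}"

text \<open>The nonnegative integral is used because the Bochner integral of a non-integrable function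
  is \<open>0\<close>, which would wrongly admit such \<open>k\<close>.\<close>

definition LA_norm :: "('a::euclidean_space \<Rightarrow> complex) \<Rightarrow> real" where
  "LA_norm u = Inf {k. 0 < k \<and> (\<integral>\<^sup>+ x. ennreal (orlicz_A (inverse k * cmod (u x))) \<partial>lborel) \<le> 1}"

definition Ws :: "real \<Rightarrow> ('a::euclidean_space \<Rightarrow> complex) set" where
  "Ws s = Hs s \<inter> LA"

definition Ws_norm :: "real \<Rightarrow> ('a::euclidean_space \<Rightarrow> complex) \<Rightarrow> real" where
  "Ws_norm s u = Hs_norm s u + LA_norm u"

definition Ws_nonzero :: "real \<Rightarrow> ('a::euclidean_space \<Rightarrow> complex) set" where
  "Ws_nonzero s = {u \<in> Ws s. \<not> (AE x in lborel. u x = 0)}"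

definition S_functional :: "real \<Rightarrow> real \<Rightarrow> ('a::euclidean_space \<Rightarrow> complex) \<Rightarrow> real" where
  "S_functional s \<omega> u =
     1 / 2 * (LINT x|lborel. (cmod (frac_laplacian (s / 2) u x))\<^sup>2)
     + (\<omega> + 1) / 2 * (LINT x|lborel. (cmod (u x))\<^sup>2)
     - 1 / 2 * (LINT x|lborel. (cmod (u x))\<^sup>2 * ln ((cmod (u x))\<^sup>2))"

definition I_functional :: "real \<Rightarrow> real \<Rightarrow> ('a::euclidean_space \<Rightarrow> complex) \<Rightarrow> real" where
  "I_functional s \<omega> u =
     (LINT x|lborel. (cmod (frac_laplacian (s / 2) u x))\<^sup>2)
     + \<omega> * (LINT x|lborel. (cmod (u x))\<^sup>2)
     - (LINT x|lborel. (cmod (u x))\<^sup>2 * ln ((cmod (u x))\<^sup>2))"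

text \<open>The domain cannot be inferred from the real value \<open>d(\<omega>)\<close>, so it is passed as a type
  argument.\<close>

definition d_value :: "'a::euclidean_space itself \<Rightarrow> real \<Rightarrow> real \<Rightarrow> real" where
  "d_value _ s \<omega> =
     Inf {S_functional s \<omega> u | u :: 'a \<Rightarrow> complex. u \<in> Ws_nonzero s \<and> I_functional s \<omega> u = 0}"

definition ground_states :: "real \<Rightarrow> real \<Rightarrow> ('a::euclidean_space \<Rightarrow> complex) set" where
  "ground_states s \<omega> =
     {\<phi> \<in> Ws_nonzero s. S_functional s \<omega> \<phi> = d_value TYPE('a) s \<omega> \<and> I_functional s \<omega> \<phi> = 0}"

definition minimizing_sequence ::
    "real \<Rightarrow> real \<Rightarrow> (nat \<Rightarrow> 'a::euclidean_space \<Rightarrow> complex) \<Rightarrow> bool" where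
  "minimizing_sequence s \<omega> u \<longleftrightarrow>
     (\<forall>n. u n \<in> Ws_nonzero s \<and> I_functional s \<omega> (u n) = 0) \<and>
     (\<lambda>n. S_functional s \<omega> (u n)) \<longlonglongrightarrow> d_value TYPE('a) s \<omega>"

definition Ws_converges ::
    "real \<Rightarrow> (nat \<Rightarrow> 'a::euclidean_space \<Rightarrow> complex) \<Rightarrow> ('a \<Rightarrow> complex) \<Rightarrow> bool" where
  "Ws_converges s u \<phi> \<longleftrightarrow>
     (\<forall>n. u n \<in> Ws s) \<and> \<phi> \<in> Ws s \<and> (\<lambda>n. Ws_norm s (\<lambda>x. u n x - \<phi> x)) \<longlonglongrightarrow> 0"

end

theory Submission
  imports Defs "HOL-Probability.Characteristic_Functions" "HOL-Complex_Analysis.Great_Picard"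
begin

text \<open>
  Write \<open>f(r) = r\<^sup>2 ln r\<^sup>2\<close>, let \<open>m(u)\<close> be the squared \<open>L\<^sup>2\<close> norm, \<open>k(u)\<close> the squared \<open>L\<^sup>2\<close> norm of
  \<open>|\<xi>|\<^sup>s \<F>u\<close> and \<open>e(u) = \<integral> f(|u|)\<close>, so that \<open>I(u) = k(u) + \<omega> m(u) - e(u)\<close> and \<open>S(u) = (I(u) + m(u)) / 2\<close>.
  Minimizing \<open>S\<close> under \<open>I = 0\<close> is thus minimizing \<open>m / 2\<close>. As \<open>I(t u) = t\<^sup>2 (I(u) - ln t\<^sup>2 m(u))\<close>,
  each nonzero \<open>u\<close> has exactly one positive multiple with \<open>I = 0\<close>, and its mass gives the
  inequality \<open>2 d \<le> m(u) exp (I(u) / m(u))\<close> (lemma \<open>d_value_le\<close>), from which all the variational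
  information is read off.

  The only Sobolev-type input is a tail estimate. The part of \<open>u\<close> with frequencies in the ball of
  radius \<open>R\<close> is bounded pointwise by a multiple of \<open>R\<^bsup>N/2\<^esup> ||u||\<close>, and the rest has \<open>L\<^sup>2\<close> norm at most
  \<open>R\<^bsup>-s\<^esup> k(u)\<^bsup>1/2\<^esup>\<close>. If \<open>R\<close> is chosen so that the first part stays below \<open>\<lambda>/2\<close>, the set \<open>|u| > \<lambda>\<close> only sees
  the second, so it carries an \<open>L\<^sup>2\<close> mass that decays like a power of \<open>\<lambda>\<close> (\<open>tail_decay\<close>). Summing over the
  levels \<open>\<lambda> e\<^sup>j\<close> bounds the positive part of the logarithmic integral (\<open>log_tail_bound\<close>); this is a
  fractional logarithmic Sobolev inequality. On the constraint it
  bounds the mass from below and the kinetic term \<open>k\<close> in terms of the mass.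

  Compactness up to translation has two halves. A minimizing sequence cannot vanish
  (\<open>lowpass_nonvanishing\<close>): if the low-frequency parts were uniformly small, the mass above every
  level \<open>\<lambda>\<close> would be small, hence \<open>e(u) \<le> ln \<lambda>\<^sup>2 m(u) + O(1)\<close>, and a small \<open>\<lambda>\<close> contradicts
  \<open>e(u) = k(u) + \<omega> m(u)\<close>. So after translation the low-frequency parts are bounded away from
  zero at the origin. On the other hand low-frequency parts are uniformly Lipschitz, so a subsequence
  of them converges pointwise, and since the remainders are uniformly small in \<open>L\<^sup>2\<close> the functions
  themselves converge locally in \<open>L\<^sup>2\<close> and weakly (\<open>Hs_local_compactness\<close>). The value at the origin of the
  low-frequency part is a weakly continuous functional, so the limit \<open>\<phi>\<close> is nonzero.

  Finally let \<open>w\<close> be the differences between the sequence and \<open>\<phi>\<close>. Weak convergence splits \<open>m\<close> and \<open>k\<close>, the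
  Brezis-Lieb lemma splits \<open>e\<close>, so \<open>m(w) \<rightarrow> 2d - m(\<phi>)\<close> and \<open>I(w) \<rightarrow> - I(\<phi>)\<close>. The inequality above for \<open>\<phi>\<close>
  and \<open>m(\<phi>) \<le> 2d\<close> give \<open>I(\<phi>) \<ge> 0\<close>; the same inequality for \<open>w\<close> then excludes \<open>m(\<phi>) < 2d\<close>. Hence \<open>w\<close>
  tends to zero in \<open>L\<^sup>2\<close>, the tail estimate makes the positive part of \<open>e(w)\<close> vanish, which forces first
  \<open>I(\<phi>) = 0\<close> and then \<open>k(w) \<rightarrow> 0\<close> and \<open>\<integral> |f(|w|)| \<rightarrow> 0\<close>. This is convergence in both parts of the norm
  of \<open>W\<^sup>s\<close>, and \<open>\<phi>\<close> is a ground state.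

  Kinetic terms and frequency cut-offs live on the Fourier side. Plancherel's identity for integrable square integrable functions
  comes from Gaussian regularization, its extension to \<open>L\<^sup>2\<close> from truncation, and surjectivity of the
  transform from the fact that it and its adjoint are both isometries.
\<close>

section \<open>The space of square integrable functions\<close>

abbreviation L2_dist :: "('a::euclidean_space \<Rightarrow> complex) \<Rightarrow> ('a \<Rightarrow> complex) \<Rightarrow> real" where
  "L2_dist u v \<equiv> L2_norm (\<lambda>x. u x - v x)"

lemma L2_measurable [measurable_dest]: "u \<in> L2 \<Longrightarrow> u \<in> borel_measurable borel"
  by (simp add: L2_def)

lemma L2_integrable: "u \<in> L2 \<Longrightarrow> integrable lborel (\<lambda>x. (cmod (u x))\<^sup>2)"
  by (simp add: L2_def)

lemma L2I: "u \<in> borel_measurable borel \<Longrightarrow> integrable lborel (\<lambda>x. (cmod (u x))\<^sup>2) \<Longrightarrow> u \<in> L2"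
  by (simp add: L2_def)

lemma L2_norm_nonneg [simp]: "0 \<le> L2_norm u"
  by (simp add: L2_norm_def)

lemma L2_norm_sq: "(L2_norm u)\<^sup>2 = (LINT x|lborel. (cmod (u x))\<^sup>2)"
  by (simp add: L2_norm_def)

lemma L2_norm_cong_AE:
  assumes "u \<in> borel_measurable borel" "v \<in> borel_measurable borel" "AE x in lborel. u x = v x"
  shows "L2_norm u = L2_norm v"
  unfolding L2_norm_def using assms
  by (intro arg_cong[where f=sqrt] integral_cong_AE) auto

lemma L2_dominated:
  assumes "u \<in> L2" "v \<in> borel_measurable borel" "AE x in lborel. cmod (v x) \<le> cmod (u x)"
  shows "v \<in> L2" "L2_norm v \<le> L2_norm u"
proof -
  have *: "AE x in lborel. norm ((cmod (v x))\<^sup>2) \<le> norm ((cmod (u x))\<^sup>2)"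
    using assms(3) by eventually_elim (auto intro: power_mono)
  show v: "v \<in> L2"
    using assms * by (intro L2I Bochner_Integration.integrable_bound[OF L2_integrable[OF assms(1)] _ *]) auto
  show "L2_norm v \<le> L2_norm u"
    unfolding L2_norm_def
    using * by (intro real_sqrt_le_mono integral_mono_AE L2_integrable v assms) (auto elim!: eventually_mono)
qed

lemma L2_cong_AE:
  assumes "u \<in> L2" "v \<in> borel_measurable borel" "AE x in lborel. u x = v x"
  shows "v \<in> L2"
proof (rule L2_dominated(1)[OF assms(1,2)])
  show "AE x in lborel. cmod (v x) \<le> cmod (u x)" using assms(3) by eventually_elim simp
qed

lemma L2_scale:
  assumes u: "u \<in> L2"
  shows "(\<lambda>x. c * u x) \<in> L2" "L2_norm (\<lambda>x. c * u x) = cmod c * L2_norm u"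
proof -
  show "(\<lambda>x. c * u x) \<in> L2"
    using u L2_integrable[OF u] by (intro L2I) (auto simp: norm_mult power_mult_distrib)
  show "L2_norm (\<lambda>x. c * u x) = cmod c * L2_norm u"
    by (simp add: L2_norm_def norm_mult power_mult_distrib real_sqrt_mult)
qed

lemma L2_bounded_mult:
  assumes u: "u \<in> L2" and m: "m \<in> borel_measurable borel" "\<And>x. cmod (m x) \<le> B"
  shows "(\<lambda>x. m x * u x) \<in> L2" "L2_norm (\<lambda>x. m x * u x) \<le> B * L2_norm u"
proof -
  have B: "0 \<le> B" using m(2) norm_ge_zero order_trans by blast
  have Bu: "(\<lambda>x. of_real B * u x) \<in> L2" using L2_scale[OF u] by blast
  have *: "AE x in lborel. cmod (m x * u x) \<le> cmod (of_real B * u x)"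
    using m(2) B by (auto simp: norm_mult intro!: mult_right_mono)
  have mm: "(\<lambda>x. m x * u x) \<in> borel_measurable borel" using u m(1) by measurable
  show "(\<lambda>x. m x * u x) \<in> L2" using L2_dominated[OF Bu mm *] by blast
  show "L2_norm (\<lambda>x. m x * u x) \<le> B * L2_norm u"
    using L2_dominated(2)[OF Bu mm *] L2_scale(2)[OF u, of "of_real B"] B by simp
qed

lemma L2_add: 
  assumes u: "u \<in> L2" and v: "v \<in> L2"
  shows "(\<lambda>x. u x + v x) \<in> L2"
proof (rule L2I)
  show "(\<lambda>x. u x + v x) \<in> borel_measurable borel" using u v by measurable
  show "integrable lborel (\<lambda>x. (cmod (u x + v x))\<^sup>2)"
  proof (rule Bochner_Integration.integrable_bound)
    show "integrable lborel (\<lambda>x. 2 * (cmod (u x))\<^sup>2 + 2 * (cmod (v x))\<^sup>2)"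
      using u v by (auto simp: L2_integrable)
    show "(\<lambda>x. (cmod (u x + v x))\<^sup>2) \<in> borel_measurable lborel" using u v by measurable
    have "(cmod (a + b))\<^sup>2 \<le> 2 * (cmod a)\<^sup>2 + 2 * (cmod b)\<^sup>2" for a b
    proof -
      have "(cmod (a + b))\<^sup>2 \<le> (cmod a + cmod b)\<^sup>2" by (simp add: norm_triangle_ineq power_mono)
      also have "\<dots> \<le> 2 * (cmod a)\<^sup>2 + 2 * (cmod b)\<^sup>2"
        using zero_le_power2[of "cmod a - cmod b"] by (simp add: power2_eq_square algebra_simps)
      finally show ?thesis .
    qed
    then show "AE x in lborel. norm ((cmod (u x + v x))\<^sup>2) \<le> norm (2 * (cmod (u x))\<^sup>2 + 2 * (cmod (v x))\<^sup>2)"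
      by simp
  qed
qed

lemma L2_diff: 
  assumes u: "u \<in> L2" and v: "v \<in> L2"
  shows "(\<lambda>x. u x - v x) \<in> L2"
  using L2_add[OF u L2_scale(1)[OF v, of "-1"]] by simp

lemma L2_zero [simp]: "(\<lambda>x. 0) \<in> L2" "L2_norm (\<lambda>x. 0) = 0"
  by (auto simp: L2_def L2_norm_def)

lemma cnj_measurable [measurable (raw)]:
  "f \<in> borel_measurable M \<Longrightarrow> (\<lambda>x. cnj (f x)) \<in> borel_measurable M"
  by (rule borel_measurable_continuous_on[where f=cnj]) (auto intro!: continuous_intros)

lemma L2_cnj: "u \<in> L2 \<Longrightarrow> (\<lambda>x. cnj (u x)) \<in> L2"
  by (auto simp: L2_def)

lemma L2_norm_cnj: "L2_norm (\<lambda>x. cnj (u x)) = L2_norm u"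
  by (simp add: L2_norm_def)

lemma L2_prod_integrable:
  assumes u: "u \<in> L2" and v: "v \<in> L2"
  shows "integrable lborel (\<lambda>x. u x * v x)"
proof (rule Bochner_Integration.integrable_bound)
  show "integrable lborel (\<lambda>x. (cmod (u x))\<^sup>2 + (cmod (v x))\<^sup>2)"
    using u v by (auto simp: L2_integrable)
  show "(\<lambda>x. u x * v x) \<in> borel_measurable lborel" using u v by measurable
  have "cmod a * cmod b \<le> (cmod a)\<^sup>2 + (cmod b)\<^sup>2" for a b
  proof -
    have "2 * (cmod a * cmod b) \<le> (cmod a)\<^sup>2 + (cmod b)\<^sup>2"
      using sum_squares_bound[of "cmod a" "cmod b"] by simp
    moreover have "0 \<le> cmod a * cmod b" by simp
    ultimately show ?thesis by linarith
  qed
  then show "AE x in lborel. norm (u x * v x) \<le> norm ((cmod (u x))\<^sup>2 + (cmod (v x))\<^sup>2)"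
    by (simp add: norm_mult)
qed

lemma L2_Cauchy_Schwarz_abs:
  assumes u: "u \<in> L2" and v: "v \<in> L2"
  shows "(LINT x|lborel. cmod (u x) * cmod (v x)) \<le> L2_norm u * L2_norm v"
proof -
  define a b where "a = L2_norm u" and "b = L2_norm v"
  have ab: "0 \<le> a" "0 \<le> b" by (auto simp: a_def b_def)
  have int: "integrable lborel (\<lambda>x. cmod (u x) * cmod (v x))"
    using integrable_norm[OF L2_prod_integrable[OF u v]] by (simp add: norm_mult)
  have main: "2 * (LINT x|lborel. cmod (u x) * cmod (v x)) \<le> 2 * (a * b) + e * (a + b)" if e: "e > 0" for e
  proof -
    \<comment> \<open>AM-GM with the optimal weight \<open>b / a\<close>, regularized by \<open>e\<close> to cover \<open>a = 0\<close> and \<open>b = 0\<close>\<close>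
    define t where "t = (b + e) / (a + e)"
    have t: "t > 0" using ab e by (simp add: t_def add_nonneg_pos)
    have pt: "2 * (p * q) \<le> t * p\<^sup>2 + q\<^sup>2 / t" for p q :: real
    proof -
      have "0 \<le> (t * p - q)\<^sup>2 / t" using t by simp
      also have "(t * p - q)\<^sup>2 / t = t * p\<^sup>2 + q\<^sup>2 / t - 2 * (p * q)"
        using t by (simp add: power2_eq_square field_simps)
      finally show ?thesis by simp
    qed
    have "2 * (LINT x|lborel. cmod (u x) * cmod (v x)) = (LINT x|lborel. 2 * (cmod (u x) * cmod (v x)))"
      by simp
    also have "\<dots> \<le> (LINT x|lborel. t * (cmod (u x))\<^sup>2 + (cmod (v x))\<^sup>2 / t)"
      using int u v by (intro integral_mono) (auto simp: L2_integrable pt)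
    also have "\<dots> = t * a\<^sup>2 + b\<^sup>2 / t"
      using u v by (simp add: L2_integrable a_def b_def L2_norm_sq)
    also have "t * a\<^sup>2 \<le> (b + e) * a"
    proof -
      have "a\<^sup>2 / (a + e) \<le> a" using ab e by (simp add: field_simps power2_eq_square)
      then have "(b + e) * (a\<^sup>2 / (a + e)) \<le> (b + e) * a" using ab e by (intro mult_left_mono) auto
      then show ?thesis by (simp add: t_def)
    qed
    also have "b\<^sup>2 / t \<le> b * (a + e)"
    proof -
      have "b\<^sup>2 / (b + e) \<le> b" using ab e by (simp add: field_simps power2_eq_square)
      then have "(a + e) * (b\<^sup>2 / (b + e)) \<le> (a + e) * b" using ab e by (intro mult_left_mono) auto
      then show ?thesis by (simp add: t_def mult.commute)
    qed
    finally show ?thesis by (simp add: algebra_simps)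
  qed
  have "2 * (LINT x|lborel. cmod (u x) * cmod (v x)) \<le> 2 * (a * b)"
  proof (rule field_le_epsilon)
    fix e :: real assume e: "e > 0"
    have ab1: "a + b + 1 > 0" using ab by linarith
    have "2 * (LINT x|lborel. cmod (u x) * cmod (v x)) \<le> 2 * (a * b) + (e / (a + b + 1)) * (a + b)"
      using main[of "e / (a + b + 1)"] e ab1 by simp
    also have "(e / (a + b + 1)) * (a + b) \<le> e"
      using e ab ab1 by (simp add: field_simps)
    finally show "2 * (LINT x|lborel. cmod (u x) * cmod (v x)) \<le> 2 * (a * b) + e" by simp
  qed
  then show ?thesis by (simp add: a_def b_def)
qed

definition L2_inner :: "('a::euclidean_space \<Rightarrow> complex) \<Rightarrow> ('a \<Rightarrow> complex) \<Rightarrow> complex" where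
  "L2_inner u v = (LINT x|lborel. u x * cnj (v x))"

lemma L2_inner_integrable:
  "u \<in> L2 \<Longrightarrow> v \<in> L2 \<Longrightarrow> integrable lborel (\<lambda>x. u x * cnj (v x))"
  by (intro L2_prod_integrable L2_cnj)

lemma L2_Cauchy_Schwarz:
  assumes u: "u \<in> L2" and v: "v \<in> L2"
  shows "cmod (L2_inner u v) \<le> L2_norm u * L2_norm v"
proof -
  have "cmod (L2_inner u v) \<le> (LINT x|lborel. cmod (u x) * cmod (v x))"
    unfolding L2_inner_def by (rule order_trans[OF integral_norm_bound]) (simp add: norm_mult)
  also have "\<dots> \<le> L2_norm u * L2_norm v" by (rule L2_Cauchy_Schwarz_abs[OF u v])
  finally show ?thesis .
qed

lemma L2_inner_diff_left:
  "u \<in> L2 \<Longrightarrow> v \<in> L2 \<Longrightarrow> w \<in> L2 \<Longrightarrow> L2_inner (\<lambda>x. u x - v x) w = L2_inner u w - L2_inner v w"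
  unfolding L2_inner_def by (simp add: algebra_simps L2_inner_integrable)

lemma L2_inner_diff_right:
  "u \<in> L2 \<Longrightarrow> v \<in> L2 \<Longrightarrow> w \<in> L2 \<Longrightarrow> L2_inner w (\<lambda>x. u x - v x) = L2_inner w u - L2_inner w v"
  unfolding L2_inner_def by (simp add: algebra_simps L2_inner_integrable)

lemma L2_inner_self: "L2_inner u u = of_real ((L2_norm u)\<^sup>2)"
proof -
  have "u x * cnj (u x) = of_real ((cmod (u x))\<^sup>2)" for x by (rule complex_norm_square[symmetric])
  then have "L2_inner u u = (LINT x|lborel. complex_of_real ((cmod (u x))\<^sup>2))"
    by (simp only: L2_inner_def)
  then show ?thesis unfolding L2_norm_sq by (simp only: integral_complex_of_real)
qed

lemma cmod_add_sq: "(cmod (a + b))\<^sup>2 = (cmod a)\<^sup>2 + 2 * Re (a * cnj b) + (cmod b)\<^sup>2"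
  unfolding cmod_power2 by (simp add: power2_eq_square algebra_simps)

lemma L2_norm_add_sq:
  assumes u: "u \<in> L2" and v: "v \<in> L2"
  shows "(L2_norm (\<lambda>x. u x + v x))\<^sup>2 = (L2_norm u)\<^sup>2 + 2 * Re (L2_inner u v) + (L2_norm v)\<^sup>2"
proof -
  have "(L2_norm (\<lambda>x. u x + v x))\<^sup>2 = (LINT x|lborel. (cmod (u x))\<^sup>2 + 2 * Re (u x * cnj (v x)) + (cmod (v x))\<^sup>2)"
    unfolding L2_norm_sq by (intro Bochner_Integration.integral_cong refl cmod_add_sq)
  also have "\<dots> = (L2_norm u)\<^sup>2 + 2 * Re (L2_inner u v) + (L2_norm v)\<^sup>2"
    using L2_inner_integrable[OF u v] L2_integrable[OF u] L2_integrable[OF v]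
    by (simp add: L2_norm_sq L2_inner_def del: Re_complex_of_real times_complex.sel)
  finally show ?thesis .
qed

lemma L2_norm_diff_sq:
  assumes u: "u \<in> L2" and v: "v \<in> L2"
  shows "(L2_dist u v)\<^sup>2 = (L2_norm u)\<^sup>2 - 2 * Re (L2_inner u v) + (L2_norm v)\<^sup>2"
  using L2_norm_add_sq[OF u L2_scale(1)[OF v, of "-1"]] L2_scale(2)[OF v, of "-1"]
  by (simp add: L2_inner_def)

lemma L2_norm_triangle:
  assumes u: "u \<in> L2" and v: "v \<in> L2"
  shows "L2_norm (\<lambda>x. u x + v x) \<le> L2_norm u + L2_norm v"
proof (rule power2_le_imp_le)
  have "Re (L2_inner u v) \<le> L2_norm u * L2_norm v"
    using L2_Cauchy_Schwarz[OF u v] complex_Re_le_cmod order_trans by blast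
  then show "(L2_norm (\<lambda>x. u x + v x))\<^sup>2 \<le> (L2_norm u + L2_norm v)\<^sup>2"
    unfolding L2_norm_add_sq[OF u v] by (simp add: power2_sum)
qed simp

lemma L2_norm_diff_triangle:
  assumes u: "u \<in> L2" and v: "v \<in> L2" and w: "w \<in> L2"
  shows "L2_dist u w \<le> L2_dist u v + L2_dist v w"
  using L2_norm_triangle[OF L2_diff[OF u v] L2_diff[OF v w]] by simp

lemma L2_norm_minus_commute: "L2_dist u v = L2_dist v u"
  by (simp add: L2_norm_def norm_minus_commute)

lemma L2_norm_diff_abs:
  assumes u: "u \<in> L2" and v: "v \<in> L2"
  shows "\<bar>L2_norm u - L2_norm v\<bar> \<le> L2_dist u v"
  using L2_norm_triangle[OF L2_diff[OF u v] v] L2_norm_triangle[OF L2_diff[OF v u] u] L2_norm_minus_commute[of u v]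
  by simp

lemma L2_norm_eq_0_iff:
  assumes u: "u \<in> L2"
  shows "L2_norm u = 0 \<longleftrightarrow> (AE x in lborel. u x = 0)"
proof -
  have "L2_norm u = 0 \<longleftrightarrow> (LINT x|lborel. (cmod (u x))\<^sup>2) = 0" by (simp add: L2_norm_def)
  also have "\<dots> \<longleftrightarrow> (AE x in lborel. (cmod (u x))\<^sup>2 = 0)"
    by (rule integral_nonneg_eq_0_iff_AE) (use u in \<open>auto simp: L2_integrable\<close>)
  finally show ?thesis by simp
qed

lemma integral_Fatou:
  fixes f :: "nat \<Rightarrow> 'b \<Rightarrow> real"
  assumes f: "\<And>n. integrable M (f n)" "\<And>n x. 0 \<le> f n x"
    and g [measurable]: "g \<in> borel_measurable M"
    and lim: "AE x in M. (\<lambda>n. f n x) \<longlonglongrightarrow> g x"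
    and B: "eventually (\<lambda>n. integral\<^sup>L M (f n) \<le> B) sequentially"
  shows "integrable M g" "integral\<^sup>L M g \<le> B"
proof -
  have g0: "AE x in M. 0 \<le> g x"
    using lim by eventually_elim (auto intro: LIMSEQ_le_const f(2))
  have B0: "0 \<le> B"
  proof -
    obtain n where "integral\<^sup>L M (f n) \<le> B" using B by (auto simp: eventually_sequentially)
    then show ?thesis using Bochner_Integration.integral_nonneg[of M "f n"] f(2) by (meson order_trans)
  qed
  have "(\<integral>\<^sup>+x. ennreal (g x) \<partial>M) = (\<integral>\<^sup>+x. liminf (\<lambda>n. ennreal (f n x)) \<partial>M)"
    using lim by (intro nn_integral_cong_AE) (auto elim!: eventually_mono intro!: lim_imp_Liminf[symmetric])
  also have "\<dots> \<le> liminf (\<lambda>n. \<integral>\<^sup>+x. ennreal (f n x) \<partial>M)"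
    using f(1) by (intro nn_integral_liminf) auto
  also have "\<dots> \<le> liminf (\<lambda>n. ennreal B)"
    using B by (intro Liminf_mono) (auto elim!: eventually_mono simp: nn_integral_eq_integral f intro!: ennreal_leI)
  also have "\<dots> = ennreal B" by (simp add: Liminf_const)
  finally have *: "(\<integral>\<^sup>+x. ennreal (g x) \<partial>M) \<le> ennreal B" .
  show i: "integrable M g"
  proof (rule integrableI_bounded[OF g])
    have "(\<integral>\<^sup>+x. ennreal (norm (g x)) \<partial>M) = (\<integral>\<^sup>+x. ennreal (g x) \<partial>M)"
      using g0 by (intro nn_integral_cong_AE) (auto elim!: eventually_mono)
    then show "(\<integral>\<^sup>+x. ennreal (norm (g x)) \<partial>M) < \<infinity>" using * by (simp add: order_le_less_trans ennreal_less_top)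
  qed
  show "integral\<^sup>L M g \<le> B"
    using * B0 by (simp add: nn_integral_eq_integral[OF i g0])
qed

lemma L2_Fatou:
  assumes u: "\<And>n::nat. u n \<in> L2" and v: "v \<in> borel_measurable borel"
    and lim: "AE x in lborel. (\<lambda>n. u n x) \<longlonglongrightarrow> v x"
    and B: "eventually (\<lambda>n. L2_norm (u n) \<le> B) sequentially"
  shows "v \<in> L2" "L2_norm v \<le> B"
proof -
  have B0: "0 \<le> B" 
  proof -
    obtain n where "L2_norm (u n) \<le> B" using B by (auto simp: eventually_sequentially)
    then show ?thesis using L2_norm_nonneg order_trans by blast
  qed
  have lim': "AE x in lborel. (\<lambda>n. (cmod (u n x))\<^sup>2) \<longlonglongrightarrow> (cmod (v x))\<^sup>2"
    using lim by eventually_elim (intro tendsto_intros)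
  have B': "eventually (\<lambda>n. (LINT x|lborel. (cmod (u n x))\<^sup>2) \<le> B\<^sup>2) sequentially"
    using B by eventually_elim (simp add: L2_norm_sq[symmetric] power_mono)
  note F = integral_Fatou[OF L2_integrable[OF u] _ _ lim' B']
  show v2: "v \<in> L2" using v F(1) by (intro L2I) auto
  show "L2_norm v \<le> B"
    using F(2) v B0 by (auto intro: power2_le_imp_le simp: L2_norm_sq)
qed

text \<open>The map \<open>z \<mapsto> |z| z\<close> sends \<open>L\<^sup>2\<close> to \<open>L\<^sup>1\<close> and has a Hoelder continuous inverse. It transfers
  completeness and continuity of translations from \<open>L\<^sup>1\<close> to \<open>L\<^sup>2\<close>.\<close>

definition signed_square :: "complex \<Rightarrow> complex" where
  "signed_square z = of_real (cmod z) * z"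

lemma signed_square_measurable [measurable]: "signed_square \<in> borel_measurable borel"
  unfolding signed_square_def by measurable

lemma cmod_signed_square: "cmod (signed_square z) = (cmod z)\<^sup>2"
  by (simp add: signed_square_def norm_mult power2_eq_square)

text \<open>The map is strongly monotone:
  \<open>2 Re ((|a| a - |b| b) cnj (a - b)) = (|a| + |b|) |a - b|\<^sup>2 + (|a| - |b|)\<^sup>2 (|a| + |b|)\<close>, and \<open>|a| + |b| \<ge> |a - b|\<close>.\<close>

lemma signed_square_inverse_Holder:
  "(cmod (a - b))\<^sup>2 \<le> 2 * cmod (signed_square a - signed_square b)"
proof (cases "a = b")
  case False
  let ?A = "cmod a" and ?B = "cmod b"
  let ?ip = "Re ((signed_square a - signed_square b) * cnj (a - b))"
  have c: "Re (a * cnj b) * 2 = ?A\<^sup>2 + ?B\<^sup>2 - (cmod (a - b))\<^sup>2"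
    using cmod_add_sq[of a "- b"] by simp
  have "2 * ?ip = 2 * ?A ^ 3 + 2 * ?B ^ 3 - (?A + ?B) * (Re (a * cnj b) * 2)"
  proof -
    have sq: "a * cnj a = of_real (?A\<^sup>2)" "b * cnj b = of_real (?B\<^sup>2)"
      by (rule complex_norm_square[symmetric])+
    have "(signed_square a - signed_square b) * cnj (a - b) =
      of_real ?A * (a * cnj a) + of_real ?B * (b * cnj b) - of_real ?A * (a * cnj b) - of_real ?B * (b * cnj a)"
      by (simp add: signed_square_def algebra_simps)
    also have "\<dots> = of_real (?A * ?A\<^sup>2 + ?B * ?B\<^sup>2) - of_real ?A * (a * cnj b) - of_real ?B * (b * cnj a)"
      unfolding sq by simp
    finally have eq: "(signed_square a - signed_square b) * cnj (a - b) = \<dots>" .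
    have "Re (b * cnj a) = Re (a * cnj b)" by (simp add: algebra_simps)
    then have "?ip = ?A * ?A\<^sup>2 + ?B * ?B\<^sup>2 - ?A * Re (a * cnj b) - ?B * Re (a * cnj b)"
      unfolding eq minus_complex.sel Re_complex_of_real by (simp add: scaleR_conv_of_real[symmetric])
    then show ?thesis by (simp add: power2_eq_square power3_eq_cube algebra_simps)
  qed
  also have "\<dots> = (?A + ?B) * (cmod (a - b))\<^sup>2 + (?A - ?B)\<^sup>2 * (?A + ?B)"
    unfolding c by (simp add: power2_eq_square power3_eq_cube algebra_simps)
  also have "\<dots> \<ge> cmod (a - b) * (cmod (a - b))\<^sup>2"
    using norm_triangle_ineq4[of a b] mult_right_mono[of "cmod (a - b)" "?A + ?B" "(cmod (a - b))\<^sup>2"]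
    by (smt (verit) norm_ge_zero zero_le_mult_iff zero_le_power2)
  finally have "cmod (a - b) * (cmod (a - b))\<^sup>2 \<le> 2 * ?ip" .
  also have "?ip \<le> cmod (signed_square a - signed_square b) * cmod (a - b)"
    by (metis complex_Re_le_cmod norm_mult complex_mod_cnj)
  finally have "cmod (a - b) * (cmod (a - b))\<^sup>2 \<le> cmod (a - b) * (2 * cmod (signed_square a - signed_square b))"
    by (simp add: mult_ac)
  then show ?thesis using False by (simp add: mult_le_cancel_left)
qed simp

lemma signed_square_Lipschitz:
  "cmod (signed_square a - signed_square b) \<le> (cmod a + cmod b) * cmod (a - b)"
proof -
  have "signed_square a - signed_square b = of_real (cmod a) * (a - b) + of_real (cmod a - cmod b) * b"
    by (simp add: signed_square_def algebra_simps)
  also have "cmod \<dots> \<le> cmod a * cmod (a - b) + \<bar>cmod a - cmod b\<bar> * cmod b"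
    by (rule order_trans[OF norm_triangle_ineq]) (simp add: norm_mult del: of_real_diff)
  also have "\<dots> \<le> cmod a * cmod (a - b) + cmod (a - b) * cmod b"
    by (intro add_left_mono mult_right_mono norm_triangle_ineq3) auto
  finally show ?thesis by (simp add: algebra_simps)
qed

lemma L2_signed_square_integrable:
  assumes "u \<in> L2" shows "integrable lborel (\<lambda>x. signed_square (u x))"
proof -
  have "(\<lambda>x. signed_square (u x)) \<in> borel_measurable lborel" using assms by measurable
  then show ?thesis
    using L2_integrable[OF assms] by (subst integrable_norm_iff[symmetric]) (auto simp: cmod_signed_square)
qed

lemma L2_AE_subseq:
  assumes u: "\<And>n::nat. u n \<in> L2" and v: "v \<in> L2" and lim: "(\<lambda>n. L2_dist (u n) v) \<longlonglongrightarrow> 0"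
  obtains r where "strict_mono (r :: nat \<Rightarrow> nat)" "AE x in lborel. (\<lambda>n. u (r n) x) \<longlonglongrightarrow> v x"
proof -
  have *: "(\<lambda>n. LINT x|lborel. norm ((cmod (u n x - v x))\<^sup>2)) \<longlonglongrightarrow> 0"
    using tendsto_power[OF lim, of 2] by (simp add: L2_norm_sq)
  have "\<exists>r. strict_mono r \<and> (AE x in lborel. (\<lambda>n. (cmod (u (r n) x - v x))\<^sup>2) \<longlonglongrightarrow> 0)"
    using tendsto_L1_AE_subseq[OF L2_integrable[OF L2_diff[OF u v]] *] by blast
  then obtain r where r: "strict_mono r" "AE x in lborel. (\<lambda>n. (cmod (u (r n) x - v x))\<^sup>2) \<longlonglongrightarrow> 0" by blast
  have "AE x in lborel. (\<lambda>n. u (r n) x) \<longlonglongrightarrow> v x"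
    using r(2)
  proof eventually_elim
    case (elim x)
    have "(\<lambda>n. sqrt ((cmod (u (r n) x - v x))\<^sup>2)) \<longlonglongrightarrow> sqrt 0"
      using elim by (intro tendsto_intros)
    then show ?case by (simp add: tendsto_norm_zero_iff LIM_zero_iff)
  qed
  then show ?thesis using r that by blast
qed

text \<open>The signed squares form a Cauchy sequence in \<open>L\<^sup>1\<close>, so a subsequence of them is Cauchy almost
  everywhere; inverting the signed square gives a pointwise limit, and Fatou makes it an \<open>L\<^sup>2\<close> limit.\<close>

lemma L2_complete:
  assumes u: "\<And>n::nat. u n \<in> L2"
    and C: "\<And>e. e > 0 \<Longrightarrow> \<exists>N. \<forall>i\<ge>N. \<forall>j\<ge>N. L2_dist (u i) (u j) < e"
  obtains v where "v \<in> L2" "(\<lambda>n. L2_dist (u n) v) \<longlonglongrightarrow> 0"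
proof -
  have meas [measurable]: "\<And>n. u n \<in> borel_measurable borel" using u by (auto intro: L2_measurable)
  have abs: "(\<lambda>x. of_real (cmod (u i x))) \<in> L2" for i
    by (rule L2_dominated(1)[OF u[of i]]) auto
  obtain N1 where N1: "\<And>i j. i \<ge> N1 \<Longrightarrow> j \<ge> N1 \<Longrightarrow> L2_dist (u i) (u j) < 1"
    using C[of 1] by auto
  define K where "K = L2_norm (u N1) + 1"
  have K: "L2_norm (u i) \<le> K" if "i \<ge> N1" for i
    using L2_norm_diff_abs[OF u u, of i N1] N1[OF that, of N1] by (simp add: K_def)
  have K0: "K > 0" by (simp add: K_def add_nonneg_pos)
  have C': "\<exists>N. \<forall>i\<ge>N. \<forall>j\<ge>N. LINT x|lborel. norm (signed_square (u i x) - signed_square (u j x)) < e"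
    if e: "e > 0" for e
  proof -
    obtain N2 where N2: "\<And>i j. i \<ge> N2 \<Longrightarrow> j \<ge> N2 \<Longrightarrow> L2_dist (u i) (u j) < e / (2 * K)"
      using C[of "e / (2 * K)"] K0 e by auto
    have "LINT x|lborel. norm (signed_square (u i x) - signed_square (u j x)) < e"
      if i: "i \<ge> max N1 N2" and j: "j \<ge> max N1 N2" for i j
    proof -
      let ?w = "\<lambda>x. complex_of_real (cmod (u i x)) + of_real (cmod (u j x))"
      have w: "?w \<in> L2" by (intro L2_add abs)
      have d: "(\<lambda>x. u i x - u j x) \<in> L2" by (intro L2_diff u)
      have cw: "cmod (?w x) = cmod (u i x) + cmod (u j x)" for x
        unfolding of_real_add[symmetric] norm_of_real by simp
      have na: "L2_norm (\<lambda>x. complex_of_real (cmod (u i x))) = L2_norm (u i)" for i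
        by (simp add: L2_norm_def)
      have "LINT x|lborel. norm (signed_square (u i x) - signed_square (u j x))
          \<le> LINT x|lborel. cmod (?w x) * cmod (u i x - u j x)"
        using integrable_norm[OF L2_prod_integrable[OF w d]] cw
        by (intro integral_mono integrable_norm Bochner_Integration.integrable_diff L2_signed_square_integrable u)
           (auto simp: norm_mult signed_square_Lipschitz)
      also have "\<dots> \<le> L2_norm ?w * L2_dist (u i) (u j)" by (rule L2_Cauchy_Schwarz_abs[OF w d])
      also have "\<dots> \<le> (2 * K) * L2_dist (u i) (u j)"
        using L2_norm_triangle[OF abs abs, of i j] K[of i] K[of j] i j
        by (intro mult_right_mono) (auto simp: na)
      also have "\<dots> < (2 * K) * (e / (2 * K))"
        using K0 i j by (intro mult_strict_left_mono N2) auto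
      finally show ?thesis using K0 by simp
    qed
    then show ?thesis by blast
  qed
  obtain r where r: "strict_mono r" "AE x in lborel. Cauchy (\<lambda>i. signed_square (u (r i) x))"
    using cauchy_L1_AE_cauchy_subseq[OF L2_signed_square_integrable[OF u] C'] by blast
  define v where "v x = lim (\<lambda>n. u (r n) x)" for x
  have vm [measurable]: "v \<in> borel_measurable borel"
    unfolding v_def by (rule borel_measurable_lim_metric) simp
  have conv: "AE x in lborel. (\<lambda>n. u (r n) x) \<longlonglongrightarrow> v x"
    using r(2)
  proof eventually_elim
    case (elim x)
    have "Cauchy (\<lambda>n. u (r n) x)"
    proof (rule CauchyI)
      fix e :: real assume e: "e > 0"
      obtain M where M: "\<And>m n. m \<ge> M \<Longrightarrow> n \<ge> M \<Longrightarrow> cmod (signed_square (u (r m) x) - signed_square (u (r n) x)) < e\<^sup>2 / 2"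
        using CauchyD[OF elim, of "e\<^sup>2 / 2"] e by auto
      have "cmod (u (r m) x - u (r n) x) < e" if "m \<ge> M" "n \<ge> M" for m n
        using signed_square_inverse_Holder[of "u (r m) x" "u (r n) x"] M[OF that] e
        by (intro power2_less_imp_less[where y=e]) auto
      then show "\<exists>M. \<forall>m\<ge>M. \<forall>n\<ge>M. norm (u (r m) x - u (r n) x) < e" by blast
    qed
    then show ?case unfolding v_def by (simp add: Cauchy_convergent_iff convergent_LIMSEQ_iff)
  qed
  have v: "v \<in> L2"
    by (rule L2_Fatou(1)[where u="\<lambda>n. u (r n)", OF u vm conv])
       (auto simp: eventually_sequentially intro!: exI[of _ N1] K order_trans[OF _ seq_suble[OF r(1)]])
  have "(\<lambda>n. L2_dist (u n) v) \<longlonglongrightarrow> 0"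
  proof (rule LIMSEQ_I)
    fix e :: real assume e: "e > 0"
    obtain N where N: "\<And>i j. i \<ge> N \<Longrightarrow> j \<ge> N \<Longrightarrow> L2_dist (u i) (u j) < e / 2"
      using C[of "e / 2"] e by auto
    have "L2_dist (u n) v \<le> e / 2" if n: "n \<ge> N" for n
    proof (rule L2_Fatou(2)[where u="\<lambda>k x. u n x - u (r k) x"])
      show "AE x in lborel. (\<lambda>k. u n x - u (r k) x) \<longlonglongrightarrow> u n x - v x"
        using conv by eventually_elim (intro tendsto_intros)
      show "eventually (\<lambda>k. L2_dist (u n) (u (r k)) \<le> e / 2) sequentially"
        using N[OF n] by (auto simp: eventually_sequentially intro!: exI[of _ N] less_imp_le order_trans[OF _ seq_suble[OF r(1)]])
    qed (use u v L2_diff in auto)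
    then show "\<exists>no. \<forall>n\<ge>no. norm (L2_dist (u n) v - 0) < e"
      using e by (intro exI[of _ N]) (force intro: le_less_trans)
  qed
  then show ?thesis using v that by blast
qed

lemma L2_translate:
  assumes u: "u \<in> L2" shows "(\<lambda>x. u (x + h)) \<in> L2" "L2_norm (\<lambda>x. u (x + h)) = L2_norm u"
proof -
  have [measurable]: "u \<in> borel_measurable borel" using u by measurable
  have "(\<lambda>x. x + h) = (+) h" by (auto simp: add.commute)
  then have l: "lborel = distr lborel borel (\<lambda>x. x + h)"
    using lborel_distr_plus[of h] by simp
  have "integrable lborel (\<lambda>x. (cmod (u x))\<^sup>2)" using u by (rule L2_integrable)
  then have "integrable (distr lborel borel (\<lambda>x. x + h)) (\<lambda>x. (cmod (u x))\<^sup>2)" using l by simp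
  then show "(\<lambda>x. u (x + h)) \<in> L2"
    by (subst (asm) integrable_distr_eq) (auto intro!: L2I)
  show "L2_norm (\<lambda>x. u (x + h)) = L2_norm u"
    unfolding L2_norm_def by (subst (2) l) (subst integral_distr, auto)
qed

section \<open>Continuity of translations\<close>

lemma lborel_affine_integral:
  fixes f :: "'a::euclidean_space \<Rightarrow> 'b::{banach, second_countable_topology}"
  assumes c: "c \<noteq> 0" and f [measurable]: "f \<in> borel_measurable borel"
  shows "(LINT x|lborel. f x) = (\<bar>c\<bar> ^ DIM('a)) *\<^sub>R (LINT x|lborel. f (t + c *\<^sub>R x))"
    and "integrable lborel f \<longleftrightarrow> integrable lborel (\<lambda>x. f (t + c *\<^sub>R x))"
proof -
  have l: "lborel = density (distr lborel borel (\<lambda>x. t + c *\<^sub>R x)) (\<lambda>_. \<bar>c\<bar>^DIM('a))"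
    using lborel_affine[OF c, of t] by simp
  have "(LINT x|lborel. f x) = (LINT x|distr lborel borel (\<lambda>x. t + c *\<^sub>R x). \<bar>c\<bar>^DIM('a) *\<^sub>R f x)"
    by (subst l, subst integral_density) auto
  also have "\<dots> = (LINT x|lborel. \<bar>c\<bar>^DIM('a) *\<^sub>R f (t + c *\<^sub>R x))"
    by (subst integral_distr) auto
  finally show "(LINT x|lborel. f x) = (\<bar>c\<bar> ^ DIM('a)) *\<^sub>R (LINT x|lborel. f (t + c *\<^sub>R x))" by simp
  have "integrable lborel f \<longleftrightarrow> integrable (distr lborel borel (\<lambda>x. t + c *\<^sub>R x)) (\<lambda>x. \<bar>c\<bar>^DIM('a) *\<^sub>R f x)"
    by (subst l, subst integrable_density) auto
  also have "\<dots> \<longleftrightarrow> integrable lborel (\<lambda>x. \<bar>c\<bar>^DIM('a) *\<^sub>R f (t + c *\<^sub>R x))"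
    by (subst integrable_distr_eq) auto
  also have "\<dots> \<longleftrightarrow> integrable lborel (\<lambda>x. f (t + c *\<^sub>R x))"
  proof
    assume i: "integrable lborel (\<lambda>x. \<bar>c\<bar>^DIM('a) *\<^sub>R f (t + c *\<^sub>R x))"
    have "integrable lborel (\<lambda>x. inverse (\<bar>c\<bar>^DIM('a)) *\<^sub>R (\<bar>c\<bar>^DIM('a) *\<^sub>R f (t + c *\<^sub>R x)))"
      by (rule integrable_scaleR_right) (rule i)
    then show "integrable lborel (\<lambda>x. f (t + c *\<^sub>R x))" using c by simp
  qed (intro integrable_scaleR_right)
  finally show "integrable lborel f \<longleftrightarrow> integrable lborel (\<lambda>x. f (t + c *\<^sub>R x))" .
qed

lemma lborel_translation_integral:
  fixes f :: "'a::euclidean_space \<Rightarrow> 'b::{banach, second_countable_topology}"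
  assumes f [measurable]: "f \<in> borel_measurable borel"
  shows "(LINT x|lborel. f (x + t)) = (LINT x|lborel. f x)"
    and "integrable lborel (\<lambda>x. f (x + t)) \<longleftrightarrow> integrable lborel f"
  using lborel_affine_integral[of 1 f t] by (simp_all add: add.commute)

lemma real_tendsto_zero_bound:
  fixes f g :: "nat \<Rightarrow> real"
  assumes "\<And>n. 0 \<le> f n" "\<And>n. f n \<le> g n" "g \<longlonglongrightarrow> 0"
  shows "f \<longlonglongrightarrow> 0"
  by (rule tendsto_sandwich[of "\<lambda>_. 0" f sequentially g]) (use assms in auto)

text \<open>For the indicator of an open set \<open>U\<close> the products \<open>1\<^sub>U(x + h) 1\<^sub>U(x)\<close> converge pointwise, which
  settles this case; outer regularity passes to Borel sets of finite measure, and linearity and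
  approximation to integrable functions.\<close>

lemma L1_translation_continuous:
  fixes f :: "'a::euclidean_space \<Rightarrow> complex" and h :: "nat \<Rightarrow> 'a"
  assumes "integrable lborel f" and h: "h \<longlonglongrightarrow> 0"
  shows "(\<lambda>n. LINT x|lborel. cmod (f (x + h n) - f x)) \<longlonglongrightarrow> 0"
  using assms(1)
proof induction
  case (base A c)
  have Am [measurable]: "A \<in> sets borel" using base by simp
  let ?d = "\<lambda>B n. LINT x|lborel. \<bar>indicator B (x + h n) - indicator B x :: real\<bar>"
  have ind_int: "integrable lborel (indicator B :: 'a \<Rightarrow> real)" if "B \<in> sets borel" "emeasure lborel B < \<infinity>" for B :: "'a set"
    using that by (simp add: integrable_indicator_iff)
  have ind_int': "integrable lborel (\<lambda>x. indicator B (x + t) :: real)" if "B \<in> sets borel" "emeasure lborel B < \<infinity>" for B :: "'a set" and t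
    by (subst lborel_translation_integral(2)) (use ind_int[OF that] that in auto)
  have openlim: "?d U \<longlonglongrightarrow> 0" if U: "open U" "emeasure lborel U < \<infinity>" for U
  proof -
    have Um [measurable]: "U \<in> sets borel" using U by simp
    have "(\<lambda>n. LINT x|lborel. indicator U (x + h n) * indicator U x :: real) \<longlonglongrightarrow> (LINT x|lborel. indicator U x)"
    proof (rule integral_dominated_convergence[where w="indicator U"])
      show "AE x in lborel. (\<lambda>n. indicator U (x + h n) * indicator U x :: real) \<longlonglongrightarrow> indicator U x"
      proof (rule AE_I2)
        fix x
        show "(\<lambda>n. indicator U (x + h n) * indicator U x :: real) \<longlonglongrightarrow> indicator U x"
        proof (cases "x \<in> U")
          case True
          have "(\<lambda>n. x + h n) \<longlonglongrightarrow> x + 0" using h by (intro tendsto_intros)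
          then have "eventually (\<lambda>n. x + h n \<in> U) sequentially"
            using U True by (simp add: topological_tendstoD)
          then show ?thesis using True
            by (intro tendsto_eventually) (auto elim!: eventually_mono)
        qed simp
      qed
      show "integrable lborel (indicator U :: 'a \<Rightarrow> real)" using ind_int U by simp
    qed (auto simp: indicator_def)
    then have "(\<lambda>n. 2 * (LINT x|lborel. indicator U x) - 2 * (LINT x|lborel. indicator U (x + h n) * indicator U x :: real))
        \<longlonglongrightarrow> 2 * (LINT x|lborel. indicator U x) - 2 * (LINT x|lborel. indicator U x)"
      by (intro tendsto_intros)
    moreover
    \<comment> \<open>on indicators, \<open>|a - b| = a + b - 2 a b\<close>\<close>
    have "?d U n = 2 * (LINT x|lborel. indicator U x) - 2 * (LINT x|lborel. indicator U (x + h n) * indicator U x :: real)" for n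
    proof -
      have i3: "integrable lborel (\<lambda>x. indicator U (x + h n) * indicator U x :: real)"
        by (rule Bochner_Integration.integrable_bound[OF ind_int[of U]]) (use U in \<open>auto simp: indicator_def\<close>)
      have "?d U n = (LINT x|lborel. indicator U (x + h n) + indicator U x - 2 * (indicator U (x + h n) * indicator U x :: real))"
        by (intro Bochner_Integration.integral_cong refl) (simp add: indicator_def)
      also have "\<dots> = (LINT x|lborel. indicator U (x + h n)) + (LINT x|lborel. indicator U x) - 2 * (LINT x|lborel. indicator U (x + h n) * indicator U x :: real)"
        using i3 ind_int[of U] ind_int'[of U "h n"] U by simp
      also have "(LINT x|lborel. indicator U (x + h n) :: real) = (LINT x|lborel. indicator U x)"
        by (rule lborel_translation_integral(1)) measurable
      finally show ?thesis by simp
    qed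
    ultimately show ?thesis by simp
  qed
  have "?d A \<longlonglongrightarrow> 0"
  proof (rule LIMSEQ_I)
    fix e :: real assume e: "e > 0"
    obtain U where U: "open U" "A \<subseteq> U" "emeasure lborel (U - A) < ennreal (e / 4)"
      using outer_regular_lborel[OF Am, of "e / 4"] e by auto
    have Um [measurable]: "U \<in> sets borel" using U by simp
    have UA: "emeasure lborel (U - A) < \<infinity>" using U(3) by (metis ennreal_less_top order_less_trans infinity_ennreal_def)
    have Uf: "emeasure lborel U < \<infinity>"
    proof -
      have "emeasure lborel U \<le> emeasure lborel (U - A) + emeasure lborel A"
        using emeasure_subadditive[of "U - A" lborel A] U(2) by (simp add: Un_absorb2)
      also have "\<dots> < \<infinity>" using UA base by simp
      finally show ?thesis .
    qed
    obtain N where N: "\<And>n. n \<ge> N \<Longrightarrow> ?d U n < e / 2"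
      using LIMSEQ_D[OF openlim[OF U(1) Uf], of "e / 2"] e by auto
    have bound: "?d A n < e" if n: "n \<ge> N" for n
    proof -
      have int1: "integrable lborel (\<lambda>x. \<bar>indicator U (x + h n) - indicator U x :: real\<bar>)"
        using ind_int[of U] ind_int'[of U "h n"] Uf by (intro integrable_abs Bochner_Integration.integrable_diff) auto
      have int2: "integrable lborel (\<lambda>x. indicator (U - A) (x + h n) :: real)" using ind_int' UA by simp
      have int3: "integrable lborel (\<lambda>x. indicator (U - A) x :: real)" using ind_int UA by simp
      have "?d A n \<le> (LINT x|lborel. \<bar>indicator U (x + h n) - indicator U x :: real\<bar> + (indicator (U - A) (x + h n) + indicator (U - A) x))"
      proof (rule integral_mono)
        show "integrable lborel (\<lambda>x. \<bar>indicator A (x + h n) - indicator A x :: real\<bar>)"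
          using ind_int[of A] ind_int'[of A "h n"] base by (intro integrable_abs Bochner_Integration.integrable_diff) auto
        show "integrable lborel (\<lambda>x. \<bar>indicator U (x + h n) - indicator U x :: real\<bar> + (indicator (U - A) (x + h n) + indicator (U - A) x))"
          by (intro Bochner_Integration.integrable_add int1 int2 int3)
        show "\<bar>indicator A (x + h n) - indicator A x :: real\<bar> \<le> \<bar>indicator U (x + h n) - indicator U x :: real\<bar> + (indicator (U - A) (x + h n) + indicator (U - A) x)" for x
          using U(2) by (auto simp: indicator_def)
      qed
      also have "\<dots> = ?d U n + ((LINT x|lborel. indicator (U - A) (x + h n)) + (LINT x|lborel. indicator (U - A) x :: real))"
        using int1 int2 int3 by simp
      also have "(LINT x|lborel. indicator (U - A) (x + h n) :: real) = (LINT x|lborel. indicator (U - A) x)"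
        by (rule lborel_translation_integral(1)) measurable
      also have "(LINT x|lborel. indicator (U - A) x :: real) = measure lborel (U - A)" by simp
      also have "measure lborel (U - A) < e / 4"
        using U(3) e UA by (simp add: emeasure_eq_ennreal_measure ennreal_less_iff less_top)
      finally show ?thesis using N[OF n] by simp
    qed
    show "\<exists>no. \<forall>n\<ge>no. norm (?d A n - 0) < e"
      using bound by (auto intro!: exI[of _ N])
  qed
  then have "(\<lambda>n. cmod c * ?d A n) \<longlonglongrightarrow> cmod c * 0" by (intro tendsto_intros)
  moreover have "cmod (indicator A (x + h n) *\<^sub>R c - indicator A x *\<^sub>R c) = cmod c * \<bar>indicator A (x + h n) - indicator A x :: real\<bar>" for x n
    unfolding scaleR_diff_left[symmetric] norm_scaleR by simp
  ultimately show ?case by simp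
next
  case (add f g)
  have m [measurable]: "f \<in> borel_measurable borel" "g \<in> borel_measurable borel" using add by auto
  have i: "integrable lborel (\<lambda>x. cmod (f (x + t) - f x))" "integrable lborel (\<lambda>x. cmod (g (x + t) - g x))" for t
    using add by (auto intro!: integrable_norm Bochner_Integration.integrable_diff simp: lborel_translation_integral)
  have i': "integrable lborel (\<lambda>x. cmod (f (x + t) + g (x + t) - (f x + g x)))" for t
    using add by (auto intro!: integrable_norm Bochner_Integration.integrable_diff Bochner_Integration.integrable_add simp: lborel_translation_integral)
  show ?case
  proof (rule real_tendsto_zero_bound)
    fix n
    have "(LINT x|lborel. cmod (f (x + h n) + g (x + h n) - (f x + g x)))
      \<le> (LINT x|lborel. cmod (f (x + h n) - f x) + cmod (g (x + h n) - g x))"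
      using i i' by (intro integral_mono Bochner_Integration.integrable_add) (auto simp: add_diff_add norm_triangle_ineq)
    then show "(LINT x|lborel. cmod (f (x + h n) + g (x + h n) - (f x + g x)))
     \<le> (LINT x|lborel. cmod (f (x + h n) - f x)) + (LINT x|lborel. cmod (g (x + h n) - g x))"
      using i by simp
  next
    show "(\<lambda>n. (LINT x|lborel. cmod (f (x + h n) - f x)) + (LINT x|lborel. cmod (g (x + h n) - g x))) \<longlonglongrightarrow> 0"
      using tendsto_add[OF add.IH] by simp
  qed simp
next
  case (lim f s)
  have m [measurable]: "f \<in> borel_measurable borel" "\<And>i. s i \<in> borel_measurable borel" using lim by auto
  have sf: "integrable lborel (\<lambda>x. cmod (s i x - f x))" for i 
    using lim by (auto intro!: integrable_norm Bochner_Integration.integrable_diff)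
  have sf': "integrable lborel (\<lambda>x. cmod (s i (x + t) - f (x + t)))" for i t
    by (subst lborel_translation_integral(2)[of "\<lambda>x. cmod (s i x - f x)"]) (use sf in auto)
  have ss: "integrable lborel (\<lambda>x. cmod (s i (x + t) - s i x))" for t i
    using lim by (auto intro!: integrable_norm Bochner_Integration.integrable_diff simp: lborel_translation_integral)
  have ff: "integrable lborel (\<lambda>x. cmod (f (x + t) - f x))" for t
    using lim by (auto intro!: integrable_norm Bochner_Integration.integrable_diff simp: lborel_translation_integral)
  have conv: "(\<lambda>i. LINT x|lborel. cmod (s i x - f x)) \<longlonglongrightarrow> (LINT x|(lborel::'a measure). 0 :: real)"
  proof (rule integral_dominated_convergence[where w="\<lambda>x. 3 * cmod (f x)"])
    show "AE x in lborel. (\<lambda>i. cmod (s i x - f x)) \<longlonglongrightarrow> 0"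
    proof (rule AE_I2)
      fix x
      show "(\<lambda>i. cmod (s i x - f x)) \<longlonglongrightarrow> 0"
        using lim.hyps(2)[of x] by (simp add: tendsto_norm_zero_iff LIM_zero_iff)
    qed
    show "AE x in lborel. norm (cmod (s i x - f x)) \<le> 3 * cmod (f x)" for i
      using norm_triangle_ineq4[of "s i _" "f _"] lim.hyps(3)[of _ i] by (intro AE_I2) (smt (verit) UNIV_I norm_ge_zero real_norm_def space_lborel)
  qed (use lim in auto)
  show ?case
  proof (rule LIMSEQ_I)
    fix e :: real assume e: "e > 0"
    obtain i where i: "(LINT x|lborel. cmod (s i x - f x)) < e / 3"
      using LIMSEQ_D[OF conv, of "e / 3"] e by auto
    obtain N where N: "\<And>n. n \<ge> N \<Longrightarrow> (LINT x|lborel. cmod (s i (x + h n) - s i x)) < e / 3"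
      using LIMSEQ_D[OF lim.IH[of i], of "e / 3"] e by auto
    have "(LINT x|lborel. cmod (f (x + h n) - f x)) < e" if n: "n \<ge> N" for n
    proof -
      have tri: "cmod (a - b) \<le> cmod (p - a) + cmod (p - q) + cmod (q - b)" for a b p q
        using norm_triangle_ineq4[of "(p - q) + (q - b)" "p - a"] norm_triangle_ineq[of "p - q" "q - b"] by (simp add: algebra_simps)
      have "(LINT x|lborel. cmod (f (x + h n) - f x)) \<le>
        (LINT x|lborel. cmod (s i (x + h n) - f (x + h n)) + cmod (s i (x + h n) - s i x) + cmod (s i x - f x))"
        by (intro integral_mono Bochner_Integration.integrable_add ff sf sf' ss tri)
      also have "\<dots> = (LINT x|lborel. cmod (s i (x + h n) - f (x + h n))) + (LINT x|lborel. cmod (s i (x + h n) - s i x)) + (LINT x|lborel. cmod (s i x - f x))"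
        using sf sf' ss by simp
      also have "(LINT x|lborel. cmod (s i (x + h n) - f (x + h n))) = (LINT x|lborel. cmod (s i x - f x))"
        by (rule lborel_translation_integral(1)) measurable
      finally show ?thesis using i N[OF n] by simp
    qed
    then show "\<exists>no. \<forall>n\<ge>no. norm ((LINT x|lborel. cmod (f (x + h n) - f x)) - 0) < e"
      by (auto intro!: exI[of _ N])
  qed
qed

lemma L2_translation_continuous:
  fixes u :: "'a::euclidean_space \<Rightarrow> complex" and h :: "nat \<Rightarrow> 'a"
  assumes u: "u \<in> L2" and h: "h \<longlonglongrightarrow> 0"
  shows "(\<lambda>n. L2_norm (\<lambda>x. u (x + h n) - u x)) \<longlonglongrightarrow> 0"
proof -
  note s = L2_signed_square_integrable[OF u]
  have [measurable]: "u \<in> borel_measurable borel" using u by measurable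
  have "(\<lambda>n. (L2_norm (\<lambda>x. u (x + h n) - u x))\<^sup>2) \<longlonglongrightarrow> 0"
  proof (rule real_tendsto_zero_bound)
    show "(\<lambda>n. 2 * (LINT x|lborel. cmod (signed_square (u (x + h n)) - signed_square (u x)))) \<longlonglongrightarrow> 0"
      using tendsto_mult_right_zero[OF L1_translation_continuous[OF s h]] by simp
    fix n
    have i: "integrable lborel (\<lambda>x. signed_square (u (x + h n)))"
      by (subst lborel_translation_integral(2)[of "\<lambda>x. signed_square (u x)"]) (use s in auto)
    have "(L2_norm (\<lambda>x. u (x + h n) - u x))\<^sup>2 \<le> (LINT x|lborel. 2 * cmod (signed_square (u (x + h n)) - signed_square (u x)))"
      unfolding L2_norm_sq
      by (intro integral_mono L2_integrable L2_diff u L2_translate(1)[OF u] integrable_mult_right integrable_norm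
            Bochner_Integration.integrable_diff s i signed_square_inverse_Holder)
    then show "(L2_norm (\<lambda>x. u (x + h n) - u x))\<^sup>2
     \<le> 2 * (LINT x|lborel. cmod (signed_square (u (x + h n)) - signed_square (u x)))" by simp
  qed simp
  then have "(\<lambda>n. sqrt ((L2_norm (\<lambda>x. u (x + h n) - u x))\<^sup>2)) \<longlonglongrightarrow> sqrt 0"
    by (intro tendsto_intros)
  then show ?thesis by simp
qed

lemma L2_inner_translate_tendsto:
  assumes u: "u \<in> L2" and h: "h \<longlonglongrightarrow> 0"
  shows "(\<lambda>n. L2_inner u (\<lambda>x. u (x + h n))) \<longlonglongrightarrow> of_real ((L2_norm u)\<^sup>2)"
proof (rule LIM_zero_cancel, rule Lim_null_comparison)
  show "(\<lambda>n. L2_norm u * L2_norm (\<lambda>x. u (x + h n) - u x)) \<longlonglongrightarrow> 0"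
    using tendsto_mult_right_zero[OF L2_translation_continuous[OF u h]] by simp
  show "\<forall>\<^sub>F n in sequentially. norm (L2_inner u (\<lambda>x. u (x + h n)) - of_real ((L2_norm u)\<^sup>2)) \<le> L2_norm u * L2_norm (\<lambda>x. u (x + h n) - u x)"
  proof (rule always_eventually, rule allI)
    fix n
    have "L2_inner u (\<lambda>x. u (x + h n)) - of_real ((L2_norm u)\<^sup>2) = L2_inner u (\<lambda>x. u (x + h n) - u x)"
      unfolding L2_inner_self[symmetric] by (intro L2_inner_diff_right[symmetric] u L2_translate(1))
    then show "norm (L2_inner u (\<lambda>x. u (x + h n)) - of_real ((L2_norm u)\<^sup>2)) \<le> L2_norm u * L2_norm (\<lambda>x. u (x + h n) - u x)"
      using L2_Cauchy_Schwarz[OF u L2_diff[OF L2_translate(1)[OF u] u]] by simp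
  qed
qed

section \<open>Gaussians\<close>

definition gauss :: "'a::euclidean_space \<Rightarrow> real" where
  "gauss x = exp (- (norm x)\<^sup>2 / 2)"

lemma gauss_measurable [measurable]: "gauss \<in> borel_measurable borel"
  unfolding gauss_def by measurable

lemma gauss_pos: "0 < gauss x" and gauss_le_1: "gauss x \<le> 1"
  by (auto simp: gauss_def)

lemma gauss_fourier_1d:
  fixes t :: real
  shows "integrable lborel (\<lambda>x. complex_of_real (exp (- x\<^sup>2 / 2)) * iexp (t * x))"
    "(LINT x|lborel. complex_of_real (exp (- x\<^sup>2 / 2)) * iexp (t * x)) = of_real (sqrt (2 * pi) * exp (- t\<^sup>2 / 2))"
proof -
  have eq: "complex_of_real (exp (- x\<^sup>2 / 2)) * iexp (t * x) = of_real (sqrt (2 * pi)) * (std_normal_density x *\<^sub>R iexp (t * x))" for x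
    unfolding std_normal_density_def by (simp add: scaleR_conv_of_real del: of_real_exp)
  have d: "integrable lborel std_normal_density" using integrable_std_normal_moment[of 0] by simp
  have "integrable lborel (\<lambda>x. std_normal_density x *\<^sub>R iexp (t * x))"
    by (rule Bochner_Integration.integrable_bound[OF d]) auto
  then show "integrable lborel (\<lambda>x. complex_of_real (exp (- x\<^sup>2 / 2)) * iexp (t * x))"
    unfolding eq by (rule integrable_mult_right)
  have "(LINT x|lborel. std_normal_density x *\<^sub>R iexp (t * x)) = char std_normal_distribution t"
    unfolding char_def by (subst integral_density) auto
  also have "\<dots> = of_real (exp (- t\<^sup>2 / 2))" by (simp only: char_std_normal_distribution)
  finally show "(LINT x|lborel. complex_of_real (exp (- x\<^sup>2 / 2)) * iexp (t * x)) = of_real (sqrt (2 * pi) * exp (- t\<^sup>2 / 2))"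
    unfolding eq integral_mult_right_zero by (simp only: of_real_mult)
qed

text \<open>In the orthonormal basis both factors are products of functions of one coordinate, so the
  one-dimensional formula suffices.\<close>

lemma gauss_fourier:
  fixes y :: "'a::euclidean_space"
  shows "integrable lborel (\<lambda>x. complex_of_real (gauss x) * iexp (y \<bullet> x))" (is ?I)
    "(LINT x|lborel. complex_of_real (gauss x) * iexp (y \<bullet> x)) = of_real (sqrt (2 * pi) ^ DIM('a) * gauss y)" (is ?E)
proof -
  interpret product_sigma_finite "\<lambda>_::'a. lborel :: real measure" ..
  let ?f = "\<lambda>b::'a. \<lambda>x::real. complex_of_real (exp (- x\<^sup>2 / 2)) * iexp ((y \<bullet> b) * x)"
  let ?S = "\<lambda>f::'a \<Rightarrow> real. \<Sum>b\<in>Basis. f b *\<^sub>R b"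
  let ?P = "\<Pi>\<^sub>M b\<in>(Basis::'a set). (lborel :: real measure)"
  have nrm: "(norm (z::'a))\<^sup>2 = (\<Sum>b\<in>Basis. (z \<bullet> b)\<^sup>2)" for z
    unfolding power2_norm_eq_inner by (subst euclidean_inner) (simp add: power2_eq_square)
  have prod: "complex_of_real (gauss (?S f)) * iexp (y \<bullet> ?S f) = (\<Prod>b\<in>Basis. ?f b (f b))" for f
  proof -
    have "gauss (?S f) = (\<Prod>b\<in>Basis. exp (- (f b)\<^sup>2 / 2))"
      unfolding gauss_def nrm by (simp add: exp_sum[symmetric] sum_negf sum_divide_distrib)
    moreover have "iexp (y \<bullet> ?S f) = (\<Prod>b\<in>Basis. iexp ((y \<bullet> b) * f b))"
      by (simp add: inner_sum_right exp_sum[symmetric] sum_distrib_left mult.commute)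
    ultimately show ?thesis by (simp add: prod.distrib)
  qed
  have m: "?S \<in> measurable ?P borel" by measurable
  have g: "(\<lambda>x. complex_of_real (gauss x) * iexp (y \<bullet> x)) \<in> borel_measurable borel" by measurable
  have i: "integrable ?P (\<lambda>f. \<Prod>b\<in>Basis. ?f b (f b))"
    by (rule product_integrable_prod[OF finite_Basis gauss_fourier_1d(1)])
  show ?I
    by (subst lborel_eq, subst integrable_distr_eq[OF m g]) (simp only: prod i)
  have "(LINT x|lborel. complex_of_real (gauss x) * iexp (y \<bullet> x)) = (LINT f|?P. (\<Prod>b\<in>Basis. ?f b (f b)))"
    by (subst lborel_eq, subst integral_distr[OF m g]) (simp only: prod)
  also have "\<dots> = (\<Prod>b\<in>Basis. LINT x|lborel. ?f b x)"
    by (rule product_integral_prod[OF finite_Basis gauss_fourier_1d(1)])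
  also have "\<dots> = (\<Prod>b\<in>(Basis::'a set). complex_of_real (sqrt (2 * pi) * exp (- (y \<bullet> b)\<^sup>2 / 2)))"
    by (intro prod.cong refl gauss_fourier_1d)
  also have "\<dots> = of_real (\<Prod>b\<in>(Basis::'a set). sqrt (2 * pi) * exp (- (y \<bullet> b)\<^sup>2 / 2))" by simp
  also have "(\<Prod>b\<in>(Basis::'a set). sqrt (2 * pi) * exp (- (y \<bullet> b)\<^sup>2 / 2)) = sqrt (2 * pi) ^ DIM('a) * gauss y"
    unfolding prod.distrib gauss_def nrm by (simp add: exp_sum[symmetric] sum_negf sum_divide_distrib)
  finally show ?E .
qed

lemma gauss_integrable: "integrable lborel (gauss :: 'a::euclidean_space \<Rightarrow> real)"
proof -
  have "integrable lborel (\<lambda>x::'a. complex_of_real (gauss x))"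
    using gauss_fourier(1)[of "0::'a"] by simp
  from integrable_norm[OF this] show ?thesis by (simp add: abs_of_pos gauss_pos)
qed

lemma gauss_integral: "(LINT x|lborel. gauss (x::'a::euclidean_space)) = sqrt (2 * pi) ^ DIM('a)"
proof -
  have "complex_of_real (LINT x|lborel. gauss (x::'a)) = of_real (sqrt (2 * pi) ^ DIM('a))"
    using gauss_fourier(2)[of "0::'a"] by (simp add: gauss_def)
  then show ?thesis using of_real_eq_iff by blast
qed

section \<open>Plancherel's identity for integrable square integrable functions\<close>

definition fourier_const :: "'a::euclidean_space itself \<Rightarrow> real" where
  "fourier_const _ = (2 * pi) powr (- real DIM('a) / 2)"

lemma fourier_const_pos: "0 < fourier_const TYPE('a::euclidean_space)"
  by (simp add: fourier_const_def)

lemma fourier_const_gauss: "fourier_const TYPE('a::euclidean_space) * sqrt (2 * pi) ^ DIM('a) = 1"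
proof -
  have "sqrt (2 * pi) ^ DIM('a) = (2 * pi) powr (real DIM('a) / 2)"
    by (simp add: powr_half_sqrt[symmetric] powr_realpow[symmetric] powr_powr)
  then show ?thesis unfolding fourier_const_def by (simp add: powr_add[symmetric])
qed

lemma fourier_integral_altdef:
  "fourier_integral u \<xi> = of_real (fourier_const TYPE('a)) * (LINT x|lborel. u x * exp (- (\<i> * of_real (\<xi> \<bullet> x))))"
  for u :: "'a::euclidean_space \<Rightarrow> complex"
  by (simp add: fourier_integral_def fourier_const_def)

lemma cmod_exp_minus_i [simp]: "cmod (exp (- (\<i> * of_real t))) = 1"
  by (simp add: norm_exp_eq_Re)

lemma fourier_integrand_integrable:
  "integrable lborel u \<Longrightarrow> integrable lborel (\<lambda>x. u x * exp (- (\<i> * of_real (\<xi> \<bullet> x))))"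
  by (rule Bochner_Integration.integrable_bound[of lborel u]) (auto simp: norm_mult)

lemma fourier_integral_measurable [measurable]:
  fixes u :: "'a::euclidean_space \<Rightarrow> complex"
  assumes [measurable]: "u \<in> borel_measurable borel"
  shows "fourier_integral u \<in> borel_measurable borel"
  unfolding fourier_integral_def by measurable

lemma fourier_integral_bound:
  fixes u :: "'a::euclidean_space \<Rightarrow> complex"
  shows "cmod (fourier_integral u \<xi>) \<le> fourier_const TYPE('a) * (LINT x|lborel. cmod (u x))"
proof -
  have "cmod (LINT x|lborel. u x * exp (- (\<i> * of_real (\<xi> \<bullet> x)))) \<le> (LINT x|lborel. cmod (u x))"
    by (rule order_trans[OF integral_norm_bound]) (simp add: norm_mult)
  then show ?thesis
    unfolding fourier_integral_altdef norm_mult using fourier_const_pos[where 'a='a] by simp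
qed

lemma fourier_integral_diff:
  assumes "integrable lborel u" "integrable lborel v"
  shows "fourier_integral (\<lambda>x. u x - v x) \<xi> = fourier_integral u \<xi> - fourier_integral v \<xi>"
  unfolding fourier_integral_altdef
  using fourier_integrand_integrable[OF assms(1)] fourier_integrand_integrable[OF assms(2)]
  by (simp add: left_diff_distrib right_diff_distrib)

lemma integrable_pair_bounded_kernel:
  fixes u v :: "'a::euclidean_space \<Rightarrow> complex" and k :: "'a \<times> 'a \<Rightarrow> complex"
  assumes u: "integrable lborel u" and v: "integrable lborel v"
    and k: "k \<in> borel_measurable (borel \<Otimes>\<^sub>M borel)" "\<And>z. cmod (k z) = 1"
  shows "integrable (lborel \<Otimes>\<^sub>M lborel) (\<lambda>(x, y). u x * v y * k (x, y))"
proof (rule lborel_pair.Fubini_integrable)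
  have [measurable]: "u \<in> borel_measurable borel" "v \<in> borel_measurable borel" using u v by auto
  note k(1)[measurable]
  show "(\<lambda>(x, y). u x * v y * k (x, y)) \<in> borel_measurable (lborel \<Otimes>\<^sub>M lborel)" by measurable
  show "integrable lborel (\<lambda>x. LINT y|lborel. norm (case (x, y) of (x, y) \<Rightarrow> u x * v y * k (x, y)))"
    using u by (simp add: norm_mult k(2))
  show "AE x in lborel. integrable lborel (\<lambda>y. case (x, y) of (x, y) \<Rightarrow> u x * v y * k (x, y))"
  proof (rule AE_I2)
    fix x
    have "integrable lborel (\<lambda>y. u x * (v y * k (x, y)))"
      by (intro integrable_mult_right, rule Bochner_Integration.integrable_bound[OF v]) (auto simp: norm_mult k(2))
    then show "integrable lborel (\<lambda>y. case (x, y) of (x, y) \<Rightarrow> u x * v y * k (x, y))"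
      by (simp add: mult.assoc)
  qed
qed

lemma fourier_integral_duality:
  fixes u v :: "'a::euclidean_space \<Rightarrow> complex"
  assumes u: "integrable lborel u" and v: "integrable lborel v"
  shows "(LINT \<xi>|lborel. fourier_integral u \<xi> * v \<xi>) = (LINT x|lborel. u x * fourier_integral v x)"
proof -
  let ?c = "complex_of_real (fourier_const TYPE('a))"
  let ?k = "\<lambda>(x, \<xi>). exp (- (\<i> * of_real (\<xi> \<bullet> x)))"
  have i: "integrable (lborel \<Otimes>\<^sub>M lborel) (case_prod (\<lambda>x \<xi>. u x * v \<xi> * exp (- (\<i> * of_real (\<xi> \<bullet> (x::'a))))))"
    using integrable_pair_bounded_kernel[OF u v, of ?k] by (simp add: case_prod_beta)
  have "(LINT \<xi>|lborel. fourier_integral u \<xi> * v \<xi>) = (LINT \<xi>|lborel. LINT x|lborel. ?c * (u x * v \<xi> * exp (- (\<i> * of_real (\<xi> \<bullet> x)))))"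
  proof (intro Bochner_Integration.integral_cong refl)
    fix \<xi>
    have "fourier_integral u \<xi> * v \<xi> = (?c * v \<xi>) * (LINT x|lborel. u x * exp (- (\<i> * of_real (\<xi> \<bullet> x))))"
      by (simp add: fourier_integral_altdef)
    also have "\<dots> = (LINT x|lborel. (?c * v \<xi>) * (u x * exp (- (\<i> * of_real (\<xi> \<bullet> x)))))"
      by (rule integral_mult_right_zero[symmetric])
    finally show "fourier_integral u \<xi> * v \<xi> = (LINT x|lborel. ?c * (u x * v \<xi> * exp (- (\<i> * of_real (\<xi> \<bullet> x)))))"
      by (simp add: mult_ac)
  qed
  also have "\<dots> = ?c * (LINT \<xi>|lborel. LINT x|lborel. (u x * v \<xi> * exp (- (\<i> * of_real (\<xi> \<bullet> x)))))"
    by (simp only: integral_mult_right_zero)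
  also have "\<dots> = ?c * (LINT x|lborel. LINT \<xi>|lborel. (u x * v \<xi> * exp (- (\<i> * of_real (\<xi> \<bullet> x)))))"
    by (subst lborel_pair.Fubini_integral[OF i]) simp
  also have "\<dots> = (LINT x|lborel. LINT \<xi>|lborel. ?c * (u x * v \<xi> * exp (- (\<i> * of_real (\<xi> \<bullet> x)))))"
    by (simp only: integral_mult_right_zero)
  also have "\<dots> = (LINT x|lborel. u x * fourier_integral v x)"
  proof (intro Bochner_Integration.integral_cong refl)
    fix x
    have "u x * fourier_integral v x = (?c * u x) * (LINT \<xi>|lborel. v \<xi> * exp (- (\<i> * of_real (x \<bullet> \<xi>))))"
      by (simp add: fourier_integral_altdef)
    also have "\<dots> = (LINT \<xi>|lborel. (?c * u x) * (v \<xi> * exp (- (\<i> * of_real (x \<bullet> \<xi>)))))"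
      by (rule integral_mult_right_zero[symmetric])
    finally have eq: "u x * fourier_integral v x = \<dots>" .
    have "?c * (u x * v \<xi> * exp (- (\<i> * of_real (\<xi> \<bullet> x)))) = (?c * u x) * (v \<xi> * exp (- (\<i> * of_real (x \<bullet> \<xi>))))" for \<xi>
      by (simp add: inner_commute)
    then show "(LINT \<xi>|lborel. ?c * (u x * v \<xi> * exp (- (\<i> * of_real (\<xi> \<bullet> x))))) = u x * fourier_integral v x"
      by (simp only: eq)
  qed
  finally show ?thesis .
qed

lemma gauss_scaled_integrable:
  assumes e: "e > 0"
  shows "integrable lborel (\<lambda>\<xi>::'a::euclidean_space. gauss (e *\<^sub>R \<xi>))"
  using lborel_affine_integral(2)[of e "gauss :: 'a \<Rightarrow> real" 0] gauss_integrable[where 'a='a] e by simp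

lemma gauss_scaled_fourier:
  fixes y :: "'a::euclidean_space"
  assumes e: "e > 0"
  shows "(LINT \<xi>|lborel. complex_of_real (gauss (e *\<^sub>R \<xi>)) * iexp (y \<bullet> \<xi>))
    = of_real (sqrt (2 * pi) ^ DIM('a) * gauss (y /\<^sub>R e) / e ^ DIM('a))"
proof -
  let ?f = "\<lambda>\<xi>. complex_of_real (gauss \<xi>) * iexp ((y /\<^sub>R e) \<bullet> \<xi>)"
  have "(LINT \<xi>|lborel. ?f \<xi>) = (\<bar>e\<bar> ^ DIM('a)) *\<^sub>R (LINT \<xi>|lborel. ?f (0 + e *\<^sub>R \<xi>))"
    using e by (intro lborel_affine_integral(1)) auto
  moreover have "(LINT \<xi>|lborel. ?f (0 + e *\<^sub>R \<xi>)) = (LINT \<xi>|lborel. complex_of_real (gauss (e *\<^sub>R \<xi>)) * iexp (y \<bullet> \<xi>))"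
  proof -
    have "(y /\<^sub>R e) \<bullet> (e *\<^sub>R \<xi>) = y \<bullet> \<xi>" for \<xi> using e by simp
    then show ?thesis by (simp only: add_0)
  qed
  moreover have "(LINT \<xi>|lborel. ?f \<xi>) = of_real (sqrt (2 * pi) ^ DIM('a) * gauss (y /\<^sub>R e))"
    by (rule gauss_fourier(2))
  ultimately show ?thesis using e by (simp add: scaleR_conv_of_real field_simps)
qed

text \<open>Duality moves the transform onto the modulated Gaussian, whose transform is known; the substitution
  \<open>y = x + e z\<close> then normalizes the Gaussian. Up to constants this is Fourier inversion for a Gaussian mean of \<open>u\<close>.\<close>

lemma fourier_integral_gauss_mean:
  fixes u :: "'a::euclidean_space \<Rightarrow> complex"
  assumes u: "integrable lborel u" and e: "e > 0"
  shows "(LINT \<xi>|lborel. fourier_integral u \<xi> * (of_real (gauss (e *\<^sub>R \<xi>)) * iexp (x \<bullet> \<xi>)))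
    = (LINT z|lborel. of_real (gauss z) * u (x + e *\<^sub>R z))"
proof -
  let ?w = "\<lambda>\<xi>. complex_of_real (gauss (e *\<^sub>R \<xi>)) * iexp (x \<bullet> \<xi>)"
  have um [measurable]: "u \<in> borel_measurable borel" using u by auto
  have w: "integrable lborel ?w"
    by (rule Bochner_Integration.integrable_bound[OF gauss_scaled_integrable[OF e]]) (auto simp: norm_mult)
  have Fw: "fourier_integral ?w y = of_real (gauss ((x - y) /\<^sub>R e) / e ^ DIM('a))" for y
  proof -
    have "?w \<xi> * exp (- (\<i> * of_real (y \<bullet> \<xi>))) = of_real (gauss (e *\<^sub>R \<xi>)) * iexp ((x - y) \<bullet> \<xi>)" for \<xi>
      by (simp add: inner_diff_left exp_add[symmetric] algebra_simps)
    then have "fourier_integral ?w y = of_real (fourier_const TYPE('a)) * of_real (sqrt (2 * pi) ^ DIM('a) * gauss ((x - y) /\<^sub>R e) / e ^ DIM('a))"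
      unfolding fourier_integral_altdef by (simp only: gauss_scaled_fourier[OF e])
    also have "\<dots> = of_real ((fourier_const TYPE('a) * sqrt (2 * pi) ^ DIM('a)) * (gauss ((x - y) /\<^sub>R e) / e ^ DIM('a)))"
      unfolding of_real_mult[symmetric] by (simp only: mult.assoc times_divide_eq_right)
    finally show ?thesis by (simp only: fourier_const_gauss mult_1)
  qed
  have "(LINT \<xi>|lborel. fourier_integral u \<xi> * ?w \<xi>) = (LINT y|lborel. u y * of_real (gauss ((x - y) /\<^sub>R e) / e ^ DIM('a)))"
    unfolding fourier_integral_duality[OF u w] Fw ..
  also have "\<dots> = (\<bar>e\<bar> ^ DIM('a)) *\<^sub>R (LINT z|lborel. u (x + e *\<^sub>R z) * of_real (gauss ((x - (x + e *\<^sub>R z)) /\<^sub>R e) / e ^ DIM('a)))"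
    using e by (intro lborel_affine_integral(1)) auto
  also have "\<dots> = (LINT z|lborel. (\<bar>e\<bar> ^ DIM('a)) *\<^sub>R (u (x + e *\<^sub>R z) * of_real (gauss ((x - (x + e *\<^sub>R z)) /\<^sub>R e) / e ^ DIM('a))))"
    unfolding scaleR_conv_of_real by (rule integral_mult_right_zero[symmetric])
  also have "\<dots> = (LINT z|lborel. of_real (gauss z) * u (x + e *\<^sub>R z))"
    using e by (intro Bochner_Integration.integral_cong refl) (simp add: scaleR_conv_of_real gauss_def)
  finally show ?thesis .
qed

text \<open>The Gaussian factor makes the integrand absolutely integrable in all variables. The right-hand side
  is a Gaussian average of the correlations of \<open>u\<close> with its translates, which tends to \<open>||u||\<^sup>2\<close> as \<open>e \<rightarrow> 0\<close>.\<close>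

lemma fourier_integral_gauss_energy:
  fixes u :: "'a::euclidean_space \<Rightarrow> complex"
  assumes u: "integrable lborel u" and u2: "u \<in> L2" and e: "e > 0"
  shows "(LINT \<xi>|lborel. complex_of_real ((cmod (fourier_integral u \<xi>))\<^sup>2 * gauss (e *\<^sub>R \<xi>)))
    = (LINT z|lborel. of_real (fourier_const TYPE('a) * gauss z) * L2_inner u (\<lambda>x. u (x + e *\<^sub>R z)))"
proof -
  let ?c = "fourier_const TYPE('a)"
  define F where "F = fourier_integral u"
  have um [measurable]: "u \<in> borel_measurable borel" using u by auto
  have Fm [measurable]: "F \<in> borel_measurable borel" unfolding F_def by measurable
  let ?h = "\<lambda>\<xi>. cnj (F \<xi>) * of_real (gauss (e *\<^sub>R \<xi>))"
  let ?B = "?c * (LINT x|lborel. cmod (u x))"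
  have h: "integrable lborel ?h"
  proof (rule Bochner_Integration.integrable_bound)
    show "integrable lborel (\<lambda>\<xi>::'a. ?B * gauss (e *\<^sub>R \<xi>))"
      using gauss_scaled_integrable[OF e] by (rule integrable_mult_right)
    have "0 \<le> ?B" using fourier_const_pos[where 'a='a] by (simp add: Bochner_Integration.integral_nonneg)
    then show "AE \<xi> in lborel. norm (?h \<xi>) \<le> norm (?B * gauss (e *\<^sub>R \<xi>))"
      using fourier_integral_bound[of u] by (intro AE_I2) (simp add: norm_mult F_def mult_right_mono less_imp_le[OF gauss_pos] abs_of_pos[OF gauss_pos] abs_of_pos[OF fourier_const_pos] abs_mult)
  qed measurable
  have Fh: "fourier_integral ?h x = of_real ?c * cnj (LINT z|lborel. of_real (gauss z) * u (x + e *\<^sub>R z))" for x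
  proof -
    have "?h \<xi> * exp (- (\<i> * of_real (x \<bullet> \<xi>))) = cnj (F \<xi> * (of_real (gauss (e *\<^sub>R \<xi>)) * iexp (x \<bullet> \<xi>)))" for \<xi>
      by (simp add: exp_cnj)
    then have "fourier_integral ?h x = of_real ?c * cnj (LINT \<xi>|lborel. F \<xi> * (of_real (gauss (e *\<^sub>R \<xi>)) * iexp (x \<bullet> \<xi>)))"
      unfolding fourier_integral_altdef by (simp only: Bochner_Integration.integral_cnj)
    then show ?thesis unfolding F_def fourier_integral_gauss_mean[OF u e] .
  qed
  let ?G = "\<lambda>z x. of_real (?c * gauss z) * (u x * cnj (u (x + e *\<^sub>R z)))"
  have iG: "integrable (lborel \<Otimes>\<^sub>M lborel) (case_prod ?G)"
  proof (rule lborel_pair.Fubini_integrable)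
    show "case_prod ?G \<in> borel_measurable (lborel \<Otimes>\<^sub>M lborel)" by measurable
    have ix: "integrable lborel (\<lambda>x. ?G z x)" for z
      by (intro integrable_mult_right L2_inner_integrable u2 L2_translate(1))
    then show "AE z in lborel. integrable lborel (\<lambda>x. case_prod ?G (z, x))" by simp
    show "integrable lborel (\<lambda>z. LINT x|lborel. norm (case_prod ?G (z, x)))"
    proof (rule Bochner_Integration.integrable_bound)
      show "integrable lborel (\<lambda>z::'a. (?c * (L2_norm u)\<^sup>2) * gauss z)"
        using gauss_integrable by (rule integrable_mult_right)
      show "AE z in lborel. norm (LINT x|lborel. norm (case_prod ?G (z, x))) \<le> norm (?c * (L2_norm u)\<^sup>2 * gauss z)"
      proof (rule AE_I2)
        fix z :: 'a
        have "(LINT x|lborel. norm (?G z x)) = (LINT x|lborel. (?c * gauss z) * (cmod (u x) * cmod (u (x + e *\<^sub>R z))))"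
          using fourier_const_pos[where 'a='a] gauss_pos[of z]
          by (intro Bochner_Integration.integral_cong refl) (simp add: norm_mult abs_of_pos)
        also have "\<dots> = (?c * gauss z) * (LINT x|lborel. cmod (u x) * cmod (u (x + e *\<^sub>R z)))"
          by (rule integral_mult_right_zero)
        also have "\<dots> \<le> (?c * gauss z) * (L2_norm u * L2_norm (\<lambda>x. u (x + e *\<^sub>R z)))"
          using fourier_const_pos[where 'a='a] gauss_pos[of z]
          by (intro mult_left_mono L2_Cauchy_Schwarz_abs u2 L2_translate(1)) auto
        also have "\<dots> = ?c * (L2_norm u)\<^sup>2 * gauss z"
          by (simp add: L2_translate(2)[OF u2] power2_eq_square)
        finally have "(LINT x|lborel. norm (?G z x)) \<le> ?c * (L2_norm u)\<^sup>2 * gauss z" .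
        moreover have "0 \<le> (LINT x|lborel. norm (?G z x))" by (rule Bochner_Integration.integral_nonneg) simp
        ultimately show "norm (LINT x|lborel. norm (case_prod ?G (z, x))) \<le> norm (?c * (L2_norm u)\<^sup>2 * gauss z)"
          by simp
      qed
    qed measurable
  qed
  have "(LINT \<xi>|lborel. complex_of_real ((cmod (F \<xi>))\<^sup>2 * gauss (e *\<^sub>R \<xi>))) = (LINT \<xi>|lborel. F \<xi> * ?h \<xi>)"
    by (intro Bochner_Integration.integral_cong refl)
       (simp only: of_real_mult complex_norm_square mult.assoc)
  also have "\<dots> = (LINT x|lborel. u x * fourier_integral ?h x)"
    unfolding F_def by (rule fourier_integral_duality[OF u h[unfolded F_def]])
  also have "\<dots> = (LINT x|lborel. LINT z|lborel. ?G z x)"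
  proof (intro Bochner_Integration.integral_cong refl)
    fix x
    have "u x * fourier_integral ?h x = (of_real ?c * u x) * (LINT z|lborel. cnj (of_real (gauss z) * u (x + e *\<^sub>R z)))"
      unfolding Fh Bochner_Integration.integral_cnj by simp
    also have "\<dots> = (LINT z|lborel. (of_real ?c * u x) * cnj (of_real (gauss z) * u (x + e *\<^sub>R z)))"
      by (rule integral_mult_right_zero[symmetric])
    finally show "u x * fourier_integral ?h x = (LINT z|lborel. ?G z x)" by (simp add: mult_ac)
  qed
  also have "\<dots> = (LINT z|lborel. LINT x|lborel. ?G z x)"
    by (rule lborel_pair.Fubini_integral[OF iG])
  also have "\<dots> = (LINT z|lborel. of_real (?c * gauss z) * L2_inner u (\<lambda>x. u (x + e *\<^sub>R z)))"
    unfolding L2_inner_def by (simp only: integral_mult_right_zero)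
  finally show ?thesis unfolding F_def .
qed

text \<open>Let the Gaussian factor tend to one. Continuity of translations gives the limit of the regularized
  energies, Fatou the square integrability of the transform, and dominated convergence the identity.\<close>

lemma Plancherel_L1_L2:
  fixes u :: "'a::euclidean_space \<Rightarrow> complex"
  assumes u: "integrable lborel u" and u2: "u \<in> L2"
  shows "fourier_integral u \<in> L2" "L2_norm (fourier_integral u) = L2_norm u"
proof -
  let ?c = "fourier_const TYPE('a)"
  define F where "F = fourier_integral u"
  have um [measurable]: "u \<in> borel_measurable borel" using u by auto
  have Fm [measurable]: "F \<in> borel_measurable borel" unfolding F_def by measurable
  define e where "e n = 1 / real (Suc n)" for n
  have e: "e n > 0" for n by (simp add: e_def)
  have e0: "e \<longlonglongrightarrow> 0" unfolding e_def by (rule LIMSEQ_Suc[OF lim_1_over_n])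
  let ?f = "\<lambda>n \<xi>. (cmod (F \<xi>))\<^sup>2 * gauss (e n *\<^sub>R \<xi>)"
  let ?B = "?c * (LINT x|lborel. cmod (u x))"
  have fi: "integrable lborel (?f n)" for n
  proof (rule Bochner_Integration.integrable_bound)
    show "integrable lborel (\<lambda>\<xi>::'a. ?B\<^sup>2 * gauss (e n *\<^sub>R \<xi>))"
      using gauss_scaled_integrable[OF e] by (rule integrable_mult_right)
    show "AE \<xi> in lborel. norm (?f n \<xi>) \<le> norm (?B\<^sup>2 * gauss (e n *\<^sub>R \<xi>))"
    proof (rule AE_I2)
      fix \<xi> :: 'a
      have "(cmod (F \<xi>))\<^sup>2 \<le> ?B\<^sup>2" unfolding F_def by (intro power_mono fourier_integral_bound) simp
      then show "norm (?f n \<xi>) \<le> norm (?B\<^sup>2 * gauss (e n *\<^sub>R \<xi>))"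
        using gauss_pos[of "e n *\<^sub>R \<xi>"] by (simp add: abs_mult mult_right_mono)
    qed
  qed measurable
  have flim: "(\<lambda>n. LINT \<xi>|lborel. ?f n \<xi>) \<longlonglongrightarrow> (L2_norm u)\<^sup>2"
  proof -
    let ?g = "\<lambda>n z. of_real (?c * gauss z) * L2_inner u (\<lambda>x. u (x + e n *\<^sub>R z))"
    have bd: "AE z in lborel. norm (?g n z) \<le> (?c * (L2_norm u)\<^sup>2) * gauss z" for n
    proof (rule AE_I2)
      fix z :: 'a
      have "cmod (L2_inner u (\<lambda>x. u (x + e n *\<^sub>R z))) \<le> (L2_norm u)\<^sup>2"
        using L2_Cauchy_Schwarz[OF u2 L2_translate(1)[OF u2]] by (simp add: L2_translate(2)[OF u2] power2_eq_square)
      then have "(?c * gauss z) * cmod (L2_inner u (\<lambda>x. u (x + e n *\<^sub>R z))) \<le> (?c * gauss z) * (L2_norm u)\<^sup>2"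
        using fourier_const_pos[where 'a='a] gauss_pos[of z] by (intro mult_left_mono) auto
      then show "norm (?g n z) \<le> (?c * (L2_norm u)\<^sup>2) * gauss z"
        using fourier_const_pos[where 'a='a] gauss_pos[of z] by (simp add: norm_mult abs_of_pos mult_ac)
    qed
    have "(\<lambda>n. LINT z|lborel. ?g n z) \<longlonglongrightarrow> (LINT z|lborel. of_real (?c * gauss (z::'a)) * complex_of_real ((L2_norm u)\<^sup>2))"
    proof (rule integral_dominated_convergence[OF _ _ _ _ bd])
      show "(\<lambda>z::'a. of_real (?c * gauss z) * complex_of_real ((L2_norm u)\<^sup>2)) \<in> borel_measurable lborel" by measurable
      show "?g n \<in> borel_measurable lborel" for n unfolding L2_inner_def by measurable
      show "integrable lborel (\<lambda>z::'a. (?c * (L2_norm u)\<^sup>2) * gauss z)"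
        using gauss_integrable by (rule integrable_mult_right)
      show "AE z in lborel. (\<lambda>n. ?g n z) \<longlonglongrightarrow> of_real (?c * gauss z) * complex_of_real ((L2_norm u)\<^sup>2)"
      proof (rule AE_I2, intro tendsto_mult tendsto_const L2_inner_translate_tendsto[OF u2])
        fix z :: 'a
        show "(\<lambda>n. e n *\<^sub>R z) \<longlonglongrightarrow> 0" using tendsto_scaleR[OF e0 tendsto_const[of z]] by simp
      qed
    qed
    also have "(LINT z|lborel. of_real (?c * gauss (z::'a)) * complex_of_real ((L2_norm u)\<^sup>2)) = of_real ((L2_norm u)\<^sup>2)"
    proof -
      have "(LINT z|lborel. of_real (?c * gauss (z::'a)) * complex_of_real ((L2_norm u)\<^sup>2))
         = complex_of_real (LINT z|lborel. (?c * (L2_norm u)\<^sup>2) * gauss (z::'a))"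
        unfolding integral_complex_of_real[symmetric] of_real_mult by (simp only: mult_ac)
      also have "(LINT z|lborel. (?c * (L2_norm u)\<^sup>2) * gauss (z::'a)) = (?c * sqrt (2 * pi) ^ DIM('a)) * (L2_norm u)\<^sup>2"
        by (simp add: gauss_integral)
      finally show ?thesis by (simp only: fourier_const_gauss mult_1)
    qed
    finally have "(\<lambda>n. complex_of_real (LINT \<xi>|lborel. ?f n \<xi>)) \<longlonglongrightarrow> of_real ((L2_norm u)\<^sup>2)"
      unfolding fourier_integral_gauss_energy[OF u u2 e, symmetric] F_def integral_complex_of_real .
    then show ?thesis by (simp only: tendsto_of_real_iff)
  qed
  have glim: "(\<lambda>n. gauss (e n *\<^sub>R \<xi>)) \<longlonglongrightarrow> 1" for \<xi> :: 'a
  proof -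
    have "(\<lambda>n. exp (- (norm (e n *\<^sub>R \<xi>))\<^sup>2 / 2)) \<longlonglongrightarrow> exp (- (norm (0 *\<^sub>R \<xi>))\<^sup>2 / 2)"
      by (intro tendsto_intros e0) auto
    then show ?thesis by (simp add: gauss_def)
  qed
  have flim2: "AE \<xi> in lborel. (\<lambda>n. ?f n \<xi>) \<longlonglongrightarrow> (cmod (F \<xi>))\<^sup>2"
    using tendsto_mult[OF tendsto_const glim] by (auto intro!: AE_I2)
  have F_int: "integrable lborel (\<lambda>\<xi>. (cmod (F \<xi>))\<^sup>2)"
  proof (rule integral_Fatou(1)[OF fi _ _ flim2])
    show "\<forall>\<^sub>F n in sequentially. (LINT \<xi>|lborel. ?f n \<xi>) \<le> (L2_norm u)\<^sup>2 + 1"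
      using order_tendstoD(2)[OF flim, of "(L2_norm u)\<^sup>2 + 1"] by (auto elim!: eventually_mono)
  qed (auto simp: less_imp_le[OF gauss_pos])
  then show "fourier_integral u \<in> L2" using Fm unfolding F_def by (intro L2I) auto
  have "(\<lambda>n. LINT \<xi>|lborel. ?f n \<xi>) \<longlonglongrightarrow> (LINT \<xi>|lborel. (cmod (F \<xi>))\<^sup>2)"
  proof (rule integral_dominated_convergence[OF _ _ F_int flim2])
    show "AE \<xi> in lborel. norm (?f n \<xi>) \<le> (cmod (F \<xi>))\<^sup>2" for n
      using gauss_le_1 by (auto intro!: AE_I2 mult_left_le simp: abs_mult abs_of_pos[OF gauss_pos])
  qed measurable
  then have "(L2_norm F)\<^sup>2 = (L2_norm u)\<^sup>2"
    unfolding L2_norm_sq[of F] using LIMSEQ_unique[OF flim] by simp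
  then show "L2_norm (fourier_integral u) = L2_norm u" unfolding F_def by simp
qed

section \<open>The Fourier transform on square integrable functions\<close>

lemma L2_inner_tendsto_left:
  assumes u: "\<And>n::nat. u n \<in> L2" "u0 \<in> L2" and v: "v \<in> L2" and lim: "(\<lambda>n. L2_dist (u n) u0) \<longlonglongrightarrow> 0"
  shows "(\<lambda>n. L2_inner (u n) v) \<longlonglongrightarrow> L2_inner u0 v"
proof (rule LIM_zero_cancel, rule Lim_null_comparison)
  show "(\<lambda>n. L2_dist (u n) u0 * L2_norm v) \<longlonglongrightarrow> 0"
    using tendsto_mult_left_zero[OF lim] by simp
  show "\<forall>\<^sub>F n in sequentially. norm (L2_inner (u n) v - L2_inner u0 v) \<le> L2_dist (u n) u0 * L2_norm v"
    using L2_Cauchy_Schwarz[OF L2_diff[OF u] v] by (simp add: L2_inner_diff_left[OF u v])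
qed

lemma L2_norm_tendsto:
  assumes u: "\<And>n::nat. u n \<in> L2" "u0 \<in> L2" and lim: "(\<lambda>n. L2_dist (u n) u0) \<longlonglongrightarrow> 0"
  shows "(\<lambda>n. L2_norm (u n)) \<longlonglongrightarrow> L2_norm u0"
proof (rule LIM_zero_cancel, rule Lim_null_comparison[OF _ lim])
  show "\<forall>\<^sub>F n in sequentially. norm (L2_norm (u n) - L2_norm u0) \<le> L2_dist (u n) u0"
    using L2_norm_diff_abs[OF u] by simp
qed

lemma L2_limit_unique:
  assumes u: "\<And>n::nat. u n \<in> L2" and v: "v \<in> L2" and w: "w \<in> L2"
    and "(\<lambda>n. L2_dist (u n) v) \<longlonglongrightarrow> 0" "(\<lambda>n. L2_dist (u n) w) \<longlonglongrightarrow> 0"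
  shows "AE x in lborel. v x = w x"
proof -
  have "(\<lambda>n. L2_dist (u n) v + L2_dist (u n) w) \<longlonglongrightarrow> 0"
    using tendsto_add[OF assms(4,5)] by simp
  moreover have "L2_dist v w \<le> L2_dist (u n) v + L2_dist (u n) w" for n
    using L2_norm_diff_triangle[OF v u w, of n] by (simp add: L2_norm_minus_commute[of v])
  ultimately have "L2_dist v w \<le> 0"
    by (intro LIMSEQ_le_const) auto
  then have "L2_dist v w = 0" using L2_norm_nonneg[of "\<lambda>x. v x - w x"] by linarith
  then show ?thesis using L2_norm_eq_0_iff[OF L2_diff[OF v w]] by simp
qed

lemma cball_sets [measurable]: "cball (a::'a::euclidean_space) R \<in> sets borel"
  by simp

definition ball_trunc :: "real \<Rightarrow> ('a::euclidean_space \<Rightarrow> complex) \<Rightarrow> 'a \<Rightarrow> complex" where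
  "ball_trunc R u = (\<lambda>x. indicator (cball 0 R) x * u x)"

lemma indicator_cball_L2: "(indicator (cball (0::'a::euclidean_space) R) :: 'a \<Rightarrow> complex) \<in> L2"
proof (rule L2I)
  have "(cmod (indicator (cball 0 R) x))\<^sup>2 = indicator (cball 0 R) x" for x :: 'a by (simp add: indicator_def)
  moreover have "integrable lborel (indicator (cball (0::'a) R) :: 'a \<Rightarrow> real)"
    using emeasure_lborel_cball_finite[of "0::'a" R] by (simp add: integrable_indicator_iff)
  ultimately show "integrable lborel (\<lambda>x::'a. (cmod (indicator (cball 0 R) x))\<^sup>2)" by simp
qed simp

lemma ball_trunc_L2: "u \<in> L2 \<Longrightarrow> ball_trunc R u \<in> L2"
  unfolding ball_trunc_def by (rule L2_bounded_mult(1)[where B=1]) (auto simp: indicator_def)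

lemma ball_trunc_integrable: "u \<in> L2 \<Longrightarrow> integrable lborel (ball_trunc R u)"
  unfolding ball_trunc_def by (rule L2_prod_integrable[OF indicator_cball_L2])

lemma ball_trunc_tendsto:
  fixes u :: "'a::euclidean_space \<Rightarrow> complex"
  assumes u: "u \<in> L2"
  shows "((\<lambda>R. L2_dist (ball_trunc R u) u) \<longlongrightarrow> 0) at_top"
proof -
  have um [measurable]: "u \<in> borel_measurable borel" using u by measurable
  have "((\<lambda>R. LINT x|lborel. (cmod (ball_trunc R u x - u x))\<^sup>2) \<longlongrightarrow> (LINT x|(lborel::'a measure). (0::real))) at_top"
  proof (rule integral_dominated_convergence_at_top[where w="\<lambda>x. (cmod (u x))\<^sup>2"])
    show "AE x in lborel. ((\<lambda>R. (cmod (ball_trunc R u x - u x))\<^sup>2) \<longlongrightarrow> 0) at_top"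
    proof (rule AE_I2)
      fix x :: 'a
      have "\<forall>\<^sub>F R in at_top. (cmod (ball_trunc R u x - u x))\<^sup>2 = 0"
        using eventually_ge_at_top[of "norm x"] by eventually_elim (simp add: ball_trunc_def)
      then show "((\<lambda>R. (cmod (ball_trunc R u x - u x))\<^sup>2) \<longlongrightarrow> 0) at_top" by (rule tendsto_eventually)
    qed
    show "\<forall>\<^sub>F R in at_top. AE x in lborel. norm ((cmod (ball_trunc R u x - u x))\<^sup>2) \<le> (cmod (u x))\<^sup>2"
      by (intro always_eventually allI AE_I2) (simp add: ball_trunc_def indicator_def)
  qed (auto simp: L2_integrable[OF u] ball_trunc_def)
  then have "((\<lambda>R. sqrt (LINT x|lborel. (cmod (ball_trunc R u x - u x))\<^sup>2)) \<longlongrightarrow> sqrt 0) at_top"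
    by (intro tendsto_intros) simp
  then show ?thesis by (simp add: L2_norm_def)
qed

lemma ball_trunc_tendsto_seq:
  "u \<in> L2 \<Longrightarrow> (\<lambda>n. L2_dist (ball_trunc (real n) u) u) \<longlonglongrightarrow> 0"
  by (rule filterlim_compose[OF ball_trunc_tendsto filterlim_real_sequentially])

lemma fourier_integral_isometry_diff:
  assumes "integrable lborel u" "u \<in> L2" "integrable lborel v" "v \<in> L2"
  shows "L2_dist (fourier_integral u) (fourier_integral v) = L2_dist u v"
  unfolding fourier_integral_diff[OF assms(1,3), symmetric]
  by (rule Plancherel_L1_L2(2)) (use assms L2_diff in auto)

lemma fourier_exists:
  fixes u :: "'a::euclidean_space \<Rightarrow> complex"
  assumes u: "u \<in> L2"
  shows "\<exists>g. g \<in> L2 \<and> ((\<lambda>R. L2_dist (fourier_integral (ball_trunc R u)) g) \<longlongrightarrow> 0) at_top"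
proof -
  let ?t = "\<lambda>n::nat. ball_trunc (real n) u"
  note T = ball_trunc_L2[OF u] ball_trunc_integrable[OF u]
  have F2: "fourier_integral (ball_trunc R u) \<in> L2" for R by (rule Plancherel_L1_L2(1)[OF T(2,1)])
  have tri: "L2_dist (fourier_integral (ball_trunc R u)) (fourier_integral (ball_trunc S u))
     \<le> L2_dist (ball_trunc R u) u + L2_dist (ball_trunc S u) u" for R S
    unfolding fourier_integral_isometry_diff[OF T(2,1) T(2,1)]
    using L2_norm_diff_triangle[OF T(1) u T(1), of R S] by (simp add: L2_norm_minus_commute[of u])
  have C: "\<exists>N. \<forall>i\<ge>N. \<forall>j\<ge>N. L2_dist (fourier_integral (?t i)) (fourier_integral (?t j)) < e" if e: "e > 0" for e
  proof -
    obtain N where N: "\<And>n. n \<ge> N \<Longrightarrow> L2_dist (?t n) u < e / 2"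
      using LIMSEQ_D[OF ball_trunc_tendsto_seq[OF u], of "e / 2"] e by auto
    have "L2_dist (fourier_integral (?t i)) (fourier_integral (?t j)) < e" if "i \<ge> N" "j \<ge> N" for i j
      using tri[of "real i" "real j"] N[OF that(1)] N[OF that(2)] by linarith
    then show ?thesis by blast
  qed
  obtain g where g: "g \<in> L2" "(\<lambda>n. L2_dist (fourier_integral (?t n)) g) \<longlonglongrightarrow> 0"
    using L2_complete[OF F2 C] by blast
  have "L2_dist (fourier_integral (ball_trunc R u)) g \<le> L2_dist (ball_trunc R u) u" for R
  proof (rule LIMSEQ_le_const)
    show "(\<lambda>n. L2_dist (ball_trunc R u) u + L2_dist (?t n) u + L2_dist (fourier_integral (?t n)) g)
      \<longlonglongrightarrow> L2_dist (ball_trunc R u) u"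
      using tendsto_add[OF tendsto_add[OF tendsto_const ball_trunc_tendsto_seq[OF u]] g(2)] by simp
    have "L2_dist (fourier_integral (ball_trunc R u)) g \<le> L2_dist (ball_trunc R u) u + L2_dist (?t n) u + L2_dist (fourier_integral (?t n)) g" for n
      using L2_norm_diff_triangle[OF F2 F2 g(1), of R "real n"] tri[of R "real n"] by linarith
    then show "\<exists>N. \<forall>n\<ge>N. L2_dist (fourier_integral (ball_trunc R u)) g \<le> L2_dist (ball_trunc R u) u + L2_dist (?t n) u + L2_dist (fourier_integral (?t n)) g" by blast
  qed
  then have "((\<lambda>R. L2_dist (fourier_integral (ball_trunc R u)) g) \<longlongrightarrow> 0) at_top"
    by (intro Lim_null_comparison[OF _ ball_trunc_tendsto[OF u]]) simp
  then show ?thesis using g(1) by blast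
qed

lemma fourier_spec:
  assumes u: "u \<in> L2"
  shows "fourier u \<in> L2" "((\<lambda>R. L2_dist (fourier_integral (ball_trunc R u)) (fourier u)) \<longlongrightarrow> 0) at_top"
  using someI_ex[OF fourier_exists[OF u]] unfolding fourier_def ball_trunc_def by blast+

lemma fourier_trunc_tendsto:
  "u \<in> L2 \<Longrightarrow> (\<lambda>n. L2_dist (fourier_integral (ball_trunc (real n) u)) (fourier u)) \<longlonglongrightarrow> 0"
  by (rule filterlim_compose[OF fourier_spec(2) filterlim_real_sequentially])

text \<open>Any approximation by integrable functions computes the transform, not only truncation to balls. This is
  what gives linearity and the action on translates.\<close>

lemma fourier_unique:
  assumes u: "u \<in> L2" and w: "\<And>n::nat. w n \<in> L2" "\<And>n. integrable lborel (w n)" and g: "g \<in> L2"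
    and wu: "(\<lambda>n. L2_dist (w n) u) \<longlonglongrightarrow> 0"
    and wg: "(\<lambda>n. L2_dist (fourier_integral (w n)) g) \<longlonglongrightarrow> 0"
  shows "AE \<xi> in lborel. fourier u \<xi> = g \<xi>"
proof -
  let ?t = "\<lambda>n::nat. ball_trunc (real n) u"
  note T = ball_trunc_L2[OF u] ball_trunc_integrable[OF u]
  have F2: "fourier_integral (w n) \<in> L2" for n by (rule Plancherel_L1_L2(1)[OF w(2,1)])
  have F2t: "fourier_integral (?t n) \<in> L2" for n by (rule Plancherel_L1_L2(1)[OF T(2,1)])
  have "(\<lambda>n. L2_dist (fourier_integral (w n)) (fourier u)) \<longlonglongrightarrow> 0"
  proof (rule real_tendsto_zero_bound)
    show "(\<lambda>n. L2_dist (w n) u + L2_dist (?t n) u + L2_dist (fourier_integral (?t n)) (fourier u)) \<longlonglongrightarrow> 0"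
      using tendsto_add[OF tendsto_add[OF wu ball_trunc_tendsto_seq[OF u]] fourier_trunc_tendsto[OF u]] by simp
    fix n
    have "L2_dist (fourier_integral (w n)) (fourier_integral (?t n)) \<le> L2_dist (w n) u + L2_dist (?t n) u"
      unfolding fourier_integral_isometry_diff[OF w(2,1) T(2,1)]
      using L2_norm_diff_triangle[OF w(1) u T(1), of n "real n"] by (simp add: L2_norm_minus_commute[of u])
    then show "L2_dist (fourier_integral (w n)) (fourier u) \<le> L2_dist (w n) u + L2_dist (?t n) u + L2_dist (fourier_integral (?t n)) (fourier u)"
      using L2_norm_diff_triangle[OF F2[of n] F2t[of n] fourier_spec(1)[OF u]] by linarith
  qed simp
  then show ?thesis by (rule L2_limit_unique[OF F2 fourier_spec(1)[OF u] g _ wg])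
qed

lemma fourier_eq_fourier_integral:
  assumes "u \<in> L2" "integrable lborel u"
  shows "AE \<xi> in lborel. fourier u \<xi> = fourier_integral u \<xi>"
  by (rule fourier_unique[where w="\<lambda>n. u"]) (use assms Plancherel_L1_L2(1) in auto)

lemma fourier_norm:
  assumes u: "u \<in> L2" shows "L2_norm (fourier u) = L2_norm u"
proof -
  note T = ball_trunc_L2[OF u] ball_trunc_integrable[OF u]
  have "(\<lambda>n. L2_norm (fourier_integral (ball_trunc (real n) u))) \<longlonglongrightarrow> L2_norm (fourier u)"
    by (rule L2_norm_tendsto[OF Plancherel_L1_L2(1)[OF T(2,1)] fourier_spec(1)[OF u] fourier_trunc_tendsto[OF u]])
  moreover have "(\<lambda>n. L2_norm (fourier_integral (ball_trunc (real n) u))) \<longlonglongrightarrow> L2_norm u"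
    unfolding Plancherel_L1_L2(2)[OF T(2,1)]
    by (rule L2_norm_tendsto[OF T(1) u ball_trunc_tendsto_seq[OF u]])
  ultimately show ?thesis by (rule LIMSEQ_unique)
qed

lemma fourier_diff:
  assumes u: "u \<in> L2" and v: "v \<in> L2"
  shows "AE \<xi> in lborel. fourier (\<lambda>x. u x - v x) \<xi> = fourier u \<xi> - fourier v \<xi>"
proof (rule fourier_unique[where w="\<lambda>n x. ball_trunc (real n) u x - ball_trunc (real n) v x"])
  note U = ball_trunc_L2[OF u] ball_trunc_integrable[OF u] and V = ball_trunc_L2[OF v] ball_trunc_integrable[OF v]
  note FU = Plancherel_L1_L2(1)[OF U(2,1)] and FV = Plancherel_L1_L2(1)[OF V(2,1)]
  show "(\<lambda>x. u x - v x) \<in> L2" "(\<lambda>\<xi>. fourier u \<xi> - fourier v \<xi>) \<in> L2"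
    using u v by (auto intro: L2_diff fourier_spec)
  show "(\<lambda>x. ball_trunc (real n) u x - ball_trunc (real n) v x) \<in> L2" for n using U V by (auto intro: L2_diff)
  show "integrable lborel (\<lambda>x. ball_trunc (real n) u x - ball_trunc (real n) v x)" for n using U V by auto
  show "(\<lambda>n. L2_norm (\<lambda>x. ball_trunc (real n) u x - ball_trunc (real n) v x - (u x - v x))) \<longlonglongrightarrow> 0"
  proof (rule real_tendsto_zero_bound)
    show "(\<lambda>n. L2_dist (ball_trunc (real n) u) u + L2_dist (ball_trunc (real n) v) v) \<longlonglongrightarrow> 0"
      using tendsto_add[OF ball_trunc_tendsto_seq[OF u] ball_trunc_tendsto_seq[OF v]] by simp
    show "L2_norm (\<lambda>x. ball_trunc (real n) u x - ball_trunc (real n) v x - (u x - v x)) \<le> L2_dist (ball_trunc (real n) u) u + L2_dist (ball_trunc (real n) v) v" for n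
      using L2_norm_triangle[OF L2_diff[OF U(1) u] L2_diff[OF v V(1)], of "real n" "real n"]
      by (simp add: L2_norm_minus_commute[of v] algebra_simps)
  qed simp
  show "(\<lambda>n. L2_norm (\<lambda>\<xi>. fourier_integral (\<lambda>x. ball_trunc (real n) u x - ball_trunc (real n) v x) \<xi> - (fourier u \<xi> - fourier v \<xi>))) \<longlonglongrightarrow> 0"
    unfolding fourier_integral_diff[OF U(2) V(2)]
  proof (rule real_tendsto_zero_bound)
    show "(\<lambda>n. L2_dist (fourier_integral (ball_trunc (real n) u)) (fourier u) + L2_dist (fourier_integral (ball_trunc (real n) v)) (fourier v)) \<longlonglongrightarrow> 0"
      using tendsto_add[OF fourier_trunc_tendsto[OF u] fourier_trunc_tendsto[OF v]] by simp
    show "L2_norm (\<lambda>\<xi>. fourier_integral (ball_trunc (real n) u) \<xi> - fourier_integral (ball_trunc (real n) v) \<xi> - (fourier u \<xi> - fourier v \<xi>))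
      \<le> L2_dist (fourier_integral (ball_trunc (real n) u)) (fourier u) + L2_dist (fourier_integral (ball_trunc (real n) v)) (fourier v)" for n
      using L2_norm_triangle[OF L2_diff[OF FU fourier_spec(1)[OF u]] L2_diff[OF fourier_spec(1)[OF v] FV], of "real n" "real n"]
      by (simp add: L2_norm_minus_commute[of "fourier v"] algebra_simps)
  qed simp
qed

lemma fourier_scale:
  fixes u :: "'a::euclidean_space \<Rightarrow> complex"
  assumes u: "u \<in> L2"
  shows "AE \<xi> in lborel. fourier (\<lambda>x. c * u x) \<xi> = c * fourier u \<xi>"
proof (rule fourier_unique[where w="\<lambda>n x. c * ball_trunc (real n) u x"])
  note U = ball_trunc_L2[OF u] ball_trunc_integrable[OF u]
  note FU = Plancherel_L1_L2(1)[OF U(2,1)]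
  show "(\<lambda>x. c * u x) \<in> L2" "(\<lambda>\<xi>. c * fourier u \<xi>) \<in> L2" "(\<lambda>x. c * ball_trunc (real n) u x) \<in> L2" for n
    using u U by (auto intro: L2_scale fourier_spec)
  show "integrable lborel (\<lambda>x. c * ball_trunc (real n) u x)" for n using U by auto
  show "(\<lambda>n. L2_norm (\<lambda>x. c * ball_trunc (real n) u x - c * u x)) \<longlonglongrightarrow> 0"
    unfolding right_diff_distrib[symmetric] L2_scale(2)[OF L2_diff[OF U(1) u]]
    using tendsto_mult_right_zero[OF ball_trunc_tendsto_seq[OF u]] by simp
  have "fourier_integral (\<lambda>x. c * v x) \<xi> = c * fourier_integral v \<xi>" for \<xi> and v :: "'a \<Rightarrow> complex"
    by (simp add: fourier_integral_altdef mult.assoc)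
  then show "(\<lambda>n. L2_norm (\<lambda>\<xi>. fourier_integral (\<lambda>x. c * ball_trunc (real n) u x) \<xi> - c * fourier u \<xi>)) \<longlonglongrightarrow> 0"
    using tendsto_mult_right_zero[OF fourier_trunc_tendsto[OF u]]
    by (simp add: right_diff_distrib[symmetric] L2_scale(2)[OF L2_diff[OF FU fourier_spec(1)[OF u]]])
qed

lemma fourier_integral_translate:
  fixes u :: "'a::euclidean_space \<Rightarrow> complex"
  assumes [measurable]: "u \<in> borel_measurable borel"
  shows "fourier_integral (\<lambda>x. u (x - y)) \<xi> = exp (- (\<i> * of_real (\<xi> \<bullet> y))) * fourier_integral u \<xi>"
proof -
  have "(LINT x|lborel. u (x - y) * exp (- (\<i> * of_real (\<xi> \<bullet> x))))
     = (LINT x|lborel. u (x + y - y) * exp (- (\<i> * of_real (\<xi> \<bullet> (x + y)))))"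
    by (rule lborel_translation_integral(1)[symmetric]) measurable
  also have "\<dots> = (LINT x|lborel. exp (- (\<i> * of_real (\<xi> \<bullet> y))) * (u x * exp (- (\<i> * of_real (\<xi> \<bullet> x)))))"
    by (intro Bochner_Integration.integral_cong refl) (simp add: inner_add_right exp_add[symmetric] algebra_simps exp_diff exp_minus divide_simps)
  also have "\<dots> = exp (- (\<i> * of_real (\<xi> \<bullet> y))) * (LINT x|lborel. u x * exp (- (\<i> * of_real (\<xi> \<bullet> x))))"
    by (rule integral_mult_right_zero)
  finally show ?thesis by (simp add: fourier_integral_altdef)
qed

lemma fourier_translate:
  fixes u :: "'a::euclidean_space \<Rightarrow> complex"
  assumes u: "u \<in> L2"
  shows "AE \<xi> in lborel. fourier (\<lambda>x. u (x - y)) \<xi> = exp (- (\<i> * of_real (\<xi> \<bullet> y))) * fourier u \<xi>"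
proof (rule fourier_unique[where w="\<lambda>n x. ball_trunc (real n) u (x - y)"])
  note U = ball_trunc_L2[OF u] ball_trunc_integrable[OF u]
  note FU = Plancherel_L1_L2(1)[OF U(2,1)]
  have tr: "(\<lambda>x. v (x - y)) \<in> L2" "L2_norm (\<lambda>x. v (x - y)) = L2_norm v" if "v \<in> L2" for v :: "'a \<Rightarrow> complex"
    using L2_translate[OF that, of "- y"] by auto
  let ?m = "\<lambda>\<xi>. exp (- (\<i> * of_real (\<xi> \<bullet> y)))"
  have m: "?m \<in> borel_measurable borel" by measurable
  have mm: "(\<lambda>\<xi>. ?m \<xi> * v \<xi>) \<in> L2" "L2_norm (\<lambda>\<xi>. ?m \<xi> * v \<xi>) = L2_norm v" if "v \<in> L2" for v
    using L2_bounded_mult(1)[OF that m, of 1] by (simp_all add: L2_norm_def norm_mult)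
  show "(\<lambda>x. u (x - y)) \<in> L2" "(\<lambda>\<xi>. ?m \<xi> * fourier u \<xi>) \<in> L2" "(\<lambda>x. ball_trunc (real n) u (x - y)) \<in> L2" for n
    using u U by (auto intro: tr mm fourier_spec)
  show "integrable lborel (\<lambda>x. ball_trunc (real n) u (x - y))" for n
    using lborel_translation_integral(2)[of "ball_trunc (real n) u" "- y"] U(2)[of "real n"] by simp
  show "(\<lambda>n. L2_norm (\<lambda>x. ball_trunc (real n) u (x - y) - u (x - y))) \<longlonglongrightarrow> 0"
    using ball_trunc_tendsto_seq[OF u] by (subst tr(2)[OF L2_diff[OF U(1) u]])
  have Um: "ball_trunc (real n) u \<in> borel_measurable borel" for n using U(1) by (rule L2_measurable)
  show "(\<lambda>n. L2_norm (\<lambda>\<xi>. fourier_integral (\<lambda>x. ball_trunc (real n) u (x - y)) \<xi> - ?m \<xi> * fourier u \<xi>)) \<longlonglongrightarrow> 0"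
    unfolding fourier_integral_translate[OF Um] right_diff_distrib[symmetric] mm(2)[OF L2_diff[OF FU fourier_spec(1)[OF u]]]
    by (rule fourier_trunc_tendsto[OF u])
qed

lemma fourier_duality:
  fixes u v :: "'a::euclidean_space \<Rightarrow> complex"
  assumes u: "u \<in> L2" and v: "v \<in> L2"
  shows "(LINT \<xi>|lborel. fourier u \<xi> * v \<xi>) = (LINT x|lborel. u x * fourier v x)"
proof -
  note U = ball_trunc_L2[OF u] ball_trunc_integrable[OF u] and V = ball_trunc_L2[OF v] ball_trunc_integrable[OF v]
  note FU = Plancherel_L1_L2(1)[OF U(2,1)] and FV = Plancherel_L1_L2(1)[OF V(2,1)]
  note Fu = fourier_spec(1)[OF u] and Fv = fourier_spec(1)[OF v]
  have conv: "(\<lambda>n. LINT x|lborel. f n x * g n x) \<longlonglongrightarrow> (LINT x|lborel. f0 x * g0 x)"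
    if "\<And>n::nat. f n \<in> L2" "\<And>n. g n \<in> L2" "f0 \<in> L2" "g0 \<in> L2" 
      "(\<lambda>n. L2_dist (f n) f0) \<longlonglongrightarrow> 0" "(\<lambda>n. L2_dist (g n) g0) \<longlonglongrightarrow> 0" 
    for f g :: "nat \<Rightarrow> 'a \<Rightarrow> complex" and f0 g0
  proof (rule LIM_zero_cancel, rule Lim_null_comparison)
    show "(\<lambda>n. L2_dist (f n) f0 * L2_norm (g n) + L2_norm f0 * L2_dist (g n) g0) \<longlonglongrightarrow> 0"
      using tendsto_add[OF tendsto_mult[OF that(5) L2_norm_tendsto[OF that(2,4,6)]] tendsto_mult[OF tendsto_const that(6)]] by simp
    have "norm ((LINT x|lborel. f n x * g n x) - (LINT x|lborel. f0 x * g0 x)) \<le> L2_dist (f n) f0 * L2_norm (g n) + L2_norm f0 * L2_dist (g n) g0" for n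
    proof -
      have i: "(LINT x|lborel. p x * q x) = L2_inner p (\<lambda>x. cnj (q x))" for p q :: "'a \<Rightarrow> complex" by (simp add: L2_inner_def)
      have "(LINT x|lborel. f n x * g n x) - (LINT x|lborel. f0 x * g0 x) = (LINT x|lborel. (f n x - f0 x) * g n x) + (LINT x|lborel. f0 x * (g n x - g0 x))"
        using L2_prod_integrable[OF that(1) that(2)] L2_prod_integrable[OF that(3) that(4)] L2_prod_integrable[OF that(3) that(2)]
        by (simp add: algebra_simps)
      also have "norm \<dots> \<le> norm (LINT x|lborel. (f n x - f0 x) * g n x) + norm (LINT x|lborel. f0 x * (g n x - g0 x))"
        by (rule norm_triangle_ineq)
      also have "\<dots> \<le> L2_dist (f n) f0 * L2_norm (g n) + L2_norm f0 * L2_dist (g n) g0"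
        unfolding i
        using L2_Cauchy_Schwarz[OF L2_diff[OF that(1) that(3)] L2_cnj[OF that(2)], of n n] L2_Cauchy_Schwarz[OF that(3) L2_cnj[OF L2_diff[OF that(2) that(4)]], of n]
        by (intro add_mono) (simp_all only: L2_norm_cnj)
      finally show ?thesis .
    qed
    then show "\<forall>\<^sub>F n in sequentially. norm ((LINT x|lborel. f n x * g n x) - (LINT x|lborel. f0 x * g0 x)) \<le> L2_dist (f n) f0 * L2_norm (g n) + L2_norm f0 * L2_dist (g n) g0"
      by simp
  qed
  have "(\<lambda>n. LINT \<xi>|lborel. fourier_integral (ball_trunc (real n) u) \<xi> * ball_trunc (real n) v \<xi>) \<longlonglongrightarrow> (LINT \<xi>|lborel. fourier u \<xi> * v \<xi>)"
    by (rule conv[OF FU V(1) Fu v fourier_trunc_tendsto[OF u] ball_trunc_tendsto_seq[OF v]])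
  moreover have "(\<lambda>n. LINT \<xi>|lborel. fourier_integral (ball_trunc (real n) u) \<xi> * ball_trunc (real n) v \<xi>) \<longlonglongrightarrow> (LINT x|lborel. u x * fourier v x)"
    unfolding fourier_integral_duality[OF U(2) V(2)]
    by (rule conv[OF U(1) FV u Fv ball_trunc_tendsto_seq[OF u] fourier_trunc_tendsto[OF v]])
  ultimately show ?thesis by (rule LIMSEQ_unique)
qed

definition inv_fourier :: "('a::euclidean_space \<Rightarrow> complex) \<Rightarrow> 'a \<Rightarrow> complex" where
  "inv_fourier g = (\<lambda>x. cnj (fourier (\<lambda>\<xi>. cnj (g \<xi>)) x))"

lemma inv_fourier_L2: "g \<in> L2 \<Longrightarrow> inv_fourier g \<in> L2"
  unfolding inv_fourier_def by (intro L2_cnj fourier_spec)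

lemma inv_fourier_norm: "g \<in> L2 \<Longrightarrow> L2_norm (inv_fourier g) = L2_norm g"
  unfolding inv_fourier_def by (simp add: L2_norm_cnj fourier_norm L2_cnj)

lemma fourier_adjoint:
  assumes u: "u \<in> L2" and g: "g \<in> L2"
  shows "L2_inner (fourier u) g = L2_inner u (inv_fourier g)"
  unfolding L2_inner_def inv_fourier_def using fourier_duality[OF u L2_cnj[OF g]] by simp

text \<open>The transform and \<open>inv_fourier\<close> are adjoint to each other and both isometric, so expanding
  \<open>||\<F> \<F>\<^sup>* g - g||\<^sup>2\<close> gives zero. Surjectivity of the transform follows without an inversion formula.\<close>

lemma fourier_inv_fourier:
  assumes g: "g \<in> L2"
  shows "AE \<xi> in lborel. fourier (inv_fourier g) \<xi> = g \<xi>"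
proof -
  have F: "fourier (inv_fourier g) \<in> L2" by (intro fourier_spec inv_fourier_L2 g)
  have "L2_inner (fourier (inv_fourier g)) g = of_real ((L2_norm g)\<^sup>2)"
    by (simp add: fourier_adjoint[OF inv_fourier_L2[OF g] g] L2_inner_self inv_fourier_norm[OF g])
  then have "(L2_dist (fourier (inv_fourier g)) g)\<^sup>2 = 0"
    unfolding L2_norm_diff_sq[OF F g] fourier_norm[OF inv_fourier_L2[OF g]] inv_fourier_norm[OF g]
    by simp
  then show ?thesis using L2_norm_eq_0_iff[OF L2_diff[OF F g]] by simp
qed

definition inv_fourier_integral :: "('a::euclidean_space \<Rightarrow> complex) \<Rightarrow> 'a \<Rightarrow> complex" where
  "inv_fourier_integral g x = of_real (fourier_const TYPE('a)) * (LINT \<xi>|lborel. g \<xi> * exp (\<i> * of_real (x \<bullet> \<xi>)))"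

lemma inv_fourier_eq_integral:
  fixes g :: "'a::euclidean_space \<Rightarrow> complex"
  assumes g: "g \<in> L2" "integrable lborel g"
  shows "AE x in lborel. inv_fourier g x = inv_fourier_integral g x"
proof -
  have "AE x in lborel. fourier (\<lambda>\<xi>. cnj (g \<xi>)) x = fourier_integral (\<lambda>\<xi>. cnj (g \<xi>)) x"
    by (rule fourier_eq_fourier_integral) (use g L2_cnj in auto)
  then show ?thesis
  proof eventually_elim
    case (elim x)
    have "(LINT \<xi>|lborel. cnj (g \<xi>) * exp (- (\<i> * of_real (x \<bullet> \<xi>)))) = (LINT \<xi>|lborel. cnj (g \<xi> * exp (\<i> * of_real (x \<bullet> \<xi>))))"
      by (intro Bochner_Integration.integral_cong refl) (simp add: exp_cnj)
    also have "\<dots> = cnj (LINT \<xi>|lborel. g \<xi> * exp (\<i> * of_real (x \<bullet> \<xi>)))"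
      by (rule Bochner_Integration.integral_cnj)
    finally show ?case by (simp add: inv_fourier_def inv_fourier_integral_def elim fourier_integral_altdef)
  qed
qed

section \<open>The fractional Laplacian on the Fourier side\<close>

definition frac_symbol :: "real \<Rightarrow> ('a::euclidean_space \<Rightarrow> complex) \<Rightarrow> 'a \<Rightarrow> complex" where
  "frac_symbol s u = (\<lambda>\<xi>. of_real (norm \<xi> powr s) * fourier u \<xi>)"

lemma Hs_iff: "u \<in> Hs s \<longleftrightarrow> u \<in> L2 \<and> frac_symbol s u \<in> L2"
  by (simp add: Hs_def frac_symbol_def)

lemma frac_symbol_measurable: "u \<in> L2 \<Longrightarrow> frac_symbol s u \<in> borel_measurable borel"
  unfolding frac_symbol_def using fourier_spec(1)[of u] by measurable

lemma frac_symbol_diff: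
  "u \<in> L2 \<Longrightarrow> v \<in> L2 \<Longrightarrow> AE \<xi> in lborel. frac_symbol s u \<xi> - frac_symbol s v \<xi> = frac_symbol s (\<lambda>x. u x - v x) \<xi>"
  using fourier_diff[of u v] unfolding frac_symbol_def by (auto elim!: eventually_mono simp: right_diff_distrib)

text \<open>The inverse transform of the symbol is an admissible choice, so the function selected by the definition
  has the right transform, and Plancherel computes its norm.\<close>

lemma frac_laplacian_norm:
  assumes u: "u \<in> Hs s"
  shows "frac_laplacian (s / 2) u \<in> L2" "L2_norm (frac_laplacian (s / 2) u) = L2_norm (frac_symbol s u)"
proof -
  have g: "frac_symbol s u \<in> L2" using u by (simp add: Hs_iff)
  let ?P = "\<lambda>v. v \<in> L2 \<and> (AE \<xi> in lborel. fourier v \<xi> = of_real (norm \<xi> powr (2 * (s / 2))) * fourier u \<xi>)"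
  have "?P (inv_fourier (frac_symbol s u))"
    using inv_fourier_L2[OF g] fourier_inv_fourier[OF g] by (simp add: frac_symbol_def)
  then have P: "?P (frac_laplacian (s / 2) u)"
    unfolding frac_laplacian_def by (rule someI[of ?P])
  then show L: "frac_laplacian (s / 2) u \<in> L2" by blast
  have "L2_norm (frac_laplacian (s / 2) u) = L2_norm (fourier (frac_laplacian (s / 2) u))"
    by (rule fourier_norm[OF L, symmetric])
  also have "\<dots> = L2_norm (frac_symbol s u)"
    using P by (intro L2_norm_cong_AE L2_measurable[OF fourier_spec(1)[OF L]] L2_measurable[OF g]) (simp add: frac_symbol_def)
  finally show "L2_norm (frac_laplacian (s / 2) u) = L2_norm (frac_symbol s u)" .
qed

lemma Hs_diff:
  assumes u: "u \<in> Hs s" and v: "v \<in> Hs s"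
  shows "(\<lambda>x. u x - v x) \<in> Hs s" 
    "L2_norm (frac_symbol s (\<lambda>x. u x - v x)) = L2_dist (frac_symbol s u) (frac_symbol s v)"
proof -
  have uv: "u \<in> L2" "v \<in> L2" "frac_symbol s u \<in> L2" "frac_symbol s v \<in> L2" using u v by (auto simp: Hs_iff)
  note d = frac_symbol_diff[OF uv(1,2), of s]
  note m = frac_symbol_measurable[OF L2_diff[OF uv(1,2)], of s]
  show "(\<lambda>x. u x - v x) \<in> Hs s"
    using L2_cong_AE[OF L2_diff[OF uv(3,4)] m d] L2_diff[OF uv(1,2)] by (simp add: Hs_iff)
  show "L2_norm (frac_symbol s (\<lambda>x. u x - v x)) = L2_dist (frac_symbol s u) (frac_symbol s v)"
    by (rule L2_norm_cong_AE[OF L2_measurable[OF L2_diff[OF uv(3,4)]] m d, symmetric])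
qed

lemma Hs_scale:
  assumes u: "u \<in> Hs s"
  shows "(\<lambda>x. c * u x) \<in> Hs s" "L2_norm (frac_symbol s (\<lambda>x. c * u x)) = cmod c * L2_norm (frac_symbol s u)"
proof -
  have u2: "u \<in> L2" "frac_symbol s u \<in> L2" using u by (auto simp: Hs_iff)
  have d: "AE \<xi> in lborel. c * frac_symbol s u \<xi> = frac_symbol s (\<lambda>x. c * u x) \<xi>"
    using fourier_scale[OF u2(1), of c] by (auto elim!: eventually_mono simp: frac_symbol_def)
  note m = frac_symbol_measurable[OF L2_scale(1)[OF u2(1)], of s c]
  show "(\<lambda>x. c * u x) \<in> Hs s"
    using L2_cong_AE[OF L2_scale(1)[OF u2(2)] m d] L2_scale(1)[OF u2(1)] by (simp add: Hs_iff)
  show "L2_norm (frac_symbol s (\<lambda>x. c * u x)) = cmod c * L2_norm (frac_symbol s u)"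
    using L2_norm_cong_AE[OF L2_measurable[OF L2_scale(1)[OF u2(2)]] m d] L2_scale(2)[OF u2(2)] by simp
qed

lemma Hs_translate:
  assumes u: "u \<in> Hs s"
  shows "(\<lambda>x. u (x - y)) \<in> Hs s" "L2_norm (frac_symbol s (\<lambda>x. u (x - y))) = L2_norm (frac_symbol s u)"
proof -
  have u2: "u \<in> L2" "frac_symbol s u \<in> L2" using u by (auto simp: Hs_iff)
  have t: "(\<lambda>x. u (x - y)) \<in> L2" using L2_translate(1)[OF u2(1), of "- y"] by simp
  let ?m = "\<lambda>\<xi>. exp (- (\<i> * of_real (\<xi> \<bullet> y)))"
  have mm: "(\<lambda>\<xi>. ?m \<xi> * frac_symbol s u \<xi>) \<in> L2" "L2_norm (\<lambda>\<xi>. ?m \<xi> * frac_symbol s u \<xi>) = L2_norm (frac_symbol s u)"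
    using L2_bounded_mult(1)[OF u2(2), of ?m 1] by (simp_all add: L2_norm_def norm_mult)
  have d: "AE \<xi> in lborel. ?m \<xi> * frac_symbol s u \<xi> = frac_symbol s (\<lambda>x. u (x - y)) \<xi>"
    using fourier_translate[OF u2(1), of y] by (auto elim!: eventually_mono simp: frac_symbol_def)
  note m = frac_symbol_measurable[OF t, of s]
  show "(\<lambda>x. u (x - y)) \<in> Hs s"
    using L2_cong_AE[OF mm(1) m d] t by (simp add: Hs_iff)
  show "L2_norm (frac_symbol s (\<lambda>x. u (x - y))) = L2_norm (frac_symbol s u)"
    using L2_norm_cong_AE[OF L2_measurable[OF mm(1)] m d] mm(2) by simp
qed

section \<open>Low frequencies and the tail estimate\<close>

definition freq_kernel :: "real \<Rightarrow> 'a::euclidean_space \<Rightarrow> 'a \<Rightarrow> complex" where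
  "freq_kernel R x = (\<lambda>\<xi>. exp (- (\<i> * of_real (x \<bullet> \<xi>))) * indicator (cball 0 R) \<xi>)"

text \<open>The function whose Fourier transform is that of \<open>u\<close> cut off at radius \<open>R\<close>, given pointwise. Writing it as
  an inner product makes the pointwise bound, the Lipschitz bound and weak continuity instances of the
  Cauchy-Schwarz inequality.\<close>

definition lowpass :: "real \<Rightarrow> ('a::euclidean_space \<Rightarrow> complex) \<Rightarrow> 'a \<Rightarrow> complex" where
  "lowpass R u x = of_real (fourier_const TYPE('a)) * L2_inner (fourier u) (freq_kernel R x)"

definition cball_L2 :: "'a::euclidean_space itself \<Rightarrow> real \<Rightarrow> real" where
  "cball_L2 _ R = L2_norm (indicator (cball (0::'a) R))"

lemma freq_kernel_L2:
  "freq_kernel R (x::'a::euclidean_space) \<in> L2" "L2_norm (freq_kernel R x) \<le> cball_L2 TYPE('a) R"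
  unfolding freq_kernel_def cball_L2_def
  using L2_bounded_mult[OF indicator_cball_L2, of "\<lambda>\<xi>. exp (- (\<i> * of_real (x \<bullet> \<xi>)))" 1 R] by auto

lemma iexp_Lipschitz: "cmod (exp (- (\<i> * of_real a)) - exp (- (\<i> * of_real b))) \<le> \<bar>a - b\<bar>"
proof -
  have "exp (- (\<i> * of_real a)) - exp (- (\<i> * of_real b)) = exp (- (\<i> * of_real b)) * (iexp (b - a) - 1)"
    by (simp add: algebra_simps exp_add[symmetric])
  then have "cmod (exp (- (\<i> * of_real a)) - exp (- (\<i> * of_real b))) = cmod (iexp (b - a) - 1)"
    by (simp add: norm_mult)
  also have "\<dots> \<le> \<bar>b - a\<bar>" using iexp_approx1[of "b - a" 0] by simp
  finally show ?thesis by (simp add: abs_minus_commute)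
qed

lemma freq_kernel_Lipschitz:
  fixes x y :: "'a::euclidean_space"
  assumes R: "R \<ge> 0"
  shows "L2_dist (freq_kernel R x) (freq_kernel R y) \<le> R * norm (x - y) * cball_L2 TYPE('a) R"
proof -
  let ?m = "of_real (R * norm (x - y))"
  have *: "AE \<xi> in lborel. cmod (freq_kernel R x \<xi> - freq_kernel R y \<xi>) \<le> cmod (?m * indicator (cball 0 R) \<xi>)"
  proof (rule AE_I2)
    fix \<xi> :: 'a
    show "cmod (freq_kernel R x \<xi> - freq_kernel R y \<xi>) \<le> cmod (?m * indicator (cball 0 R) \<xi>)"
    proof (cases "\<xi> \<in> cball 0 R")
      case True
      have "cmod (freq_kernel R x \<xi> - freq_kernel R y \<xi>) \<le> \<bar>x \<bullet> \<xi> - y \<bullet> \<xi>\<bar>"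
        using True iexp_Lipschitz[of "x \<bullet> \<xi>" "y \<bullet> \<xi>"] by (simp add: freq_kernel_def)
      also have "\<dots> \<le> norm (x - y) * norm \<xi>"
        unfolding inner_diff_left[symmetric] by (rule Cauchy_Schwarz_ineq2)
      also have "\<dots> \<le> norm (x - y) * R" using True by (intro mult_left_mono) auto
      finally show ?thesis using True R by (simp add: norm_mult mult.commute)
    qed (simp add: freq_kernel_def)
  qed
  have i: "(\<lambda>\<xi>. ?m * indicator (cball (0::'a) R) \<xi>) \<in> L2" "L2_norm (\<lambda>\<xi>. ?m * indicator (cball (0::'a) R) \<xi>) = cmod ?m * cball_L2 TYPE('a) R"
    using L2_scale[OF indicator_cball_L2, of ?m R] by (simp_all add: cball_L2_def)
  have "L2_dist (freq_kernel R x) (freq_kernel R y) \<le> L2_norm (\<lambda>\<xi>. ?m * indicator (cball (0::'a) R) \<xi>)"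
    by (rule L2_dominated(2)[OF i(1) _ *]) (intro L2_measurable L2_diff freq_kernel_L2)
  also have "\<dots> = R * norm (x - y) * cball_L2 TYPE('a) R"
    unfolding i(2) using R by (simp add: norm_mult)
  finally show ?thesis .
qed

lemma cball_L2_eq:
  assumes "R \<ge> 0"
  shows "cball_L2 TYPE('a::euclidean_space) R = sqrt (unit_ball_vol (real DIM('a)) * R ^ DIM('a))"
proof -
  have eq: "(cmod (indicator (cball 0 R) x))\<^sup>2 = indicator (cball 0 R) x" for x :: 'a by (simp add: indicator_def)
  have "(LINT x|lborel. (cmod (indicator (cball (0::'a) R) x))\<^sup>2) = measure lborel (cball (0::'a) R)"
    unfolding eq by simp
  also have "\<dots> = unit_ball_vol (real DIM('a)) * R ^ DIM('a)"
    using content_cball[OF assms, of "0::'a"] by simp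
  finally show ?thesis by (simp add: cball_L2_def L2_norm_def)
qed

lemma lowpass_bound:
  fixes u :: "'a::euclidean_space \<Rightarrow> complex"
  assumes u: "u \<in> L2"
  shows "cmod (lowpass R u x) \<le> fourier_const TYPE('a) * cball_L2 TYPE('a) R * L2_norm u"
proof -
  have "cmod (L2_inner (fourier u) (freq_kernel R x)) \<le> L2_norm u * cball_L2 TYPE('a) R"
    using L2_Cauchy_Schwarz[OF fourier_spec(1)[OF u] freq_kernel_L2(1)[of R x]] freq_kernel_L2(2)[of R x]
    unfolding fourier_norm[OF u] by (meson L2_norm_nonneg mult_left_mono order_trans)
  then show ?thesis
    using fourier_const_pos[where 'a='a] by (simp add: lowpass_def norm_mult mult_left_mono mult_ac)
qed

lemma lowpass_Lipschitz:
  fixes u :: "'a::euclidean_space \<Rightarrow> complex"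
  assumes u: "u \<in> L2" and R: "R \<ge> 0"
  shows "cmod (lowpass R u x - lowpass R u y) \<le> (fourier_const TYPE('a) * cball_L2 TYPE('a) R * R * L2_norm u) * norm (x - y)"
proof -
  note k = freq_kernel_L2(1)
  have "L2_inner (fourier u) (freq_kernel R x) - L2_inner (fourier u) (freq_kernel R y) = L2_inner (fourier u) (\<lambda>\<xi>. freq_kernel R x \<xi> - freq_kernel R y \<xi>)"
    by (rule L2_inner_diff_right[OF k k fourier_spec(1)[OF u], symmetric])
  moreover have "cmod (L2_inner (fourier u) (\<lambda>\<xi>. freq_kernel R x \<xi> - freq_kernel R y \<xi>)) \<le> L2_norm u * (R * norm (x - y) * cball_L2 TYPE('a) R)"
    using L2_Cauchy_Schwarz[OF fourier_spec(1)[OF u] L2_diff[OF k[of R x] k[of R y]]] freq_kernel_Lipschitz[OF R, of x y]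
    unfolding fourier_norm[OF u] by (meson L2_norm_nonneg mult_left_mono order_trans)
  ultimately show ?thesis
    using fourier_const_pos[where 'a='a] 
    by (simp add: lowpass_def norm_mult mult_left_mono mult_ac right_diff_distrib[symmetric])
qed

lemma lowpass_continuous: 
  assumes u: "u \<in> L2" and R: "R \<ge> 0"
  shows "continuous_on UNIV (lowpass R u)"
proof (rule continuous_at_imp_continuous_on, rule ballI)
  fix x
  let ?K = "fourier_const TYPE('a) * cball_L2 TYPE('a) R * R * L2_norm u"
  show "isCont (lowpass R u) x"
    unfolding isCont_def
  proof (rule LIM_zero_cancel, rule Lim_null_comparison)
    show "((\<lambda>y. ?K * norm (y - x)) \<longlongrightarrow> 0) (at x)"
      by (rule tendsto_eq_intros refl | simp)+
    show "\<forall>\<^sub>F y in at x. norm (lowpass R u y - lowpass R u x) \<le> ?K * norm (y - x)"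
      using lowpass_Lipschitz[OF u R] by simp
  qed
qed

lemma lowpass_measurable [measurable]: "u \<in> L2 \<Longrightarrow> R \<ge> 0 \<Longrightarrow> lowpass R u \<in> borel_measurable borel"
  by (rule borel_measurable_continuous_onI[OF lowpass_continuous])

lemma lowpass_translate:
  fixes u :: "'a::euclidean_space \<Rightarrow> complex"
  assumes u: "u \<in> L2"
  shows "lowpass R (\<lambda>x. u (x - y)) x = lowpass R u (x - y)"
proof -
  have t: "(\<lambda>x. u (x - y)) \<in> L2" using L2_translate(1)[OF u, of "- y"] by simp
  have m: "fourier (\<lambda>x. u (x - y)) \<in> borel_measurable borel" "fourier u \<in> borel_measurable borel"
    "freq_kernel R z \<in> borel_measurable borel" for z
    using fourier_spec(1)[OF t] fourier_spec(1)[OF u] freq_kernel_L2(1) by (auto intro: L2_measurable)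
  have "L2_inner (fourier (\<lambda>x. u (x - y))) (freq_kernel R x) = L2_inner (fourier u) (freq_kernel R (x - y))"
    unfolding L2_inner_def
  proof (rule integral_cong_AE)
    show "AE \<xi> in lborel. fourier (\<lambda>x. u (x - y)) \<xi> * cnj (freq_kernel R x \<xi>) = fourier u \<xi> * cnj (freq_kernel R (x - y) \<xi>)"
      using fourier_translate[OF u, of y]
    proof eventually_elim
      case (elim \<xi>)
      have "exp (- (\<i> * of_real (\<xi> \<bullet> y))) * exp (\<i> * of_real (x \<bullet> \<xi>)) = exp (\<i> * complex_of_real ((x - y) \<bullet> \<xi>))"
        by (simp add: exp_add[symmetric] inner_diff_left inner_commute algebra_simps)
      then show ?case unfolding elim freq_kernel_def by (simp add: exp_cnj)
    qed
  qed (use m in measurable)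
  then show ?thesis by (simp add: lowpass_def)
qed

lemma lowpass_approx:
  fixes u :: "'a::euclidean_space \<Rightarrow> complex"
  assumes u: "u \<in> L2" and R: "R \<ge> 0"
  shows "lowpass R u \<in> L2"
    "L2_dist u (lowpass R u) = L2_dist (fourier u) (ball_trunc R (fourier u))"
proof -
  let ?g = "ball_trunc R (fourier u)"
  have F: "fourier u \<in> L2" using u by (rule fourier_spec)
  have g: "?g \<in> L2" "integrable lborel ?g" using ball_trunc_L2[OF F] ball_trunc_integrable[OF F] by auto
  have "fourier u \<xi> * cnj (freq_kernel R x \<xi>) = ?g \<xi> * exp (\<i> * of_real (x \<bullet> \<xi>))" for x \<xi>
    by (cases "\<xi> \<in> cball 0 R") (simp_all add: ball_trunc_def freq_kernel_def exp_cnj)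
  then have "lowpass R u x = inv_fourier_integral ?g x" for x
    unfolding lowpass_def inv_fourier_integral_def L2_inner_def by (simp only:)
  then have ae: "AE x in lborel. inv_fourier ?g x = lowpass R u x"
    using inv_fourier_eq_integral[OF g] by simp
  note m = lowpass_measurable[OF u R]
  show L: "lowpass R u \<in> L2" by (rule L2_cong_AE[OF inv_fourier_L2[OF g(1)] m ae])
  have "L2_dist u (lowpass R u) = L2_dist u (inv_fourier ?g)"
    using ae by (intro L2_norm_cong_AE L2_measurable L2_diff u L inv_fourier_L2 g) (auto elim!: eventually_mono)
  also have "\<dots> = L2_norm (fourier (\<lambda>x. u x - inv_fourier ?g x))"
    by (rule fourier_norm[symmetric]) (intro L2_diff u inv_fourier_L2 g)
  also have "\<dots> = L2_dist (fourier u) ?g"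
  proof (rule L2_norm_cong_AE)
    show "AE \<xi> in lborel. fourier (\<lambda>x. u x - inv_fourier ?g x) \<xi> = fourier u \<xi> - ?g \<xi>"
      using fourier_diff[OF u inv_fourier_L2[OF g(1)]] fourier_inv_fourier[OF g(1)] by eventually_elim simp
  qed (intro L2_measurable fourier_spec L2_diff u inv_fourier_L2 g)+
  finally show "L2_dist u (lowpass R u) = L2_dist (fourier u) ?g" .
qed

lemma lowpass_approx_Hs:
  fixes u :: "'a::euclidean_space \<Rightarrow> complex"
  assumes u: "u \<in> Hs s" and R: "R > 0" and s: "s \<ge> 0"
  shows "L2_dist u (lowpass R u) \<le> R powr (- s) * L2_norm (frac_symbol s u)"
proof -
  have u2: "u \<in> L2" "frac_symbol s u \<in> L2" using u by (auto simp: Hs_iff)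
  let ?v = "\<lambda>\<xi>. of_real (R powr (- s)) * frac_symbol s u \<xi>"
  have v: "?v \<in> L2" "L2_norm ?v = R powr (- s) * L2_norm (frac_symbol s u)"
    using L2_scale[OF u2(2), of "of_real (R powr (- s))"] by simp_all
  have "L2_dist (fourier u) (ball_trunc R (fourier u)) \<le> L2_norm ?v"
  proof (rule L2_dominated(2)[OF v(1)])
    show "(\<lambda>\<xi>. fourier u \<xi> - ball_trunc R (fourier u) \<xi>) \<in> borel_measurable borel"
      by (intro L2_measurable L2_diff ball_trunc_L2 fourier_spec u2)
    show "AE \<xi> in lborel. cmod (fourier u \<xi> - ball_trunc R (fourier u) \<xi>) \<le> cmod (?v \<xi>)"
    proof (rule AE_I2)
      fix \<xi> :: 'a
      show "cmod (fourier u \<xi> - ball_trunc R (fourier u) \<xi>) \<le> cmod (?v \<xi>)"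
      proof (cases "norm \<xi> \<le> R")
        case False
        have "1 = R powr (- s) * R powr s" using R by (simp add: powr_add[symmetric])
        also have "\<dots> \<le> R powr (- s) * norm \<xi> powr s"
          using False R s by (intro mult_left_mono powr_mono2) auto
        finally have "1 * cmod (fourier u \<xi>) \<le> (R powr (- s) * norm \<xi> powr s) * cmod (fourier u \<xi>)"
          by (intro mult_right_mono) auto
        then show ?thesis using False by (simp add: ball_trunc_def frac_symbol_def norm_mult mult.assoc)
      qed (simp add: ball_trunc_def)
    qed
  qed
  then show ?thesis unfolding v(2) using lowpass_approx(2)[OF u2(1), of R] R by simp
qed

definition tail :: "real \<Rightarrow> ('a \<Rightarrow> complex) \<Rightarrow> 'a \<Rightarrow> real" where
  "tail l u x = (if l < cmod (u x) then (cmod (u x))\<^sup>2 else 0)"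

lemma tail_integrable:
  fixes u :: "'a::euclidean_space \<Rightarrow> complex"
  assumes u: "u \<in> L2" shows "integrable lborel (tail l u)"
proof (rule Bochner_Integration.integrable_bound[OF L2_integrable[OF u]])
  have [measurable]: "u \<in> borel_measurable borel" using u by measurable
  show "tail l u \<in> borel_measurable lborel" unfolding tail_def by measurable
qed (auto simp: tail_def)

lemma tail_nonneg [simp]: "0 \<le> tail l u x"
  by (simp add: tail_def)

text \<open>Where \<open>|u| > l\<close>, the low-frequency part is at most \<open>l / 2 < |u| / 2\<close>, so the high-frequency part is at least \<open>|u| / 2\<close>.\<close>

lemma tail_le_lowpass:
  fixes u :: "'a::euclidean_space \<Rightarrow> complex"
  assumes u: "u \<in> Hs s" and R: "R > 0" and s: "s \<ge> 0"
    and small: "\<And>x. cmod (lowpass R u x) \<le> l / 2"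
  shows "(LINT x|lborel. tail l u x) \<le> 4 * R powr (- (2 * s)) * (L2_norm (frac_symbol s u))\<^sup>2"
proof -
  have u2: "u \<in> L2" using u by (auto simp: Hs_iff)
  have d: "(\<lambda>x. u x - lowpass R u x) \<in> L2" using u2 R by (intro L2_diff lowpass_approx) auto
  have "(LINT x|lborel. tail l u x) \<le> (LINT x|lborel. 4 * (cmod (u x - lowpass R u x))\<^sup>2)"
  proof (rule integral_mono[OF tail_integrable[OF u2] integrable_mult_right[OF L2_integrable[OF d]]])
    fix x
    show "tail l u x \<le> 4 * (cmod (u x - lowpass R u x))\<^sup>2"
    proof (cases "l < cmod (u x)")
      case True
      have "cmod (u x) \<le> 2 * cmod (u x - lowpass R u x)"
        using norm_triangle_ineq2[of "u x" "lowpass R u x"] small[of x] True by linarith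
      then have "(cmod (u x))\<^sup>2 \<le> (2 * cmod (u x - lowpass R u x))\<^sup>2" by (intro power_mono) auto
      then show ?thesis using True by (simp add: tail_def power_mult_distrib)
    qed (simp add: tail_def)
  qed
  also have "\<dots> = 4 * (L2_dist u (lowpass R u))\<^sup>2" by (simp add: L2_norm_sq)
  also have "\<dots> \<le> 4 * (R powr (- s) * L2_norm (frac_symbol s u))\<^sup>2"
    using lowpass_approx_Hs[OF u R s] by (intro mult_left_mono power_mono) auto
  also have "\<dots> = 4 * R powr (- (2 * s)) * (L2_norm (frac_symbol s u))\<^sup>2"
    by (simp add: power_mult_distrib power2_eq_square[of "R powr _"] powr_add[symmetric])
  finally show ?thesis .
qed

lemma tail_decay:
  fixes s :: real
  assumes s: "s > 0"
  obtains C where "C > 0" "\<And>(u::'a::euclidean_space \<Rightarrow> complex) l. u \<in> Hs s \<Longrightarrow> l > 0 \<Longrightarrow>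
    (LINT x|lborel. tail l u x) \<le> C * (L2_norm u / l) powr (4 * s / DIM('a)) * (L2_norm (frac_symbol s u))\<^sup>2"
proof -
  define N where "N = real DIM('a)"
  have N: "N > 0" by (simp add: N_def)
  define C1 where "C1 = fourier_const TYPE('a) * sqrt (unit_ball_vol N)"
  have C1: "C1 > 0" using fourier_const_pos[where 'a='a] N by (simp add: C1_def)
  define C where "C = 4 * (2 * C1) powr (4 * s / N)"
  have C: "C > 0" using C1 by (simp add: C_def)
  have "(LINT x|lborel. tail l u x) \<le> C * (L2_norm u / l) powr (4 * s / N) * (L2_norm (frac_symbol s u))\<^sup>2"
    if u: "u \<in> Hs s" and l: "l > 0" for u :: "'a \<Rightarrow> complex" and l
  proof (cases "L2_norm u = 0")
    case True
    have u2: "u \<in> L2" using u by (auto simp: Hs_iff)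
    have ae: "AE x in lborel. u x = 0" using True L2_norm_eq_0_iff[OF u2] by simp
    have "(LINT x|lborel. tail l u x) = 0"
      by (rule integral_eq_zero_AE) (use ae l in \<open>auto elim!: eventually_mono simp: tail_def\<close>)
    then show ?thesis using True by simp
  next
    case False
    then have n: "L2_norm u > 0" using L2_norm_nonneg[of u] by linarith
    have u2: "u \<in> L2" using u by (auto simp: Hs_iff)
    define a where "a = 2 * C1 * (L2_norm u / l)"
    have a: "a > 0" using C1 n l by (simp add: a_def)
    \<comment> \<open>the radius at which the pointwise bound of the low-frequency part is exactly \<open>l / 2\<close>\<close>
    define R where "R = (1 / a) powr (2 / N)"
    have R: "R > 0" using a by (simp add: R_def)
    have "cball_L2 TYPE('a) R = sqrt (unit_ball_vol N) * R powr (N / 2)"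
      using R by (simp add: cball_L2_eq real_sqrt_mult N_def powr_half_sqrt[symmetric] powr_realpow[symmetric] powr_powr)
    also have "R powr (N / 2) = 1 / a" unfolding R_def powr_powr using a N by simp
    finally have "fourier_const TYPE('a) * cball_L2 TYPE('a) R * L2_norm u = C1 * (1 / a) * L2_norm u"
      by (simp add: C1_def)
    also have "\<dots> = l / 2" using C1 n l by (simp add: a_def)
    finally have "fourier_const TYPE('a) * cball_L2 TYPE('a) R * L2_norm u = l / 2" .
    then have small: "cmod (lowpass R u x) \<le> l / 2" for x using lowpass_bound[OF u2, of R x] by simp
    have "R powr (- (2 * s)) = a powr (4 * s / N)"
      unfolding R_def powr_powr using a N by (simp add: powr_divide powr_minus_divide)
    also have "\<dots> = (2 * C1) powr (4 * s / N) * (L2_norm u / l) powr (4 * s / N)"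
      unfolding a_def using C1 n l by (subst powr_mult) auto
    finally have "4 * R powr (- (2 * s)) = C * (L2_norm u / l) powr (4 * s / N)"
      by (simp add: C_def)
    then show ?thesis using tail_le_lowpass[OF u R less_imp_le[OF s] small] by simp
  qed
  then show ?thesis using that[OF C] unfolding N_def by blast
qed

text \<open>For \<open>l = 1\<close> this is the positive part of \<open>r\<^sup>2 ln r\<^sup>2\<close> at \<open>r = |u|\<close>.\<close>

definition log_tail :: "real \<Rightarrow> ('a \<Rightarrow> complex) \<Rightarrow> 'a \<Rightarrow> real" where
  "log_tail l u x = (if l < cmod (u x) then (cmod (u x))\<^sup>2 * ln ((cmod (u x))\<^sup>2 / l\<^sup>2) else 0)"

lemma log_tail_measurable [measurable (raw)]:
  assumes [measurable]: "u \<in> borel_measurable M"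
  shows "log_tail l u \<in> borel_measurable M"
  unfolding log_tail_def by measurable

lemma log_tail_nonneg: "l > 0 \<Longrightarrow> 0 \<le> log_tail l u x"
proof -
  assume l: "l > 0"
  show "0 \<le> log_tail l u x"
  proof (cases "l < cmod (u x)")
    case True
    have "l\<^sup>2 \<le> (cmod (u x))\<^sup>2" using True l by (intro power_mono) auto
    then show ?thesis using True l by (simp add: log_tail_def)
  qed (simp add: log_tail_def)
qed

text \<open>For \<open>|u| > l\<close> the number of \<open>k \<ge> 0\<close> with \<open>l e\<^sup>k < |u|\<close> is \<open>\<lceil>ln (|u| / l)\<rceil>\<close>, and \<open>ln (|u|\<^sup>2 / l\<^sup>2) = 2 ln (|u| / l)\<close>.\<close>

lemma log_tail_le_dyadic:
  assumes l: "l > 0" and n: "real n \<ge> ln (cmod (u x) / l) + 1"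
  shows "log_tail l u x \<le> 2 * (\<Sum>k<n. tail (l * exp (real k)) u x)"
proof (cases "l < cmod (u x)")
  case True
  define t where "t = ln (cmod (u x) / l)"
  have c0: "cmod (u x) > 0" using True l by linarith
  have t: "t > 0" unfolding t_def using True l by (intro ln_gt_zero) (simp add: field_simps)
  have ln: "ln ((cmod (u x))\<^sup>2 / l\<^sup>2) = 2 * t"
    using c0 l by (simp add: t_def power_divide[symmetric] ln_realpow)
  define M where "M = nat \<lceil>t\<rceil>"
  have Mt: "t \<le> real M" using t by (simp add: M_def)
  have Mn: "M \<le> n" using n t unfolding M_def t_def[symmetric] by linarith
  have tl: "tail (l * exp (real k)) u x = (cmod (u x))\<^sup>2" if k: "k < M" for k
  proof -
    have "real k < t" using k unfolding M_def by linarith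
    then have "exp (real k) < exp t" by simp
    also have "exp t = cmod (u x) / l" using c0 l by (simp add: t_def)
    finally show ?thesis using l by (simp add: tail_def field_simps)
  qed
  have "log_tail l u x = 2 * (t * (cmod (u x))\<^sup>2)" using True by (simp add: log_tail_def ln)
  also have "\<dots> \<le> 2 * (real M * (cmod (u x))\<^sup>2)" using Mt by (intro mult_left_mono mult_right_mono) auto
  also have "real M * (cmod (u x))\<^sup>2 = (\<Sum>k<M. tail (l * exp (real k)) u x)" by (simp add: tl)
  also have "\<dots> \<le> (\<Sum>k<n. tail (l * exp (real k)) u x)" using Mn by (intro sum_mono2) auto
  finally show ?thesis by simp
next
  case False
  then show ?thesis by (simp add: log_tail_def sum_nonneg)
qed

text \<open>A logarithmic Sobolev inequality: by \<open>tail_decay\<close> the contributions of the levels \<open>l e\<^sup>k\<close> form a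
  geometric series.\<close>

lemma log_tail_bound:
  fixes s :: real
  assumes s: "s > 0"
  obtains C where "C > 0" 
    "\<And>(u::'a::euclidean_space \<Rightarrow> complex) l. u \<in> Hs s \<Longrightarrow> l > 0 \<Longrightarrow> integrable lborel (log_tail l u)"
    "\<And>(u::'a \<Rightarrow> complex) l. u \<in> Hs s \<Longrightarrow> l > 0 \<Longrightarrow>
    (LINT x|lborel. log_tail l u x) \<le> C * (L2_norm u / l) powr (4 * s / DIM('a)) * (L2_norm (frac_symbol s u))\<^sup>2"
proof -
  define p where "p = 4 * s / DIM('a)"
  have p: "p > 0" using s by (simp add: p_def)
  obtain C0 where C0: "C0 > 0" and tb: "\<And>(u::'a \<Rightarrow> complex) l. u \<in> Hs s \<Longrightarrow> l > 0 \<Longrightarrow>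
    (LINT x|lborel. tail l u x) \<le> C0 * (L2_norm u / l) powr p * (L2_norm (frac_symbol s u))\<^sup>2"
    using tail_decay[OF s, where 'a='a] unfolding p_def by metis
  define q where "q = exp (- p)"
  have q: "0 < q" "q < 1" using p by (auto simp: q_def)
  define C where "C = 2 * C0 / (1 - q)"
  have C: "C > 0" using C0 q by (simp add: C_def)
  have main: "integrable lborel (log_tail l u) \<and> (LINT x|lborel. log_tail l u x) \<le> C * (L2_norm u / l) powr p * (L2_norm (frac_symbol s u))\<^sup>2"
    if u: "u \<in> Hs s" and l: "l > 0" for u :: "'a \<Rightarrow> complex" and l
  proof -
    have u2: "u \<in> L2" using u by (auto simp: Hs_iff)
    have [measurable]: "u \<in> borel_measurable borel" using u2 by measurable
    let ?E = "(L2_norm (frac_symbol s u))\<^sup>2"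
    let ?B = "C * (L2_norm u / l) powr p * ?E"
    define f where "f n x = 2 * (\<Sum>k<n. tail (l * exp (real k)) u x)" for n x
    have fi: "integrable lborel (f n)" for n unfolding f_def using tail_integrable[OF u2] by auto
    have f0: "0 \<le> f n x" for n x by (simp add: f_def sum_nonneg)
    have geo: "(\<Sum>k<n. q ^ k) \<le> 1 / (1 - q)" for n
      using sum_gp_strict[of q n] q by (simp add: divide_right_mono)
    have fb: "(LINT x|lborel. f n x) \<le> ?B" for n
    proof -
      have "(LINT x|lborel. f n x) = 2 * (\<Sum>k<n. LINT x|lborel. tail (l * exp (real k)) u x)"
        unfolding f_def using tail_integrable[OF u2] by simp
      also have "\<dots> \<le> 2 * (\<Sum>k<n. C0 * (L2_norm u / l) powr p * ?E * q ^ k)"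
      proof (intro mult_left_mono sum_mono)
        fix k
        have "(LINT x|lborel. tail (l * exp (real k)) u x) \<le> C0 * (L2_norm u / (l * exp (real k))) powr p * ?E"
          by (rule tb[OF u]) (simp add: l)
        also have "L2_norm u / (l * exp (real k)) = (L2_norm u / l) * exp (- real k)"
          by (simp add: exp_minus field_simps)
        also have "\<dots> powr p = (L2_norm u / l) powr p * exp (- real k) powr p"
          using l by (subst powr_mult) auto
        also have "exp (- real k) powr p = q ^ k"
          by (simp add: q_def powr_def exp_of_nat_mult[symmetric] mult_ac)
        finally show "(LINT x|lborel. tail (l * exp (real k)) u x) \<le> C0 * (L2_norm u / l) powr p * ?E * q ^ k"
          by (simp add: mult_ac)
      qed simp
      also have "\<dots> = 2 * (C0 * (L2_norm u / l) powr p * ?E * (\<Sum>k<n. q ^ k))" by (simp add: sum_distrib_left)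
      also have "\<dots> \<le> 2 * (C0 * (L2_norm u / l) powr p * ?E * (1 / (1 - q)))"
        using C0 by (intro mult_left_mono geo mult_nonneg_nonneg) auto
      finally show ?thesis by (simp add: C_def)
    qed
    \<comment> \<open>these minima equal \<open>log_tail\<close> from some \<open>n\<close> on, so Fatou applies without naming the limit of \<open>f\<close>\<close>
    define h where "h n x = min (log_tail l u x) (f n x)" for n x
    have hi: "integrable lborel (h n)" for n
    proof (rule Bochner_Integration.integrable_bound[OF fi])
      show "h n \<in> borel_measurable lborel" unfolding h_def using borel_measurable_integrable[OF fi[of n]] by measurable
      show "AE x in lborel. norm (h n x) \<le> norm (f n x)"
        using log_tail_nonneg[OF l, of u] f0 by (auto simp: h_def)
    qed
    have h0: "0 \<le> h n x" for n x using log_tail_nonneg[OF l, of u] f0 by (simp add: h_def)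
    have hlim: "AE x in lborel. (\<lambda>n. h n x) \<longlonglongrightarrow> log_tail l u x"
    proof (rule AE_I2, rule tendsto_eventually)
      fix x
      obtain M where M: "real M \<ge> ln (cmod (u x) / l) + 1" using real_arch_simple by blast
      show "\<forall>\<^sub>F n in sequentially. h n x = log_tail l u x"
        unfolding eventually_sequentially
      proof (intro exI allI impI)
        fix n assume "M \<le> n"
        then have "real n \<ge> ln (cmod (u x) / l) + 1" using M by linarith
        with l have "log_tail l u x \<le> 2 * (\<Sum>k<n. tail (l * exp (real k)) u x)" by (rule log_tail_le_dyadic)
        then show "h n x = log_tail l u x" by (simp add: h_def f_def)
      qed
    qed
    have hb: "\<forall>\<^sub>F n in sequentially. integral\<^sup>L lborel (h n) \<le> ?B"
    proof (rule always_eventually, rule allI)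
      fix n
      have "integral\<^sup>L lborel (h n) \<le> integral\<^sup>L lborel (f n)"
        by (intro integral_mono hi fi) (simp add: h_def)
      then show "integral\<^sup>L lborel (h n) \<le> ?B" using fb[of n] by linarith
    qed
    show ?thesis using integral_Fatou[OF hi h0 _ hlim hb] by simp
  qed
  show ?thesis by (rule that[OF C]) (use main in \<open>auto simp: p_def\<close>)
qed

section \<open>The logarithmic nonlinearity and the Brezis-Lieb lemma\<close>

definition sq_log :: "real \<Rightarrow> real" where
  "sq_log r = r\<^sup>2 * ln (r\<^sup>2)"

lemma sq_log_measurable [measurable]: "sq_log \<in> borel_measurable borel"
  unfolding sq_log_def by measurable

lemma sq_log_0 [simp]: "sq_log 0 = 0" and sq_log_1 [simp]: "sq_log 1 = 0"
  by (auto simp: sq_log_def)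

lemma sq_log_le_log_tail:
  assumes l: "l > 0"
  shows "sq_log (cmod (u x)) \<le> ln (l\<^sup>2) * (cmod (u x))\<^sup>2 + log_tail l u x"
proof (cases "u x = 0")
  case False
  then have c: "cmod (u x) > 0" by simp
  show ?thesis
  proof (cases "l < cmod (u x)")
    case True
    then show ?thesis using c l by (simp add: sq_log_def log_tail_def ln_div algebra_simps)
  next
    case False
    then have "(cmod (u x))\<^sup>2 \<le> l\<^sup>2" by (intro power_mono) auto
    then have "ln ((cmod (u x))\<^sup>2) \<le> ln (l\<^sup>2)" using c l by (intro ln_mono) auto
    then have "(cmod (u x))\<^sup>2 * ln ((cmod (u x))\<^sup>2) \<le> (cmod (u x))\<^sup>2 * ln (l\<^sup>2)" by (intro mult_left_mono) auto
    then show ?thesis using False by (simp add: sq_log_def log_tail_def mult.commute)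
  qed
qed (simp add: log_tail_nonneg[OF l])

lemma sq_log_mult:
  assumes "t \<ge> 0" "r \<ge> 0"
  shows "sq_log (t * r) = t\<^sup>2 * sq_log r + r\<^sup>2 * sq_log t"
proof (cases "t = 0 \<or> r = 0")
  case False
  then have "t\<^sup>2 > 0" "r\<^sup>2 > 0" using assms by auto
  then show ?thesis by (simp add: sq_log_def power_mult_distrib ln_mult algebra_simps)
qed auto

lemma sq_log_small_bound: "0 \<le> r \<Longrightarrow> r \<le> 1 \<Longrightarrow> \<bar>sq_log r\<bar> \<le> 2 * r"
proof (cases "r = 0")
  case False
  assume r: "0 \<le> r" "r \<le> 1"
  then have r0: "r > 0" using False by simp
  have "ln (1 / r) \<le> 1 / r - 1" using r0 by (intro ln_le_minus_one) auto
  then have "- ln r \<le> 1 / r" using r0 by (simp add: ln_div)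
  then have "(2 * r\<^sup>2) * - ln r \<le> (2 * r\<^sup>2) * (1 / r)" using r0 by (intro mult_left_mono) auto
  also have "\<dots> = 2 * r" using r0 by (simp add: power2_eq_square)
  finally have 1: "2 * r\<^sup>2 * - ln r \<le> 2 * r" .
  have 2: "sq_log r = 2 * r\<^sup>2 * ln r" using r0 by (simp add: sq_log_def ln_realpow)
  have "ln r \<le> 0" using r0 r(2) by simp
  then have "2 * r\<^sup>2 * ln r \<le> 0" by (intro mult_nonneg_nonpos) auto
  then show ?thesis using 1 2 by linarith
qed simp

lemma sq_log_bounded:
  assumes "0 \<le> t" "t \<le> M" "1 \<le> M"
  shows "\<bar>sq_log t\<bar> \<le> 2 + sq_log M"
proof (cases "t \<le> 1")
  case True
  have "0 \<le> sq_log M" using assms(3) by (simp add: sq_log_def)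
  then show ?thesis using sq_log_small_bound[OF assms(1) True] True by linarith
next
  case False
  then have t: "t > 1" by simp
  have "t\<^sup>2 * ln (t\<^sup>2) \<le> M\<^sup>2 * ln (M\<^sup>2)"
    using t assms by (intro mult_mono power_mono ln_mono) auto
  moreover have "0 \<le> t\<^sup>2 * ln (t\<^sup>2)" using t by simp
  ultimately show ?thesis by (simp add: sq_log_def)
qed

lemma sq_log_isCont: "isCont sq_log r"
proof (cases "r = 0")
  case False
  then show ?thesis unfolding sq_log_def by (intro continuous_intros) auto
next
  case True
  have "(sq_log \<longlongrightarrow> 0) (at 0)"
  proof (rule Lim_null_comparison)
    show "\<forall>\<^sub>F x in at 0. norm (sq_log x) \<le> 2 * \<bar>x\<bar>"
      unfolding eventually_at
    proof (intro exI conjI ballI impI)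
      fix x :: real assume x: "x \<noteq> 0 \<and> dist x 0 < 1"
      have "sq_log x = sq_log \<bar>x\<bar>" by (simp add: sq_log_def)
      then show "norm (sq_log x) \<le> 2 * \<bar>x\<bar>" using sq_log_small_bound[of "\<bar>x\<bar>"] x by simp
    qed simp
    show "((\<lambda>x. 2 * \<bar>x\<bar>) \<longlongrightarrow> 0) (at (0::real))" by (rule tendsto_eq_intros refl | simp)+
  qed
  then show ?thesis using True by (simp add: isCont_def)
qed

text \<open>Finiteness of the integral of this function describes the energy space: it is comparable with the Orlicz
  function up to \<open>r\<^sup>2\<close> and the positive part of \<open>sq_log\<close>, whose integrals the Sobolev norm controls.\<close>

definition log_modular :: "real \<Rightarrow> real" where
  "log_modular r = \<bar>sq_log r\<bar> + r\<^sup>2"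

lemma log_modular_measurable [measurable]: "log_modular \<in> borel_measurable borel"
  unfolding log_modular_def by measurable

lemma log_modular_nonneg [simp]: "0 \<le> log_modular r"
  by (simp add: log_modular_def)

lemma log_modular_isCont: "isCont log_modular r"
  unfolding log_modular_def by (intro continuous_intros sq_log_isCont)

text \<open>If \<open>b\<close> is small compared with \<open>a\<close>, put \<open>t = |a + b| / |a|\<close>; then \<open>f(t r) = t\<^sup>2 f(r) + r\<^sup>2 f(t)\<close> and
  continuity of \<open>f\<close> and of the square at \<open>t = 1\<close> give the factor \<open>e\<close>. Otherwise \<open>a\<close> and \<open>a + b\<close> are bounded by
  multiples of \<open>b\<close>, and the same identity with bounded \<open>t\<close> compares both terms with \<open>b\<close>.\<close>

lemma sq_log_perturbation:
  fixes e :: real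
  assumes e: "e > 0"
  obtains C where "C > 0"
    "\<And>a b :: complex. \<bar>sq_log (cmod (a + b)) - sq_log (cmod a)\<bar> \<le> e * log_modular (cmod a) + C * log_modular (cmod b)"
proof -
  have c1: "isCont (\<lambda>t::real. t\<^sup>2 - 1) 1" by (intro continuous_intros)
  obtain d1 where d1: "d1 > 0" "\<And>t. \<bar>t - 1\<bar> < d1 \<Longrightarrow> \<bar>t\<^sup>2 - 1\<bar> < e"
    using c1[unfolded continuous_at_eps_delta, rule_format, OF e] by (auto simp: dist_real_def)
  obtain d2 where d2: "d2 > 0" "\<And>t. \<bar>t - 1\<bar> < d2 \<Longrightarrow> \<bar>sq_log t\<bar> < e"
    using sq_log_isCont[of 1, unfolded continuous_at_eps_delta, rule_format, OF e] by (auto simp: dist_real_def)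
  define d where "d = min d1 d2"
  have d: "d > 0" using d1 d2 by (simp add: d_def)
  define M where "M = 1 + 1 / d"
  have M: "M \<ge> 1" using d by (simp add: M_def)
  define C where "C = 2 * (M\<^sup>2 + (2 + sq_log M))"
  have slM: "0 \<le> sq_log M" using M by (simp add: sq_log_def)
  have C: "C > 0" using slM by (simp add: C_def add_nonneg_pos)
  have "\<bar>sq_log (cmod (a + b)) - sq_log (cmod a)\<bar> \<le> e * log_modular (cmod a) + C * log_modular (cmod b)" for a b :: complex
  proof (cases "cmod b < d * cmod a")
    case True
    have a: "cmod a > 0"
      by (rule ccontr) (use True norm_ge_zero[of b] in \<open>simp\<close>)
    define t where "t = cmod (a + b) / cmod a"
    have "\<bar>cmod (a + b) - cmod a\<bar> \<le> cmod b" using norm_triangle_ineq3[of "a + b" a] by simp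
    also have "\<dots> < d * cmod a" by (rule True)
    finally have "\<bar>t - 1\<bar> < d" using a by (simp add: t_def field_simps abs_less_iff)
    then have t: "\<bar>t\<^sup>2 - 1\<bar> \<le> e" "\<bar>sq_log t\<bar> \<le> e" using d1 d2 by (auto simp: d_def intro: less_imp_le)
    have "sq_log (cmod (a + b)) = sq_log (t * cmod a)" using a by (simp add: t_def)
    also have "\<dots> = t\<^sup>2 * sq_log (cmod a) + (cmod a)\<^sup>2 * sq_log t" by (rule sq_log_mult) (auto simp: t_def)
    finally have "sq_log (cmod (a + b)) - sq_log (cmod a) = (t\<^sup>2 - 1) * sq_log (cmod a) + sq_log t * (cmod a)\<^sup>2"
      by (simp add: algebra_simps)
    also have "\<bar>\<dots>\<bar> \<le> \<bar>t\<^sup>2 - 1\<bar> * \<bar>sq_log (cmod a)\<bar> + \<bar>sq_log t\<bar> * (cmod a)\<^sup>2"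
      by (rule order_trans[OF abs_triangle_ineq]) (simp add: abs_mult)
    also have "\<dots> \<le> e * \<bar>sq_log (cmod a)\<bar> + e * (cmod a)\<^sup>2"
      using t by (intro add_mono mult_right_mono) auto
    also have "\<dots> = e * log_modular (cmod a)" by (simp add: log_modular_def algebra_simps)
    also have "\<dots> \<le> e * log_modular (cmod a) + C * log_modular (cmod b)" using C by simp
    finally show ?thesis .
  next
    case False
    then have ab: "cmod a \<le> cmod b / d" using d by (simp add: field_simps)
    show ?thesis
    proof (cases "b = 0")
      case True
      then show ?thesis using e C by (auto intro!: add_nonneg_nonneg mult_nonneg_nonneg)
    next
      case False
      then have b: "cmod b > 0" by simp
      have key: "\<bar>sq_log r\<bar> \<le> (M\<^sup>2 + (2 + sq_log M)) * log_modular (cmod b)" if r: "0 \<le> r" "r \<le> M * cmod b" for r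
      proof -
        define t where "t = r / cmod b"
        have t: "0 \<le> t" "t \<le> M" using r b by (auto simp: t_def field_simps)
        have "sq_log r = sq_log (t * cmod b)" using b by (simp add: t_def)
        also have "\<dots> = t\<^sup>2 * sq_log (cmod b) + (cmod b)\<^sup>2 * sq_log t" using t by (intro sq_log_mult) auto
        also have "\<bar>\<dots>\<bar> \<le> t\<^sup>2 * \<bar>sq_log (cmod b)\<bar> + \<bar>sq_log t\<bar> * (cmod b)\<^sup>2"
          by (rule order_trans[OF abs_triangle_ineq]) (simp add: abs_mult)
        also have "\<dots> \<le> M\<^sup>2 * \<bar>sq_log (cmod b)\<bar> + (2 + sq_log M) * (cmod b)\<^sup>2"
          using t sq_log_bounded[OF t M] by (intro add_mono mult_right_mono power_mono) auto
        also have "\<dots> \<le> (M\<^sup>2 + (2 + sq_log M)) * log_modular (cmod b)"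
          using slM by (simp add: log_modular_def algebra_simps)
        finally show ?thesis .
      qed
      have ka: "cmod a \<le> M * cmod b" and kb: "cmod (a + b) \<le> M * cmod b"
      proof -
        have "M * cmod b = cmod b + cmod b / d" by (simp add: M_def algebra_simps)
        then show "cmod a \<le> M * cmod b" "cmod (a + b) \<le> M * cmod b"
          using ab b norm_triangle_ineq[of a b] by linarith+
      qed
      have "C * log_modular (cmod b) = 2 * ((M\<^sup>2 + (2 + sq_log M)) * log_modular (cmod b))"
        by (simp add: C_def)
      then have "\<bar>sq_log (cmod a)\<bar> + \<bar>sq_log (cmod (a + b))\<bar> \<le> C * log_modular (cmod b)"
        using key[OF norm_ge_zero ka] key[OF norm_ge_zero kb] by linarith
      moreover have "0 \<le> e * log_modular (cmod a)" using e by simp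
      ultimately show ?thesis by linarith
    qed
  qed
  then show ?thesis using that C by blast
qed

lemma log_modular_add:
  obtains K where "K > 0" "\<And>a b :: complex. log_modular (cmod (a + b)) \<le> K * (log_modular (cmod a) + log_modular (cmod b))"
proof -
  obtain C where C: "C > 0"
    "\<And>a b :: complex. \<bar>sq_log (cmod (a + b)) - sq_log (cmod a)\<bar> \<le> 1 * log_modular (cmod a) + C * log_modular (cmod b)"
    using sq_log_perturbation[of 1] by (metis zero_less_one)
  have "log_modular (cmod (a + b)) \<le> (C + 4) * (log_modular (cmod a) + log_modular (cmod b))" for a b :: complex
  proof -
    have "(cmod (a + b))\<^sup>2 \<le> (cmod a + cmod b)\<^sup>2" by (simp add: norm_triangle_ineq power_mono)
    also have "\<dots> \<le> 2 * (cmod a)\<^sup>2 + 2 * (cmod b)\<^sup>2"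
      using zero_le_power2[of "cmod a - cmod b"] by (simp add: power2_eq_square algebra_simps)
    also have "\<dots> \<le> 2 * log_modular (cmod a) + 2 * log_modular (cmod b)"
      by (simp add: log_modular_def)
    finally have 1: "(cmod (a + b))\<^sup>2 \<le> 2 * log_modular (cmod a) + 2 * log_modular (cmod b)" .
    have "\<bar>sq_log (cmod (a + b))\<bar> \<le> \<bar>sq_log (cmod a)\<bar> + log_modular (cmod a) + C * log_modular (cmod b)"
      using C(2)[of a b] by linarith
    also have "\<bar>sq_log (cmod a)\<bar> \<le> log_modular (cmod a)" by (simp add: log_modular_def)
    finally have "log_modular (cmod (a + b)) \<le> 4 * log_modular (cmod a) + (C + 2) * log_modular (cmod b)"
      using 1 by (simp add: log_modular_def[of "cmod (a + b)"] algebra_simps)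
    also have "\<dots> \<le> (C + 4) * (log_modular (cmod a) + log_modular (cmod b))"
      using C(1) by (simp add: algebra_simps)
    finally show ?thesis .
  qed
  then show ?thesis using that[of "C + 4"] C(1) by simp
qed

text \<open>By \<open>sq_log_perturbation\<close> with \<open>a = u n - v\<close> and \<open>b = v\<close>, the defect \<open>G n\<close> exceeds a small multiple of a
  modular with bounded integral only by an amount that is dominated by an integrable function of \<open>v\<close>; this
  excess \<open>W n\<close> tends to zero almost everywhere, hence in the mean.\<close>

lemma Brezis_Lieb_sq_log:
  fixes u :: "nat \<Rightarrow> 'a::euclidean_space \<Rightarrow> complex" and v :: "'a \<Rightarrow> complex"
  assumes u [measurable]: "\<And>n. u n \<in> borel_measurable borel" and v [measurable]: "v \<in> borel_measurable borel"
    and ui: "\<And>n. integrable lborel (\<lambda>x. log_modular (cmod (u n x)))"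
    and vi: "integrable lborel (\<lambda>x. log_modular (cmod (v x)))"
    and bd: "\<And>n. (LINT x|lborel. log_modular (cmod (u n x))) \<le> B"
    and ae: "AE x in lborel. (\<lambda>n. u n x) \<longlonglongrightarrow> v x"
  shows "(\<lambda>n. (LINT x|lborel. sq_log (cmod (u n x))) - (LINT x|lborel. sq_log (cmod (u n x - v x))))
     \<longlonglongrightarrow> (LINT x|lborel. sq_log (cmod (v x)))"
proof -
  obtain K where K: "K > 0" "\<And>a b :: complex. log_modular (cmod (a + b)) \<le> K * (log_modular (cmod a) + log_modular (cmod b))"
    using log_modular_add by blast
  have Kd: "log_modular (cmod (a - b)) \<le> K * (log_modular (cmod a) + log_modular (cmod b))" for a b
    using K(2)[of a "- b"] by simp
  have di: "integrable lborel (\<lambda>x. log_modular (cmod (u n x - v x)))" for n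
  proof (rule Bochner_Integration.integrable_bound)
    show "integrable lborel (\<lambda>x. K * (log_modular (cmod (u n x)) + log_modular (cmod (v x))))"
      using ui vi by auto
  qed (use Kd in \<open>auto intro: order_trans[OF _ abs_ge_self]\<close>)
  define B' where "B' = K * (B + (LINT x|lborel. log_modular (cmod (v x))))"
  have db: "(LINT x|lborel. log_modular (cmod (u n x - v x))) \<le> B'" for n
  proof -
    have "(LINT x|lborel. log_modular (cmod (u n x - v x))) \<le> (LINT x|lborel. K * (log_modular (cmod (u n x)) + log_modular (cmod (v x))))"
      using di ui vi Kd by (intro integral_mono) auto
    also have "\<dots> = K * ((LINT x|lborel. log_modular (cmod (u n x))) + (LINT x|lborel. log_modular (cmod (v x))))"
      using ui vi by simp
    also have "\<dots> \<le> B'" unfolding B'_def using bd[of n] K(1) by (intro mult_left_mono) auto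
    finally show ?thesis .
  qed
  have B'0: "B' \<ge> 0" using order_trans[OF Bochner_Integration.integral_nonneg db[of 0]] by simp
  have sl: "integrable lborel (\<lambda>x. sq_log (cmod (w x)))" if "integrable lborel (\<lambda>x. log_modular (cmod (w x)))" "w \<in> borel_measurable borel" for w :: "'a \<Rightarrow> complex"
    by (rule Bochner_Integration.integrable_bound[OF that(1)]) (use that(2) in \<open>auto simp: log_modular_def\<close>)
  note su = sl[OF ui u] and sv = sl[OF vi v]
  have sd: "integrable lborel (\<lambda>x. sq_log (cmod (u n x - v x)))" for n by (rule sl[OF di]) measurable
  define G where "G n x = \<bar>sq_log (cmod (u n x)) - sq_log (cmod (u n x - v x)) - sq_log (cmod (v x))\<bar>" for n x
  have Gi: "integrable lborel (G n)" for n unfolding G_def using su sd sv by auto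
  have Glim: "AE x in lborel. (\<lambda>n. G n x) \<longlonglongrightarrow> 0"
    using ae
  proof eventually_elim
    case (elim x)
    have c: "(\<lambda>n. sq_log (cmod (w n))) \<longlonglongrightarrow> sq_log (cmod z)" if "w \<longlonglongrightarrow> z" for w z
      by (rule isCont_tendsto_compose[OF sq_log_isCont tendsto_norm[OF that]])
    have "(\<lambda>n. u n x - v x) \<longlonglongrightarrow> 0" using elim by (simp add: LIM_zero)
    then have "(\<lambda>n. G n x) \<longlonglongrightarrow> \<bar>sq_log (cmod (v x)) - sq_log (cmod 0) - sq_log (cmod (v x))\<bar>"
      unfolding G_def by (intro tendsto_intros c elim)
    then show ?case by simp
  qed
  have "(\<lambda>n. LINT x|lborel. G n x) \<longlonglongrightarrow> 0"
  proof (rule LIMSEQ_I)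
    fix e :: real assume e: "e > 0"
    define d where "d = e / (2 * (B' + 1))"
    have d: "d > 0" using e B'0 by (simp add: d_def)
    obtain C where C: "C > 0"
      "\<And>a b :: complex. \<bar>sq_log (cmod (a + b)) - sq_log (cmod a)\<bar> \<le> d * log_modular (cmod a) + C * log_modular (cmod b)"
      using sq_log_perturbation[OF d] by metis
    define W where "W n x = max (G n x - d * log_modular (cmod (u n x - v x))) 0" for n x
    have Gb: "G n x \<le> d * log_modular (cmod (u n x - v x)) + (C + 1) * log_modular (cmod (v x))" for n x
    proof -
      have "G n x \<le> \<bar>sq_log (cmod (u n x)) - sq_log (cmod (u n x - v x))\<bar> + \<bar>sq_log (cmod (v x))\<bar>"
        unfolding G_def by linarith
      also have "\<dots> \<le> d * log_modular (cmod (u n x - v x)) + C * log_modular (cmod (v x)) + log_modular (cmod (v x))"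
        using C(2)[of "u n x - v x" "v x"] by (intro add_mono) (auto simp: log_modular_def)
      finally show ?thesis by (simp add: algebra_simps)
    qed
    have Gm: "G n \<in> borel_measurable borel" for n unfolding G_def by measurable
    have Wm: "W n \<in> borel_measurable lborel" for n unfolding W_def using Gm[of n] by measurable
    have Wb: "norm (W n x) \<le> (C + 1) * log_modular (cmod (v x))" for n x
      using Gb[of n x] C(1) by (auto simp: W_def)
    have Wlim: "(\<lambda>n. LINT x|lborel. W n x) \<longlonglongrightarrow> (LINT x|(lborel::'a measure). (0::real))"
    proof (rule integral_dominated_convergence[where w="\<lambda>x. (C + 1) * log_modular (cmod (v x))"])
      show "AE x in lborel. (\<lambda>n. W n x) \<longlonglongrightarrow> 0"
        using Glim
      proof eventually_elim
        case (elim x)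
        show ?case
        proof (rule real_tendsto_zero_bound[OF _ _ elim])
          show "W n x \<le> G n x" for n using d by (simp add: W_def G_def)
        qed (simp add: W_def)
      qed
      show "AE x in lborel. norm (W n x) \<le> (C + 1) * log_modular (cmod (v x))" for n
        using Wb by simp
    qed (use Wm vi in auto)
    have Wi: "integrable lborel (W n)" for n
    proof (rule Bochner_Integration.integrable_bound[OF integrable_mult_right[OF vi, of "C + 1"] Wm])
      show "AE x in lborel. norm (W n x) \<le> norm ((C + 1) * log_modular (cmod (v x)))"
        using Wb[of n] by (intro AE_I2) (simp add: order_trans[OF _ abs_ge_self])
    qed
    obtain N where N: "\<And>n. n \<ge> N \<Longrightarrow> (LINT x|lborel. W n x) < e / 2"
      using order_tendstoD(2)[OF Wlim, of "e / 2"] e by (auto simp: eventually_sequentially)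
    have "(LINT x|lborel. G n x) < e" if n: "n \<ge> N" for n
    proof -
      have "(LINT x|lborel. G n x) \<le> (LINT x|lborel. d * log_modular (cmod (u n x - v x)) + W n x)"
        using di Wi Gi by (intro integral_mono) (auto simp: W_def)
      also have "\<dots> = d * (LINT x|lborel. log_modular (cmod (u n x - v x))) + (LINT x|lborel. W n x)"
        using di Wi by simp
      also have "\<dots> \<le> d * B' + (LINT x|lborel. W n x)" using d db[of n] by (intro add_mono mult_left_mono) auto
      also have "d * B' \<le> e / 2" using e B'0 by (simp add: d_def field_simps)
      finally show ?thesis using N[OF n] by linarith
    qed
    moreover have "0 \<le> (LINT x|lborel. G n x)" for n by (rule Bochner_Integration.integral_nonneg) (simp add: G_def)
    ultimately show "\<exists>no. \<forall>n\<ge>no. norm ((LINT x|lborel. G n x) - 0) < e"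
      by (auto intro!: exI[of _ N])
  qed
  then have "(\<lambda>n. (LINT x|lborel. sq_log (cmod (u n x))) - (LINT x|lborel. sq_log (cmod (u n x - v x))) - (LINT x|lborel. sq_log (cmod (v x)))) \<longlonglongrightarrow> 0"
  proof (rule Lim_null_comparison[rotated], intro always_eventually allI)
    fix n
    have "(LINT x|lborel. sq_log (cmod (u n x))) - (LINT x|lborel. sq_log (cmod (u n x - v x))) - (LINT x|lborel. sq_log (cmod (v x)))
      = (LINT x|lborel. sq_log (cmod (u n x)) - sq_log (cmod (u n x - v x)) - sq_log (cmod (v x)))"
      using su sd sv by simp
    also have "norm \<dots> \<le> (LINT x|lborel. G n x)"
      unfolding G_def real_norm_def[symmetric] by (rule integral_norm_bound)
    finally show "norm ((LINT x|lborel. sq_log (cmod (u n x))) - (LINT x|lborel. sq_log (cmod (u n x - v x))) - (LINT x|lborel. sq_log (cmod (v x)))) \<le> (LINT x|lborel. G n x)" .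
  qed
  then show ?thesis by (rule LIM_zero_cancel)
qed

section \<open>The Orlicz space\<close>

lemma orlicz_A_nonneg: "0 \<le> r \<Longrightarrow> 0 \<le> orlicz_A r"
proof (cases "r \<le> exp (-3)")
  case True
  assume r: "0 \<le> r"
  have "r \<le> 1" using True by (rule order_trans) simp
  then have "r\<^sup>2 \<le> 1" using r by (simp add: power_le_one)
  then have "r\<^sup>2 * ln (r\<^sup>2) \<le> 0" 
    by (cases "r = 0") (use r in \<open>auto intro!: mult_nonneg_nonpos\<close>)
  then show ?thesis using True by (simp add: orlicz_A_def)
next
  case False
  assume r: "0 \<le> r"
  have "exp (-6) = exp (-3) * exp (-3::real)" by (simp add: exp_add[symmetric])
  also have "\<dots> \<le> exp (-3) * r" using False by (intro mult_left_mono) auto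
  also have "\<dots> \<le> 4 * exp (-3) * r" using r by simp
  finally show ?thesis using False by (simp add: orlicz_A_def add_increasing)
qed

lemma orlicz_A_le: "0 \<le> r \<Longrightarrow> orlicz_A r \<le> 7 * log_modular r"
proof (cases "r \<le> exp (-3)")
  case False
  assume r: "0 \<le> r"
  have "exp (-3) * r \<le> r * r" using False r by (intro mult_right_mono) auto
  then have "3 * r\<^sup>2 + 4 * exp (-3) * r - exp (-6) \<le> 7 * r\<^sup>2"
    unfolding power2_eq_square using exp_gt_zero[of "-6::real"] by linarith
  also have "\<dots> \<le> 7 * log_modular r" by (simp add: log_modular_def)
  finally show ?thesis using False by (simp add: orlicz_A_def add_increasing)
next
  case True
  then have "orlicz_A r = - sq_log r" by (simp add: orlicz_A_def sq_log_def)
  also have "\<dots> \<le> \<bar>sq_log r\<bar> + 6 * \<bar>sq_log r\<bar> + 7 * r\<^sup>2" by (smt (verit) zero_le_power2)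
  finally show ?thesis by (simp add: log_modular_def)
qed

lemma abs_sq_log_le:
  "\<bar>sq_log (cmod (u x))\<bar> \<le> orlicz_A (cmod (u x)) + 6 * (cmod (u x))\<^sup>2 + log_tail 1 u x"
proof -
  define r where "r = cmod (u x)"
  have r: "r \<ge> 0" by (simp add: r_def)
  note A = orlicz_A_nonneg[OF r]
  show ?thesis
  proof (cases "1 < r")
    case True
    then have "0 \<le> sq_log r" by (simp add: sq_log_def)
    then have "\<bar>sq_log r\<bar> = log_tail 1 u x" using True by (simp add: log_tail_def sq_log_def r_def)
    then show ?thesis using A by (simp add: r_def)
  next
    case False
    have neg: "sq_log r \<le> 0"
      by (cases "r = 0") (use r False in \<open>auto simp: sq_log_def power_le_one intro!: mult_nonneg_nonpos\<close>)
    have "- sq_log r \<le> orlicz_A r + 6 * r\<^sup>2"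
    proof (cases "r \<le> exp (-3)")
      case True
      then show ?thesis by (simp add: orlicz_A_def sq_log_def)
    next
      case F: False
      then have r0: "r > 0" by (smt (verit) exp_gt_zero)
      have "ln (exp (-3)) \<le> ln r" using F r0 by (intro ln_mono) auto
      then have "- ln (r\<^sup>2) \<le> 6" using r0 by (simp add: ln_realpow)
      then have "r\<^sup>2 * - ln (r\<^sup>2) \<le> r\<^sup>2 * 6" by (intro mult_left_mono) auto
      then show ?thesis using A by (simp add: sq_log_def)
    qed
    moreover have "0 \<le> log_tail 1 u x" by (rule log_tail_nonneg) simp
    ultimately show ?thesis using neg by (simp add: r_def)
  qed
qed

lemma orlicz_A_measurable [measurable]: "orlicz_A \<in> borel_measurable borel"
  unfolding orlicz_A_def by measurable

lemma L2_subset_L1_loc: "L2 \<subseteq> (L1_loc :: ('a::euclidean_space \<Rightarrow> complex) set)"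
proof
  fix u :: "'a \<Rightarrow> complex" assume u: "u \<in> L2"
  have [measurable]: "u \<in> borel_measurable borel" using u by measurable
  have "set_integrable lborel K u" if K: "compact K" for K
  proof -
    obtain R where R: "K \<subseteq> cball 0 R" using compact_imp_bounded[OF K] unfolding bounded_iff by (auto simp: subset_iff)
    have [measurable]: "K \<in> sets borel" by (rule borel_compact[OF K])
    have "integrable lborel (\<lambda>x. indicator (cball 0 R) x * u x)"
      by (rule L2_prod_integrable[OF indicator_cball_L2 u])
    then show ?thesis unfolding set_integrable_def
      by (rule Bochner_Integration.integrable_bound) (use R in \<open>auto simp: indicator_def intro!: AE_I2\<close>)
  qed
  then show "u \<in> L1_loc" using u by (auto simp: L1_loc_def)
qed

lemma Ws_iff:
  fixes u :: "'a::euclidean_space \<Rightarrow> complex"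
  assumes s: "s > 0"
  shows "u \<in> Ws s \<longleftrightarrow> u \<in> Hs s \<and> integrable lborel (\<lambda>x. log_modular (cmod (u x)))"
proof (intro iffI conjI)
  assume "u \<in> Ws s"
  then have u: "u \<in> Hs s" "integrable lborel (\<lambda>x. orlicz_A (cmod (u x)))" by (auto simp: Ws_def LA_def)
  show "u \<in> Hs s" by fact
  have u2: "u \<in> L2" using u by (simp add: Hs_iff)
  have [measurable]: "u \<in> borel_measurable borel" using u2 by measurable
  have lt: "integrable lborel (log_tail 1 u)" using log_tail_bound[OF s, where 'a='a] u(1) by (metis zero_less_one)
  have "integrable lborel (\<lambda>x. orlicz_A (cmod (u x)) + 6 * (cmod (u x))\<^sup>2 + log_tail 1 u x + (cmod (u x))\<^sup>2)"
    using u(2) lt L2_integrable[OF u2] by auto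
  then show "integrable lborel (\<lambda>x. log_modular (cmod (u x)))"
  proof (rule Bochner_Integration.integrable_bound)
    show "AE x in lborel. norm (log_modular (cmod (u x))) \<le> norm (orlicz_A (cmod (u x)) + 6 * (cmod (u x))\<^sup>2 + log_tail 1 u x + (cmod (u x))\<^sup>2)"
    proof (rule AE_I2)
      fix x
      show "norm (log_modular (cmod (u x))) \<le> norm (orlicz_A (cmod (u x)) + 6 * (cmod (u x))\<^sup>2 + log_tail 1 u x + (cmod (u x))\<^sup>2)"
        using abs_sq_log_le[of u x] by (simp add: log_modular_def)
    qed
  qed measurable
next
  assume u: "u \<in> Hs s \<and> integrable lborel (\<lambda>x. log_modular (cmod (u x)))"
  have u2: "u \<in> L2" using u by (simp add: Hs_iff)
  have [measurable]: "u \<in> borel_measurable borel" using u2 by measurable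
  have "integrable lborel (\<lambda>x. 7 * log_modular (cmod (u x)))" using u by auto
  then have "integrable lborel (\<lambda>x. orlicz_A (cmod (u x)))"
    by (rule Bochner_Integration.integrable_bound) (use orlicz_A_nonneg orlicz_A_le in auto)
  then show "u \<in> Ws s" using u u2 L2_subset_L1_loc by (auto simp: Ws_def LA_def)
qed

lemma log_modular_scale:
  assumes "t \<ge> 0"
  obtains C where "C > 0" "\<And>r. r \<ge> 0 \<Longrightarrow> log_modular (t * r) \<le> C * log_modular r"
proof -
  define C where "C = 2 * t\<^sup>2 + \<bar>sq_log t\<bar> + 1"
  have C: "C > 0" by (simp add: C_def add_nonneg_pos)
  have "log_modular (t * r) \<le> C * log_modular r" if "r \<ge> 0" for r
  proof -
    have "\<bar>sq_log (t * r)\<bar> \<le> t\<^sup>2 * \<bar>sq_log r\<bar> + r\<^sup>2 * \<bar>sq_log t\<bar>"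
      unfolding sq_log_mult[OF assms that] by (rule order_trans[OF abs_triangle_ineq]) (simp add: abs_mult)
    moreover have "t\<^sup>2 * \<bar>sq_log r\<bar> \<le> t\<^sup>2 * log_modular r" "r\<^sup>2 * \<bar>sq_log t\<bar> \<le> log_modular r * \<bar>sq_log t\<bar>" "t\<^sup>2 * r\<^sup>2 \<le> t\<^sup>2 * log_modular r"
      by (auto intro!: mult_left_mono mult_right_mono simp: log_modular_def)
    moreover have "0 \<le> log_modular r" by simp
    ultimately have "log_modular (t * r) \<le> t\<^sup>2 * log_modular r + log_modular r * \<bar>sq_log t\<bar> + t\<^sup>2 * log_modular r + log_modular r"
      unfolding log_modular_def[of "t * r"] power_mult_distrib by linarith
    then show ?thesis by (simp add: C_def algebra_simps)
  qed
  then show ?thesis using that C by blast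
qed

text \<open>For fixed \<open>k\<close> the modular of \<open>w n / k\<close> is bounded by a multiple of the modular of \<open>w n\<close>, so it is eventually
  at most one, which puts \<open>k\<close> into the set defining the Luxemburg norm.\<close>

lemma LA_norm_tendsto_zero:
  fixes w :: "nat \<Rightarrow> 'a::euclidean_space \<Rightarrow> complex"
  assumes w [measurable]: "\<And>n. w n \<in> borel_measurable borel" and wi: "\<And>n. integrable lborel (\<lambda>x. log_modular (cmod (w n x)))"
    and lim: "(\<lambda>n. LINT x|lborel. log_modular (cmod (w n x))) \<longlonglongrightarrow> 0"
  shows "(\<lambda>n. LA_norm (w n)) \<longlonglongrightarrow> 0"
proof (rule LIMSEQ_I)
  fix e :: real assume e: "e > 0"
  define k where "k = e / 2"
  have k: "k > 0" using e by (simp add: k_def)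
  obtain C where C: "C > 0" "\<And>r. r \<ge> 0 \<Longrightarrow> log_modular (inverse k * r) \<le> C * log_modular r"
    using log_modular_scale[of "inverse k"] k by (metis inverse_nonnegative_iff_nonnegative less_imp_le)
  have "(\<lambda>n. 7 * C * (LINT x|lborel. log_modular (cmod (w n x)))) \<longlonglongrightarrow> 7 * C * 0"
    by (intro tendsto_mult tendsto_const lim)
  then obtain N where N: "\<And>n. n \<ge> N \<Longrightarrow> 7 * C * (LINT x|lborel. log_modular (cmod (w n x))) < 1"
    using order_tendstoD(2)[of _ "7 * C * 0" sequentially 1] by (auto simp: eventually_sequentially)
  have "\<bar>LA_norm (w n)\<bar> \<le> k" if n: "n \<ge> N" for n
  proof -
    let ?S = "{k. 0 < k \<and> (\<integral>\<^sup>+ x. ennreal (orlicz_A (inverse k * cmod (w n x))) \<partial>lborel) \<le> 1}"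
    have b: "orlicz_A (inverse k * cmod (w n x)) \<le> 7 * C * log_modular (cmod (w n x))" for x
      using orlicz_A_le[of "inverse k * cmod (w n x)"] C(2)[of "cmod (w n x)"] k by simp
    have "(\<integral>\<^sup>+ x. ennreal (orlicz_A (inverse k * cmod (w n x))) \<partial>lborel) \<le> (\<integral>\<^sup>+ x. ennreal (7 * C * log_modular (cmod (w n x))) \<partial>lborel)"
      by (intro nn_integral_mono ennreal_leI b)
    also have "\<dots> = ennreal (LINT x|lborel. 7 * C * log_modular (cmod (w n x)))"
      using C(1) wi by (intro nn_integral_eq_integral) auto
    also have "\<dots> \<le> ennreal 1" using N[OF n] by (intro ennreal_leI) simp
    finally have "k \<in> ?S" using k by simp
    then have "Inf ?S \<le> k" "0 \<le> Inf ?S"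
      by (auto intro!: cInf_lower cInf_greatest bdd_belowI[of _ 0])
    then show ?thesis by (simp add: LA_norm_def)
  qed
  then show "\<exists>no. \<forall>n\<ge>no. norm (LA_norm (w n) - 0) < e"
    using e by (intro exI[of _ N]) (force simp: k_def intro: le_less_trans)
qed

section \<open>Local compactness of bounded sequences\<close>

lemma cmod_diff_via: "cmod (a - b) \<le> cmod (a - c) + cmod (c - d) + cmod (b - d)"
proof -
  have "cmod (a - b) \<le> cmod (a - c) + cmod (c - b)"
    using norm_triangle_ineq[of "a - c" "c - b"] by simp
  moreover have "cmod (c - b) \<le> cmod (c - d) + cmod (d - b)"
    using norm_triangle_ineq[of "c - d" "d - b"] by simp
  ultimately show ?thesis by (simp add: norm_minus_commute)
qed

lemma L2_weak_from_truncations: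
  fixes v :: "nat \<Rightarrow> 'a::euclidean_space \<Rightarrow> complex"
  assumes v: "\<And>n. v n \<in> L2" "v0 \<in> L2" and M: "\<And>n. L2_norm (v n) \<le> M" "L2_norm v0 \<le> M" and g: "g \<in> L2"
    and w: "\<And>k::nat. (\<lambda>n. L2_inner (v n) (ball_trunc (real k) g)) \<longlonglongrightarrow> L2_inner v0 (ball_trunc (real k) g)"
  shows "(\<lambda>n. L2_inner (v n) g) \<longlonglongrightarrow> L2_inner v0 g"
proof (rule LIMSEQ_I)
  fix e :: real assume e: "e > 0"
  have M0: "M \<ge> 0" using L2_norm_nonneg M(2) order_trans by blast
  obtain k where k: "L2_dist (ball_trunc (real k) g) g < e / (3 * (M + 1))"
    using order_tendstoD(2)[OF ball_trunc_tendsto_seq[OF g], of "e / (3 * (M + 1))"] e M0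
    by (auto simp: eventually_sequentially)
  have gk: "ball_trunc (real k) g \<in> L2" by (rule ball_trunc_L2[OF g])
  have rest: "cmod (L2_inner z g - L2_inner z (ball_trunc (real k) g)) \<le> e / 3" if z: "z \<in> L2" "L2_norm z \<le> M" for z
  proof -
    have "cmod (L2_inner z g - L2_inner z (ball_trunc (real k) g)) = cmod (L2_inner z (\<lambda>x. g x - ball_trunc (real k) g x))"
      by (simp add: L2_inner_diff_right[OF g gk z(1)])
    also have "\<dots> \<le> L2_norm z * L2_dist g (ball_trunc (real k) g)"
      by (rule L2_Cauchy_Schwarz[OF z(1) L2_diff[OF g gk]])
    also have "\<dots> \<le> (M + 1) * (e / (3 * (M + 1)))"
      using z(2) k M0 by (intro mult_mono) (auto simp: L2_norm_minus_commute[of g])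
    also have "\<dots> = e / 3" using M0 by (simp add: field_simps)
    finally show ?thesis .
  qed
  obtain N where N: "\<And>n. n \<ge> N \<Longrightarrow> cmod (L2_inner (v n) (ball_trunc (real k) g) - L2_inner v0 (ball_trunc (real k) g)) < e / 3"
    using LIMSEQ_D[OF w[of k], of "e / 3"] e by auto
  have "cmod (L2_inner (v n) g - L2_inner v0 g) < e" if n: "n \<ge> N" for n
  proof -
    show ?thesis
      using cmod_diff_via[of "L2_inner (v n) g" "L2_inner v0 g" "L2_inner (v n) (ball_trunc (real k) g)" "L2_inner v0 (ball_trunc (real k) g)"]
        rest[OF v(1) M(1), of n] rest[OF v(2) M(2)] N[OF n] by linarith
  qed
  then show "\<exists>no. \<forall>n\<ge>no. norm (L2_inner (v n) g - L2_inner v0 g) < e" by blast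
qed

lemma fourier_weak:
  assumes u: "\<And>n::nat. u n \<in> L2" "v \<in> L2" and w: "\<And>g. g \<in> L2 \<Longrightarrow> (\<lambda>n. L2_inner (u n) g) \<longlonglongrightarrow> L2_inner v g"
    and g: "g \<in> L2"
  shows "(\<lambda>n. L2_inner (fourier (u n)) g) \<longlonglongrightarrow> L2_inner (fourier v) g"
  unfolding fourier_adjoint[OF u(1) g] fourier_adjoint[OF u(2) g] by (rule w[OF inv_fourier_L2[OF g]])

text \<open>For each cut-off radius the low-frequency parts are uniformly bounded and uniformly Lipschitz. A diagonal
  choice gives convergence at all points of a countable dense set and all integer radii, and the Lipschitz
  bound extends it to all points.\<close>

lemma lowpass_convergent_subsequence:
  fixes u :: "nat \<Rightarrow> 'a::euclidean_space \<Rightarrow> complex"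
  assumes u: "\<And>n. u n \<in> L2" and M: "\<And>n. L2_norm (u n) \<le> M"
  obtains r where "strict_mono (r :: nat \<Rightarrow> nat)" "\<And>k x. convergent (\<lambda>n. lowpass (real k) (u (r n)) x)"
proof -
  have M0: "M \<ge> 0" using L2_norm_nonneg M order_trans by blast
  define c where "c = fourier_const TYPE('a)"
  have c: "c > 0" unfolding c_def by (rule fourier_const_pos)
  define b where "b k = c * cball_L2 TYPE('a) (real k) * M + 1" for k
  have cb: "cball_L2 TYPE('a) R \<ge> 0" for R by (simp add: cball_L2_def)
  have b: "b k > 0" for k using c cb M0 by (simp add: b_def add_nonneg_pos)
  have bound: "cmod (lowpass (real k) (u n) x) \<le> b k" for k n x
  proof -
    have "cmod (lowpass (real k) (u n) x) \<le> c * cball_L2 TYPE('a) (real k) * L2_norm (u n)"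
      unfolding c_def by (rule lowpass_bound[OF u])
    also have "\<dots> \<le> c * cball_L2 TYPE('a) (real k) * M" using M[of n] c cb by (intro mult_left_mono) auto
    finally show ?thesis by (simp add: b_def)
  qed
  obtain D :: "'a set" where D: "countable D" "\<And>X. open X \<Longrightarrow> X \<noteq> {} \<Longrightarrow> \<exists>d\<in>D. d \<in> X"
    using countable_dense_setE by blast
  \<comment> \<open>dividing by \<open>b k\<close> gives one bound for all radii, so that a single diagonal argument treats them all\<close>
  let ?f = "\<lambda>n (k, x). lowpass (real k) (u n) x / of_real (b k)"
  have "countable ((UNIV :: nat set) \<times> D)" using D(1) by simp
  moreover have "norm (?f n z) \<le> 1" if "z \<in> UNIV \<times> D" for n z
    using bound b by (auto simp: case_prod_beta norm_divide abs_of_pos)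
  ultimately obtain r where r: "strict_mono (r :: nat \<Rightarrow> nat)" "\<And>z. z \<in> UNIV \<times> D \<Longrightarrow> \<exists>l. (\<lambda>n. ?f (r n) z) \<longlonglongrightarrow> l"
    using function_convergent_subsequence[of "(UNIV :: nat set) \<times> D" ?f 1] by blast
  have convD: "Cauchy (\<lambda>n. lowpass (real k) (u (r n)) x)" if x: "x \<in> D" for k x
  proof -
    obtain l where "(\<lambda>n. ?f (r n) (k, x)) \<longlonglongrightarrow> l" using r(2)[of "(k, x)"] x by auto
    then have "(\<lambda>n. of_real (b k) * ?f (r n) (k, x)) \<longlonglongrightarrow> of_real (b k) * l" by (intro tendsto_mult tendsto_const)
    moreover have "of_real (b k) * ?f (r n) (k, x) = lowpass (real k) (u (r n)) x" for n
      using b[of k] by simp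
    ultimately show ?thesis by (simp add: LIMSEQ_imp_Cauchy)
  qed
  have "Cauchy (\<lambda>n. lowpass (real k) (u (r n)) x)" for k x
  proof (rule CauchyI)
    fix e :: real assume e: "e > 0"
    define L where "L = c * cball_L2 TYPE('a) (real k) * real k * M + 1"
    have L: "L > 0" using c cb M0 by (simp add: L_def add_nonneg_pos)
    have lip: "cmod (lowpass (real k) (u n) x - lowpass (real k) (u n) y) \<le> L * norm (x - y)" for n y
    proof -
      have "cmod (lowpass (real k) (u n) x - lowpass (real k) (u n) y) \<le> (c * cball_L2 TYPE('a) (real k) * real k * L2_norm (u n)) * norm (x - y)"
        unfolding c_def by (rule lowpass_Lipschitz[OF u]) simp
      also have "\<dots> \<le> (c * cball_L2 TYPE('a) (real k) * real k * M) * norm (x - y)"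
        using M[of n] c cb by (intro mult_right_mono mult_left_mono) auto
      also have "\<dots> \<le> L * norm (x - y)" by (intro mult_right_mono) (auto simp: L_def)
      finally show ?thesis .
    qed
    define \<rho> where "\<rho> = e / (3 * L)"
    have "\<rho> > 0" using e L by (simp add: \<rho>_def)
    then obtain y where y: "y \<in> D" "dist x y < \<rho>"
      using D(2)[of "ball x \<rho>"] by auto
    have small: "cmod (lowpass (real k) (u n) x - lowpass (real k) (u n) y) < e / 3" for n
    proof -
      have "L * norm (x - y) < L * \<rho>" using y(2) L by (intro mult_strict_left_mono) (auto simp: dist_norm)
      also have "\<dots> = e / 3" using L by (simp add: \<rho>_def)
      finally show ?thesis using lip[of n y] by linarith
    qed
    obtain N where N: "\<And>m n. m \<ge> N \<Longrightarrow> n \<ge> N \<Longrightarrow> cmod (lowpass (real k) (u (r m)) y - lowpass (real k) (u (r n)) y) < e / 3"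
      using CauchyD[OF convD[OF y(1), of k], of "e / 3"] e by auto
    have "cmod (lowpass (real k) (u (r m)) x - lowpass (real k) (u (r n)) x) < e" if "m \<ge> N" "n \<ge> N" for m n
    proof -
      let ?l = "\<lambda>n x. lowpass (real k) (u (r n)) x"
      show ?thesis
        using cmod_diff_via[of "?l m x" "?l n x" "?l m y" "?l n y"] small[of "r m"] small[of "r n"] N[OF that] by linarith
    qed
    then show "\<exists>M. \<forall>m\<ge>M. \<forall>n\<ge>M. norm (lowpass (real k) (u (r m)) x - lowpass (real k) (u (r n)) x) < e" by blast
  qed
  then show ?thesis using that[OF r(1)] by (simp add: Cauchy_convergent_iff)
qed

text \<open>A positive weight in \<open>L\<^sup>2\<close> that is bounded by one: convergence of weighted functions in \<open>L\<^sup>2\<close> stands for local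
  convergence in \<open>L\<^sup>2\<close>, without exhausting the space by balls.\<close>

definition gauss_weight :: "('a::euclidean_space \<Rightarrow> complex) \<Rightarrow> 'a \<Rightarrow> complex" where
  "gauss_weight u = (\<lambda>x. of_real (gauss x) * u x)"

lemma gauss_weight_L2:
  assumes "u \<in> L2" shows "gauss_weight u \<in> L2" "L2_norm (gauss_weight u) \<le> L2_norm u"
  unfolding gauss_weight_def
  using L2_bounded_mult[OF assms, of "\<lambda>x. of_real (gauss x)" 1] gauss_le_1 by (auto simp: abs_of_pos[OF gauss_pos])

lemma gauss_L2: "(\<lambda>x::'a::euclidean_space. complex_of_real (gauss x)) \<in> L2"
proof (rule L2I)
  have "(gauss x)\<^sup>2 \<le> gauss x" for x :: 'a
    using mult_left_le[OF gauss_le_1[of x] less_imp_le[OF gauss_pos]] by (simp add: power2_eq_square)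
  then show "integrable lborel (\<lambda>x::'a. (cmod (of_real (gauss x)))\<^sup>2)"
    by (intro Bochner_Integration.integrable_bound[OF gauss_integrable]) (auto simp: abs_of_pos[OF gauss_pos])
qed measurable

text \<open>The remainders of the low-frequency parts are small in \<open>L\<^sup>2\<close> uniformly in \<open>n\<close> once the radius \<open>k\<close> is large. For
  this fixed \<open>k\<close> the weighted low-frequency parts converge by dominated convergence.\<close>

lemma gauss_weight_Cauchy:
  fixes u :: "nat \<Rightarrow> 'a::euclidean_space \<Rightarrow> complex"
  assumes s: "s > 0" and u: "\<And>n. u n \<in> Hs s" and M: "\<And>n. L2_norm (u n) \<le> M" "\<And>n. L2_norm (frac_symbol s (u n)) \<le> M"
    and conv: "\<And>k x. convergent (\<lambda>n. lowpass (real k) (u n) x)" and e: "e > 0"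
  shows "\<exists>N. \<forall>i\<ge>N. \<forall>j\<ge>N. L2_dist (gauss_weight (u i)) (gauss_weight (u j)) < e"
proof -
  have u2: "u n \<in> L2" for n using u by (simp add: Hs_iff)
  have "((\<lambda>k::nat. real k powr (- s) * M) \<longlongrightarrow> 0 * M) sequentially"
    using s by (intro tendsto_mult tendsto_const tendsto_neg_powr filterlim_real_sequentially) auto
  then have "eventually (\<lambda>k::nat. real k powr (- s) * M < e / 5) sequentially"
    using order_tendstoD(2)[of _ "0 * M" sequentially "e / 5"] e by auto
  then have "eventually (\<lambda>k::nat. real k powr (- s) * M < e / 5 \<and> k > 0) sequentially"
    using eventually_gt_at_top[of 0] by eventually_elim simp
  then obtain k :: nat where k: "real k powr (- s) * M < e / 5" "k > 0"
    using eventually_happens'[OF sequentially_bot] by blast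
  let ?V = "\<lambda>n. lowpass (real k) (u n)"
  define B where "B = fourier_const TYPE('a) * cball_L2 TYPE('a) (real k) * M"
  have V2: "?V n \<in> L2" for n by (rule lowpass_approx(1)[OF u2]) simp
  have VB: "cmod (?V n x) \<le> B" for n x
  proof -
    have "cmod (?V n x) \<le> fourier_const TYPE('a) * cball_L2 TYPE('a) (real k) * L2_norm (u n)"
      by (rule lowpass_bound[OF u2])
    also have "\<dots> \<le> B" unfolding B_def using M(1)[of n] fourier_const_pos[where 'a='a]
      by (intro mult_left_mono) (auto simp: cball_L2_def)
    finally show ?thesis .
  qed
  define V where "V x = lim (\<lambda>n. ?V n x)" for x
  have Vlim: "(\<lambda>n. ?V n x) \<longlonglongrightarrow> V x" for x
    using conv[of k x] unfolding V_def by (simp add: convergent_LIMSEQ_iff)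
  have Vm [measurable]: "V \<in> borel_measurable borel" unfolding V_def
    by (rule borel_measurable_lim_metric) (rule L2_measurable[OF V2])
  have VB': "cmod (V x) \<le> B" for x
    by (rule LIMSEQ_le_const2[OF tendsto_norm[OF Vlim]]) (use VB in auto)
  have WV: "gauss_weight V \<in> L2"
    unfolding gauss_weight_def using L2_bounded_mult(1)[OF gauss_L2 Vm VB'] by (simp add: mult.commute)
  have close: "L2_dist (gauss_weight (u n)) (gauss_weight (?V n)) < e / 5" for n
  proof -
    have "(\<lambda>x. gauss_weight (u n) x - gauss_weight (?V n) x) = gauss_weight (\<lambda>x. u n x - ?V n x)"
      by (simp add: gauss_weight_def right_diff_distrib)
    then have "L2_dist (gauss_weight (u n)) (gauss_weight (?V n)) \<le> L2_dist (u n) (?V n)"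
      using gauss_weight_L2(2)[OF L2_diff[OF u2 V2]] by simp
    also have "\<dots> \<le> real k powr (- s) * L2_norm (frac_symbol s (u n))"
      using k s by (intro lowpass_approx_Hs u) auto
    also have "\<dots> \<le> real k powr (- s) * M" by (intro mult_left_mono M) simp
    finally show ?thesis using k by simp
  qed
  have "(\<lambda>n. LINT x|lborel. (cmod (gauss_weight (?V n) x - gauss_weight V x))\<^sup>2) \<longlonglongrightarrow> (LINT x|(lborel::'a measure). (0::real))"
  proof (rule integral_dominated_convergence[where w="\<lambda>x. (2 * B)\<^sup>2 * gauss x"])
    show "integrable lborel (\<lambda>x::'a. (2 * B)\<^sup>2 * gauss x)" using gauss_integrable by (rule integrable_mult_right)
    show "AE x in lborel. (\<lambda>n. (cmod (gauss_weight (?V n) x - gauss_weight V x))\<^sup>2) \<longlonglongrightarrow> 0"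
    proof (rule AE_I2)
      fix x
      have "(\<lambda>n. (cmod (gauss_weight (?V n) x - gauss_weight V x))\<^sup>2) \<longlonglongrightarrow> (cmod (of_real (gauss x) * V x - of_real (gauss x) * V x))\<^sup>2"
        unfolding gauss_weight_def by (intro tendsto_intros Vlim)
      then show "(\<lambda>n. (cmod (gauss_weight (?V n) x - gauss_weight V x))\<^sup>2) \<longlonglongrightarrow> 0" by simp
    qed
    show "AE x in lborel. norm ((cmod (gauss_weight (?V n) x - gauss_weight V x))\<^sup>2) \<le> (2 * B)\<^sup>2 * gauss x" for n
    proof (rule AE_I2)
      fix x
      have "cmod (gauss_weight (?V n) x - gauss_weight V x) = gauss x * cmod (?V n x - V x)"
        unfolding gauss_weight_def right_diff_distrib[symmetric] norm_mult by (simp add: abs_of_pos[OF gauss_pos])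
      also have "\<dots> \<le> gauss x * (2 * B)"
        using VB[of n x] VB'[of x] norm_triangle_ineq4[of "?V n x" "V x"] less_imp_le[OF gauss_pos[of x]] by (intro mult_left_mono) linarith+
      finally have "(cmod (gauss_weight (?V n) x - gauss_weight V x))\<^sup>2 \<le> (gauss x * (2 * B))\<^sup>2" by (intro power_mono) auto
      also have "\<dots> = ((2 * B)\<^sup>2 * gauss x) * gauss x" by (simp add: power2_eq_square)
      also have "\<dots> \<le> (2 * B)\<^sup>2 * gauss x"
        using gauss_le_1[of x] less_imp_le[OF gauss_pos[of x]] by (intro mult_left_le mult_nonneg_nonneg) auto
      finally show "norm ((cmod (gauss_weight (?V n) x - gauss_weight V x))\<^sup>2) \<le> (2 * B)\<^sup>2 * gauss x" by simp
    qed
    show "(\<lambda>x. (cmod (gauss_weight (?V n) x - gauss_weight V x))\<^sup>2) \<in> borel_measurable lborel" for n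
      using L2_measurable[OF L2_diff[OF gauss_weight_L2(1)[OF V2] WV]] by measurable
  qed simp
  then have "(\<lambda>n. sqrt (LINT x|lborel. (cmod (gauss_weight (?V n) x - gauss_weight V x))\<^sup>2)) \<longlonglongrightarrow> sqrt 0"
    by (intro tendsto_intros) simp
  then have "(\<lambda>n. L2_dist (gauss_weight (?V n)) (gauss_weight V)) \<longlonglongrightarrow> 0"
    by (simp add: L2_norm_def)
  then have "eventually (\<lambda>n. L2_dist (gauss_weight (?V n)) (gauss_weight V) < e / 5) sequentially"
    using e by (intro order_tendstoD(2)[of _ 0]) auto
  then obtain N where N: "\<And>n. n \<ge> N \<Longrightarrow> L2_dist (gauss_weight (?V n)) (gauss_weight V) < e / 5"
    by (auto simp: eventually_sequentially)
  have near: "L2_dist (gauss_weight (u n)) (gauss_weight V) < 2 * (e / 5)" if "n \<ge> N" for n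
    using L2_norm_diff_triangle[OF gauss_weight_L2(1)[OF u2] gauss_weight_L2(1)[OF V2] WV, of n n] close[of n] N[OF that] by linarith
  have "L2_dist (gauss_weight (u i)) (gauss_weight (u j)) < e" if "i \<ge> N" "j \<ge> N" for i j
    using L2_norm_diff_triangle[OF gauss_weight_L2(1)[OF u2] WV gauss_weight_L2(1)[OF u2], of i j] near[OF that(1)] near[OF that(2)] e
    unfolding L2_norm_minus_commute[of "gauss_weight V"] by linarith
  then show ?thesis by blast
qed

text \<open>The limit is found by dividing the \<open>L\<^sup>2\<close> limit of the weighted functions by the weight. Weak convergence is
  tested on functions supported in balls, where the inverse weight is bounded; it passes to the Fourier side
  by the adjoint. Testing there with the truncated symbol of the limit itself bounds that symbol and puts the
  limit into \<open>H\<^sup>s\<close>.\<close>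

theorem Hs_local_compactness:
  fixes u :: "nat \<Rightarrow> 'a::euclidean_space \<Rightarrow> complex"
  assumes s: "s > 0" and u: "\<And>n. u n \<in> Hs s" and M: "\<And>n. L2_norm (u n) \<le> M" "\<And>n. L2_norm (frac_symbol s (u n)) \<le> M"
  obtains r \<phi> where "strict_mono (r :: nat \<Rightarrow> nat)" "\<phi> \<in> Hs s"
    "AE x in lborel. (\<lambda>n. u (r n) x) \<longlonglongrightarrow> \<phi> x"
    "\<forall>g\<in>L2. (\<lambda>n. L2_inner (u (r n)) g) \<longlonglongrightarrow> L2_inner \<phi> g"
    "\<forall>g\<in>L2. (\<lambda>n. L2_inner (fourier (u (r n))) g) \<longlonglongrightarrow> L2_inner (fourier \<phi>) g"
    "\<forall>g\<in>L2. (\<lambda>n. L2_inner (frac_symbol s (u (r n))) g) \<longlonglongrightarrow> L2_inner (frac_symbol s \<phi>) g"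
proof -
  have u2: "u n \<in> L2" "frac_symbol s (u n) \<in> L2" for n using u by (auto simp: Hs_iff)
  have M0: "M \<ge> 0" using L2_norm_nonneg M order_trans by blast
  obtain r1 where r1: "strict_mono (r1 :: nat \<Rightarrow> nat)" "\<And>k x. convergent (\<lambda>n. lowpass (real k) (u (r1 n)) x)"
    using lowpass_convergent_subsequence[of u, OF u2(1) M(1)] by blast
  obtain \<psi> where \<psi>: "\<psi> \<in> L2" "(\<lambda>n. L2_dist (gauss_weight (u (r1 n))) \<psi>) \<longlonglongrightarrow> 0"
    by (rule L2_complete[of "\<lambda>n. gauss_weight (u (r1 n))", OF gauss_weight_L2(1)[OF u2(1)] gauss_weight_Cauchy[of s "\<lambda>n. u (r1 n)" M, OF s u M r1(2)]])
  obtain r2 where r2: "strict_mono (r2 :: nat \<Rightarrow> nat)" "AE x in lborel. (\<lambda>n. gauss_weight (u (r1 (r2 n))) x) \<longlonglongrightarrow> \<psi> x"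
    by (rule L2_AE_subseq[of "\<lambda>n. gauss_weight (u (r1 n))", OF gauss_weight_L2(1)[OF u2(1)] \<psi>])
  define r where "r = r1 \<circ> r2"
  have r: "strict_mono r" unfolding r_def by (rule strict_mono_o[OF r1(1) r2(1)])
  define \<phi> where "\<phi> x = \<psi> x / of_real (gauss x)" for x
  have g0: "gauss x \<noteq> 0" for x :: 'a using gauss_pos[of x] by simp
  have \<psi>_eq: "\<psi> = gauss_weight \<phi>" by (rule ext) (simp add: gauss_weight_def \<phi>_def g0)
  have \<phi>m [measurable]: "\<phi> \<in> borel_measurable borel" unfolding \<phi>_def using L2_measurable[OF \<psi>(1)] by measurable
  have ae: "AE x in lborel. (\<lambda>n. u (r n) x) \<longlonglongrightarrow> \<phi> x"
    using r2(2)
  proof eventually_elim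
    case (elim x)
    have "(\<lambda>n. gauss_weight (u (r1 (r2 n))) x / of_real (gauss x)) \<longlonglongrightarrow> \<psi> x / of_real (gauss x)"
      by (intro tendsto_divide elim tendsto_const) (simp add: g0)
    then show ?case by (simp add: gauss_weight_def r_def \<phi>_def g0)
  qed
  have \<phi>2: "\<phi> \<in> L2" "L2_norm \<phi> \<le> M"
    using L2_Fatou[of "\<lambda>n. u (r n)" \<phi> M, OF u2(1) \<phi>m ae] M(1) by auto
  have lim2: "(\<lambda>n. L2_dist (gauss_weight (u (r n))) (gauss_weight \<phi>)) \<longlonglongrightarrow> 0"
    using LIMSEQ_subseq_LIMSEQ[OF \<psi>(2) r2(1)] unfolding r_def \<psi>_eq by (simp add: o_def)
  have weak: "(\<lambda>n. L2_inner (u (r n)) g) \<longlonglongrightarrow> L2_inner \<phi> g" if g: "g \<in> L2" for g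
  proof (rule L2_weak_from_truncations[OF u2(1) \<phi>2(1) M(1) \<phi>2(2) g])
    fix k :: nat
    define h where "h = (\<lambda>x. (indicator (cball 0 (real k)) x / of_real (gauss x)) * g x)"
    have h: "h \<in> L2" unfolding h_def
    proof (rule L2_bounded_mult(1)[OF g, where B="exp ((real k)\<^sup>2 / 2)"])
      show "cmod (indicator (cball 0 (real k)) x / of_real (gauss x)) \<le> exp ((real k)\<^sup>2 / 2)" for x :: 'a
      proof (cases "x \<in> cball 0 (real k)")
        case True
        have "cmod (indicator (cball 0 (real k)) x / of_real (gauss x)) = inverse (gauss x)"
          using True by (simp add: norm_divide abs_of_pos[OF gauss_pos] inverse_eq_divide)
        also have "\<dots> = exp ((norm x)\<^sup>2 / 2)" unfolding gauss_def exp_minus[symmetric] by simp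
        also have "(norm x)\<^sup>2 \<le> (real k)\<^sup>2" using True by (intro power_mono) auto
        finally show ?thesis by simp
      qed simp
    qed measurable
    have eq: "L2_inner v (ball_trunc (real k) g) = L2_inner (gauss_weight v) h" for v
      unfolding L2_inner_def
      by (intro Bochner_Integration.integral_cong refl) (simp add: ball_trunc_def h_def gauss_weight_def g0)
    show "(\<lambda>n. L2_inner (u (r n)) (ball_trunc (real k) g)) \<longlonglongrightarrow> L2_inner \<phi> (ball_trunc (real k) g)"
      unfolding eq
      by (rule L2_inner_tendsto_left[OF gauss_weight_L2(1)[OF u2(1)] gauss_weight_L2(1)[OF \<phi>2(1)] h lim2])
  qed
  have Fweak: "(\<lambda>n. L2_inner (fourier (u (r n))) g) \<longlonglongrightarrow> L2_inner (fourier \<phi>) g" if "g \<in> L2" for g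
    by (rule fourier_weak[of "\<lambda>n. u (r n)", OF u2(1) \<phi>2(1) weak that])
  let ?p = "\<lambda>\<xi>::'a. complex_of_real (norm \<xi> powr s)"
  have pk: "(\<lambda>\<xi>. ?p \<xi> * ball_trunc (real k) g \<xi>) \<in> L2" if g: "g \<in> L2" for g and k :: nat
  proof -
    have "(\<lambda>\<xi>. (?p \<xi> * indicator (cball 0 (real k)) \<xi>) * g \<xi>) \<in> L2"
    proof (rule L2_bounded_mult(1)[OF g, where B="real k powr s"])
      show "cmod (?p \<xi> * indicator (cball 0 (real k)) \<xi>) \<le> real k powr s" for \<xi>
        using s by (auto simp: norm_mult indicator_def intro!: powr_mono2)
    qed measurable
    then show ?thesis by (simp add: ball_trunc_def mult.assoc)
  qed
  have move: "L2_inner (frac_symbol s v) (ball_trunc (real k) g) = L2_inner (fourier v) (\<lambda>\<xi>. ?p \<xi> * ball_trunc (real k) g \<xi>)" for v g and k :: nat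
    unfolding L2_inner_def by (intro Bochner_Integration.integral_cong refl) (simp add: frac_symbol_def mult_ac)
  have tw: "(\<lambda>n. L2_inner (frac_symbol s (u (r n))) (ball_trunc (real k) g)) \<longlonglongrightarrow> L2_inner (frac_symbol s \<phi>) (ball_trunc (real k) g)"
    if "g \<in> L2" for g and k :: nat
    unfolding move by (rule Fweak[OF pk[OF that]])
  have F\<phi>: "fourier \<phi> \<in> L2" by (rule fourier_spec[OF \<phi>2(1)])
  have trunc_bound: "ball_trunc (real k) (frac_symbol s \<phi>) \<in> L2 \<and> L2_norm (ball_trunc (real k) (frac_symbol s \<phi>)) \<le> M" for k :: nat
  proof -
    let ?z = "ball_trunc (real k) (frac_symbol s \<phi>)"
    have z_eq: "?z = (\<lambda>\<xi>. ?p \<xi> * ball_trunc (real k) (fourier \<phi>) \<xi>)"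
      by (rule ext) (simp add: ball_trunc_def frac_symbol_def mult_ac)
    have z: "?z \<in> L2" unfolding z_eq by (rule pk[OF F\<phi>])
    have tz: "ball_trunc (real k) ?z = ?z" by (rule ext) (simp add: ball_trunc_def indicator_def)
    have "(\<lambda>n. L2_inner (frac_symbol s (u (r n))) ?z) \<longlonglongrightarrow> L2_inner (frac_symbol s \<phi>) ?z"
      using tw[OF z, of k] unfolding tz .
    moreover have "L2_inner (frac_symbol s \<phi>) ?z = L2_inner ?z ?z"
      unfolding L2_inner_def by (intro Bochner_Integration.integral_cong refl) (simp add: ball_trunc_def indicator_def)
    ultimately have "(\<lambda>n. L2_inner (frac_symbol s (u (r n))) ?z) \<longlonglongrightarrow> of_real ((L2_norm ?z)\<^sup>2)"
      by (simp only: L2_inner_self)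
    from tendsto_norm[OF this]
    have "(\<lambda>n. cmod (L2_inner (frac_symbol s (u (r n))) ?z)) \<longlonglongrightarrow> (L2_norm ?z)\<^sup>2"
      unfolding norm_of_real by simp
    moreover have "cmod (L2_inner (frac_symbol s (u (r n))) ?z) \<le> M * L2_norm ?z" for n
      using L2_Cauchy_Schwarz[OF u2(2) z] M(2) by (meson L2_norm_nonneg mult_right_mono order_trans)
    ultimately have "(L2_norm ?z)\<^sup>2 \<le> M * L2_norm ?z" by (intro LIMSEQ_le_const2) auto
    then have "L2_norm ?z \<le> M"
      using M0 L2_norm_nonneg[of ?z] by (cases "L2_norm ?z = 0") (auto simp: power2_eq_square)
    then show ?thesis using z by blast
  qed
  have "AE \<xi> in lborel. (\<lambda>k. ball_trunc (real k) (frac_symbol s \<phi>) \<xi>) \<longlonglongrightarrow> frac_symbol s \<phi> \<xi>"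
  proof (rule AE_I2, rule tendsto_eventually)
    fix \<xi> :: 'a
    obtain K :: nat where "norm \<xi> \<le> real K" using real_arch_simple by blast
    then show "\<forall>\<^sub>F k in sequentially. ball_trunc (real k) (frac_symbol s \<phi>) \<xi> = frac_symbol s \<phi> \<xi>"
      unfolding eventually_sequentially by (intro exI[of _ K]) (auto simp: ball_trunc_def)
  qed
  from L2_Fatou[OF _ frac_symbol_measurable[OF \<phi>2(1)] this, of M] trunc_bound
  have sym: "frac_symbol s \<phi> \<in> L2" "L2_norm (frac_symbol s \<phi>) \<le> M" by auto
  have sweak: "(\<lambda>n. L2_inner (frac_symbol s (u (r n))) g) \<longlonglongrightarrow> L2_inner (frac_symbol s \<phi>) g" if g: "g \<in> L2" for g
    by (rule L2_weak_from_truncations[OF u2(2) sym(1) M(2) sym(2) g tw[OF g]])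
  show ?thesis
  proof (rule that[OF r _ ae])
    show "\<phi> \<in> Hs s" using \<phi>2 sym by (simp add: Hs_iff)
  qed (use weak Fweak sweak in blast)+
qed

lemma L2_norm_diff_weak:
  assumes u: "\<And>n::nat. u n \<in> L2" and v: "v \<in> L2" and w: "(\<lambda>n. L2_inner (u n) v) \<longlonglongrightarrow> L2_inner v v"
  shows "(\<lambda>n. (L2_dist (u n) v)\<^sup>2 - (L2_norm (u n))\<^sup>2) \<longlonglongrightarrow> - (L2_norm v)\<^sup>2"
proof -
  have "(\<lambda>n. - 2 * Re (L2_inner (u n) v) + (L2_norm v)\<^sup>2) \<longlonglongrightarrow> - 2 * Re (L2_inner v v) + (L2_norm v)\<^sup>2"
    by (intro tendsto_intros tendsto_Re w)
  then show ?thesis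
    unfolding L2_norm_diff_sq[OF u v] L2_inner_self by simp
qed

section \<open>The constraint and its minimal value\<close>

definition mass :: "('a::euclidean_space \<Rightarrow> complex) \<Rightarrow> real" where
  "mass u = (L2_norm u)\<^sup>2"

definition kinetic :: "real \<Rightarrow> ('a::euclidean_space \<Rightarrow> complex) \<Rightarrow> real" where
  "kinetic s u = (L2_norm (frac_symbol s u))\<^sup>2"

definition entropy :: "('a::euclidean_space \<Rightarrow> complex) \<Rightarrow> real" where
  "entropy u = (LINT x|lborel. sq_log (cmod (u x)))"

lemma mass_nonneg [simp]: "0 \<le> mass u" and kinetic_nonneg [simp]: "0 \<le> kinetic s u"
  by (auto simp: mass_def kinetic_def)

lemma I_functional_eq:
  assumes u: "u \<in> Hs s"
  shows "I_functional s \<omega> u = kinetic s u + \<omega> * mass u - entropy u"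
  using frac_laplacian_norm[OF u]
  by (simp add: I_functional_def kinetic_def mass_def entropy_def sq_log_def L2_norm_sq[symmetric])

lemma S_functional_eq:
  "S_functional s \<omega> u = I_functional s \<omega> u / 2 + mass u / 2"
  by (simp add: S_functional_def I_functional_def mass_def L2_norm_sq field_simps)

lemma Ws_Hs: "u \<in> Ws s \<Longrightarrow> u \<in> Hs s"
  by (simp add: Ws_def)

lemma Ws_L2: "u \<in> Ws s \<Longrightarrow> u \<in> L2"
  by (simp add: Ws_def Hs_iff)

lemma Ws_sq_log_integrable:
  assumes s: "s > 0" and u: "u \<in> Ws s"
  shows "integrable lborel (\<lambda>x. sq_log (cmod (u x)))"
proof -
  have [measurable]: "u \<in> borel_measurable borel" using Ws_L2[OF u] by measurable
  have "integrable lborel (\<lambda>x. log_modular (cmod (u x)))" using Ws_iff[OF s] u by blast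
  then show ?thesis by (rule Bochner_Integration.integrable_bound) (auto simp: log_modular_def)
qed

lemma mass_pos_iff: "u \<in> L2 \<Longrightarrow> mass u > 0 \<longleftrightarrow> \<not> (AE x in lborel. u x = 0)"
  using L2_norm_eq_0_iff[of u] by (auto simp: mass_def)

lemma Ws_diff:
  assumes s: "s > 0" and u: "u \<in> Ws s" and v: "v \<in> Ws s"
  shows "(\<lambda>x. u x - v x) \<in> Ws s"
proof -
  have uv: "integrable lborel (\<lambda>x. log_modular (cmod (u x)))" "integrable lborel (\<lambda>x. log_modular (cmod (v x)))"
    using Ws_iff[OF s] u v by auto
  have [measurable]: "u \<in> borel_measurable borel" "v \<in> borel_measurable borel" using Ws_L2[OF u] Ws_L2[OF v] by measurable
  obtain K where K: "K > 0" "\<And>a b :: complex. log_modular (cmod (a + b)) \<le> K * (log_modular (cmod a) + log_modular (cmod b))"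
    using log_modular_add by blast
  have "integrable lborel (\<lambda>x. K * (log_modular (cmod (u x)) + log_modular (cmod (v x))))" using uv by auto
  then have "integrable lborel (\<lambda>x. log_modular (cmod (u x - v x)))"
  proof (rule Bochner_Integration.integrable_bound)
    show "AE x in lborel. norm (log_modular (cmod (u x - v x))) \<le> norm (K * (log_modular (cmod (u x)) + log_modular (cmod (v x))))"
    proof (rule AE_I2)
      fix x
      show "norm (log_modular (cmod (u x - v x))) \<le> norm (K * (log_modular (cmod (u x)) + log_modular (cmod (v x))))"
        using K(2)[of "u x" "- v x"] by simp
    qed
  qed measurable
  then show ?thesis using Ws_iff[OF s] Hs_diff(1)[OF Ws_Hs[OF u] Ws_Hs[OF v]] by blast
qed

lemma Ws_scale:
  fixes u :: "'a::euclidean_space \<Rightarrow> complex"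
  assumes s: "s > 0" and u: "u \<in> Ws s" and t: "t > 0"
  defines "v \<equiv> \<lambda>x. complex_of_real t * u x"
  shows "v \<in> Ws s" "mass v = t\<^sup>2 * mass u" "I_functional s \<omega> v = t\<^sup>2 * (I_functional s \<omega> u - ln (t\<^sup>2) * mass u)"
proof -
  have u2: "u \<in> L2" using u by (rule Ws_L2)
  have [measurable]: "u \<in> borel_measurable borel" using u2 by measurable
  have li: "integrable lborel (\<lambda>x. log_modular (cmod (u x)))" using Ws_iff[OF s] u by blast
  have cv: "cmod (v x) = t * cmod (u x)" for x using t by (simp add: v_def norm_mult)
  obtain C where C: "C > 0" "\<And>r. r \<ge> 0 \<Longrightarrow> log_modular (t * r) \<le> C * log_modular r"
    using log_modular_scale[of t] t by (metis less_imp_le)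
  have vH: "v \<in> Hs s" "L2_norm (frac_symbol s v) = t * L2_norm (frac_symbol s u)"
    unfolding v_def using Hs_scale[OF Ws_Hs[OF u], of "of_real t"] t by auto
  have "integrable lborel (\<lambda>x. C * log_modular (cmod (u x)))" using li by auto
  then have "integrable lborel (\<lambda>x. log_modular (cmod (v x)))"
  proof (rule Bochner_Integration.integrable_bound)
    show "AE x in lborel. norm (log_modular (cmod (v x))) \<le> norm (C * log_modular (cmod (u x)))"
    proof (rule AE_I2)
      fix x
      show "norm (log_modular (cmod (v x))) \<le> norm (C * log_modular (cmod (u x)))"
        using C(1) C(2)[of "cmod (u x)"] by (simp add: cv)
    qed
  qed (simp add: v_def)
  then show vW: "v \<in> Ws s" using vH Ws_iff[OF s] by blast
  show m: "mass v = t\<^sup>2 * mass u"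
    unfolding mass_def v_def using L2_scale(2)[OF u2, of "of_real t"] by (simp add: power_mult_distrib)
  have k: "kinetic s v = t\<^sup>2 * kinetic s u" unfolding kinetic_def vH(2) by (simp add: power_mult_distrib)
  have "entropy v = (LINT x|lborel. t\<^sup>2 * sq_log (cmod (u x)) + sq_log t * (cmod (u x))\<^sup>2)"
    unfolding entropy_def cv using t by (simp add: sq_log_mult mult.commute)
  also have "\<dots> = t\<^sup>2 * entropy u + sq_log t * mass u"
    using Ws_sq_log_integrable[OF s u] L2_integrable[OF u2] by (simp add: entropy_def mass_def L2_norm_sq)
  finally show "I_functional s \<omega> v = t\<^sup>2 * (I_functional s \<omega> u - ln (t\<^sup>2) * mass u)"
    unfolding I_functional_eq[OF vH(1)] I_functional_eq[OF Ws_Hs[OF u]] m k by (simp add: sq_log_def algebra_simps)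
qed

lemma Ws_translate:
  fixes u :: "'a::euclidean_space \<Rightarrow> complex" and y :: 'a
  assumes s: "s > 0" and u: "u \<in> Ws s"
  defines "v \<equiv> \<lambda>x. u (x - y)"
  shows "v \<in> Ws s" "mass v = mass u" "kinetic s v = kinetic s u" "entropy v = entropy u" "I_functional s \<omega> v = I_functional s \<omega> u"
proof -
  have u2: "u \<in> L2" using u by (rule Ws_L2)
  have [measurable]: "u \<in> borel_measurable borel" using u2 by measurable
  have tr: "(LINT x|lborel. f (v x)) = (LINT x|lborel. f (u x))" "integrable lborel (\<lambda>x. f (v x)) \<longleftrightarrow> integrable lborel (\<lambda>x. f (u x))"
    if [measurable]: "f \<in> borel_measurable borel" for f :: "complex \<Rightarrow> real"
    using lborel_translation_integral[of "\<lambda>x. f (u x)" "- y"] unfolding v_def by auto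
  have vH: "v \<in> Hs s" unfolding v_def by (rule Hs_translate(1)[OF Ws_Hs[OF u]])
  have "integrable lborel (\<lambda>x. log_modular (cmod (v x)))"
    using tr(2)[of "\<lambda>z. log_modular (cmod z)"] Ws_iff[OF s] u by auto
  then show vW: "v \<in> Ws s" using vH Ws_iff[OF s] by blast
  show m: "mass v = mass u" unfolding mass_def L2_norm_sq by (rule tr(1)) measurable
  show k: "kinetic s v = kinetic s u" unfolding kinetic_def v_def Hs_translate(2)[OF Ws_Hs[OF u]] ..
  show e: "entropy v = entropy u" unfolding entropy_def by (rule tr(1)) measurable
  show "I_functional s \<omega> v = I_functional s \<omega> u"
    unfolding I_functional_eq[OF vH] I_functional_eq[OF Ws_Hs[OF u]] m k e ..
qed

lemma gauss_fourier_integral: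
  "fourier_integral (\<lambda>x::'a::euclidean_space. complex_of_real (gauss x)) \<xi> = of_real (gauss \<xi>)"
proof -
  have "(LINT x|lborel. complex_of_real (gauss x) * exp (- (\<i> * of_real (\<xi> \<bullet> x)))) = of_real (sqrt (2 * pi) ^ DIM('a) * gauss \<xi>)"
    using gauss_fourier(2)[of "- \<xi>"] by (simp add: gauss_def)
  then have "fourier_integral (\<lambda>x::'a. complex_of_real (gauss x)) \<xi> = of_real ((fourier_const TYPE('a) * sqrt (2 * pi) ^ DIM('a)) * gauss \<xi>)"
    unfolding fourier_integral_altdef by simp
  then show ?thesis by (simp only: fourier_const_gauss mult_1)
qed

lemma gauss_sq_bound: "(1 + (norm x)\<^sup>2) * (gauss x)\<^sup>2 \<le> 2 * gauss x"
proof -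
  have "1 + (norm x)\<^sup>2 / 2 \<le> exp ((norm x)\<^sup>2 / 2)" by (rule exp_ge_add_one_self)
  then have "1 + (norm x)\<^sup>2 \<le> 2 * exp ((norm x)\<^sup>2 / 2)" by linarith
  then have "(1 + (norm x)\<^sup>2) * gauss x \<le> (2 * exp ((norm x)\<^sup>2 / 2)) * gauss x"
    using less_imp_le[OF gauss_pos[of x]] by (intro mult_right_mono) auto
  also have "\<dots> = 2" by (simp add: gauss_def exp_minus)
  finally have "(1 + (norm x)\<^sup>2) * gauss x * gauss x \<le> 2 * gauss x"
    using less_imp_le[OF gauss_pos[of x]] by (intro mult_right_mono) auto
  then show ?thesis by (simp add: power2_eq_square mult.assoc)
qed

lemma gauss_Ws_nonzero:
  assumes s: "0 < s" "s < 1"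
  shows "(\<lambda>x::'a::euclidean_space. complex_of_real (gauss x)) \<in> Ws_nonzero s"
proof -
  let ?G = "\<lambda>x::'a. complex_of_real (gauss x)"
  have G1: "integrable lborel ?G" using gauss_integrable by (rule integrable_of_real)
  note G2 = gauss_L2[where 'a='a]
  have ae: "AE \<xi> in lborel. of_real (norm \<xi> powr s) * ?G \<xi> = frac_symbol s ?G \<xi>"
    using fourier_eq_fourier_integral[OF G2 G1] by eventually_elim (simp add: frac_symbol_def gauss_fourier_integral)
  have "(\<lambda>\<xi>::'a. of_real (norm \<xi> powr s) * ?G \<xi>) \<in> L2"
  proof (rule L2I)
    show "integrable lborel (\<lambda>\<xi>::'a. (cmod (of_real (norm \<xi> powr s) * ?G \<xi>))\<^sup>2)"
    proof (rule Bochner_Integration.integrable_bound[OF integrable_mult_right[OF gauss_integrable, of 2]])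
      show "AE \<xi>::'a in lborel. norm ((cmod (of_real (norm \<xi> powr s) * ?G \<xi>))\<^sup>2) \<le> norm (2 * gauss \<xi>)"
      proof (rule AE_I2)
        fix \<xi> :: 'a
        have "(norm \<xi> powr s)\<^sup>2 \<le> 1 + (norm \<xi>)\<^sup>2"
        proof (cases "norm \<xi> \<le> 1")
          case True
          have "norm \<xi> powr s \<le> 1" using True s by (intro powr_le1) auto
          then have "(norm \<xi> powr s)\<^sup>2 \<le> 1" by (intro power_le_one) auto
          then show ?thesis by (simp add: add_increasing2)
        next
          case False
          then have "norm \<xi> powr s \<le> norm \<xi> powr 1" using s by (intro powr_mono) auto
          then have "(norm \<xi> powr s)\<^sup>2 \<le> (norm \<xi>)\<^sup>2" using False by (intro power_mono) auto
          then show ?thesis by linarith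
        qed
        then have "(norm \<xi> powr s)\<^sup>2 * (gauss \<xi>)\<^sup>2 \<le> (1 + (norm \<xi>)\<^sup>2) * (gauss \<xi>)\<^sup>2" by (intro mult_right_mono) auto
        also have "\<dots> \<le> 2 * gauss \<xi>" by (rule gauss_sq_bound)
        finally show "norm ((cmod (of_real (norm \<xi> powr s) * ?G \<xi>))\<^sup>2) \<le> norm (2 * gauss \<xi>)"
          using gauss_pos[of \<xi>] by (simp add: norm_mult power_mult_distrib)
      qed
    qed measurable
  qed measurable
  then have "frac_symbol s ?G \<in> L2" by (rule L2_cong_AE[OF _ frac_symbol_measurable[OF G2] ae])
  then have H: "?G \<in> Hs s" using G2 by (simp add: Hs_iff)
  have "integrable lborel (\<lambda>x::'a. log_modular (cmod (?G x)))"
  proof (rule Bochner_Integration.integrable_bound[OF integrable_mult_right[OF gauss_integrable, of 2]])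
    show "AE x::'a in lborel. norm (log_modular (cmod (?G x))) \<le> norm (2 * gauss x)"
    proof (rule AE_I2)
      fix x :: 'a
      have "ln ((gauss x)\<^sup>2) = - (norm x)\<^sup>2" using gauss_pos[of x] by (simp add: ln_realpow) (simp add: gauss_def)
      then have "log_modular (gauss x) = (1 + (norm x)\<^sup>2) * (gauss x)\<^sup>2"
        by (simp add: log_modular_def sq_log_def abs_mult algebra_simps)
      then show "norm (log_modular (cmod (?G x))) \<le> norm (2 * gauss x)"
        using gauss_sq_bound[of x] gauss_pos[of x] by simp
    qed
  qed measurable
  then have W: "?G \<in> Ws s" using H Ws_iff[OF s(1)] by blast
  have "\<not> (AE x::'a in lborel. ?G x = 0)"
  proof
    assume "AE x::'a in lborel. ?G x = 0"
    then have "AE x::'a in lborel. False" by eventually_elim (use gauss_pos in \<open>auto simp: less_le\<close>)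
    then show False by (simp add: eventually_False ae_filter_eq_bot_iff)
  qed
  then show ?thesis using W by (simp add: Ws_nonzero_def)
qed

lemma constraint_bdd_below:
  "bdd_below {S_functional s \<omega> u | u :: 'a::euclidean_space \<Rightarrow> complex. u \<in> Ws_nonzero s \<and> I_functional s \<omega> u = 0}"
  by (rule bdd_belowI[of _ 0]) (auto simp: S_functional_eq)

lemma Nehari_rescaling:
  fixes u :: "'a::euclidean_space \<Rightarrow> complex"
  assumes s: "s > 0" and u: "u \<in> Ws_nonzero s"
  obtains v :: "'a \<Rightarrow> complex" where "v \<in> Ws_nonzero s" "I_functional s \<omega> v = 0"
    "mass v = mass u * exp (I_functional s \<omega> u / mass u)"
proof -
  have uW: "u \<in> Ws s" and m: "mass u > 0" using u mass_pos_iff[OF Ws_L2] by (auto simp: Ws_nonzero_def)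
  define t where "t = exp (I_functional s \<omega> u / mass u / 2)"
  have t: "t > 0" by (simp add: t_def)
  have t2: "t\<^sup>2 = exp (I_functional s \<omega> u / mass u)" by (simp add: t_def power2_eq_square exp_add[symmetric])
  note S = Ws_scale[OF s uW t]
  let ?v = "\<lambda>x. complex_of_real t * u x"
  have "mass ?v > 0" using S(2) m t by simp
  then have "?v \<in> Ws_nonzero s" using S(1) mass_pos_iff[OF Ws_L2[OF S(1)]] by (simp add: Ws_nonzero_def)
  moreover have "I_functional s \<omega> ?v = 0" unfolding S(3) t2 using m by simp
  moreover have "mass ?v = mass u * exp (I_functional s \<omega> u / mass u)" unfolding S(2) t2 by simp
  ultimately show ?thesis using that by blast
qed

text \<open>The key variational inequality: the right-hand side is the mass of the multiple of \<open>u\<close> on the constraint.\<close>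

lemma d_value_le:
  fixes u :: "'a::euclidean_space \<Rightarrow> complex"
  assumes s: "s > 0" and u: "u \<in> Ws_nonzero s"
  shows "2 * d_value TYPE('a) s \<omega> \<le> mass u * exp (I_functional s \<omega> u / mass u)"
proof -
  obtain v :: "'a \<Rightarrow> complex" where v: "v \<in> Ws_nonzero s" "I_functional s \<omega> v = 0"
    "mass v = mass u * exp (I_functional s \<omega> u / mass u)"
    using Nehari_rescaling[OF s u] by blast
  have "d_value TYPE('a) s \<omega> \<le> S_functional s \<omega> v"
    unfolding d_value_def by (rule cInf_lower[OF _ constraint_bdd_below]) (use v in blast)
  then show ?thesis using v by (simp add: S_functional_eq)
qed

lemma constraint_nonempty:
  assumes s: "0 < s" "s < 1"
  shows "{S_functional s \<omega> u | u :: 'a::euclidean_space \<Rightarrow> complex. u \<in> Ws_nonzero s \<and> I_functional s \<omega> u = 0} \<noteq> {}"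
  using Nehari_rescaling[OF s(1) gauss_Ws_nonzero[OF s, where 'a='a], of \<omega>] by blast

lemma minimizing_sequence_exists:
  assumes s: "0 < s" "s < 1"
  shows "\<exists>u :: nat \<Rightarrow> 'a::euclidean_space \<Rightarrow> complex. minimizing_sequence s \<omega> u"
proof -
  let ?S = "{S_functional s \<omega> u | u :: 'a \<Rightarrow> complex. u \<in> Ws_nonzero s \<and> I_functional s \<omega> u = 0}"
  let ?d = "d_value TYPE('a) s \<omega>"
  have "\<exists>u :: 'a \<Rightarrow> complex. u \<in> Ws_nonzero s \<and> I_functional s \<omega> u = 0 \<and> S_functional s \<omega> u < ?d + 1 / real (Suc n)" for n
  proof -
    have "Inf ?S < ?d + 1 / real (Suc n)" by (simp add: d_value_def)
    then show ?thesis using cInf_lessD[OF constraint_nonempty[OF s, of \<omega>, where 'a='a]] by blast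
  qed
  then obtain u :: "nat \<Rightarrow> 'a \<Rightarrow> complex" where u: "\<And>n. u n \<in> Ws_nonzero s" "\<And>n. I_functional s \<omega> (u n) = 0"
    "\<And>n. S_functional s \<omega> (u n) < ?d + 1 / real (Suc n)" by metis
  have lb: "?d \<le> S_functional s \<omega> (u n)" for n
    unfolding d_value_def by (rule cInf_lower[OF _ constraint_bdd_below]) (use u in blast)
  have "(\<lambda>n. S_functional s \<omega> (u n) - ?d) \<longlonglongrightarrow> 0"
  proof (rule real_tendsto_zero_bound)
    show "(\<lambda>n. 1 / real (Suc n)) \<longlonglongrightarrow> 0" by (rule LIMSEQ_Suc[OF lim_1_over_n])
    show "0 \<le> S_functional s \<omega> (u n) - ?d" for n using lb[of n] by simp
    show "S_functional s \<omega> (u n) - ?d \<le> 1 / real (Suc n)" for n using u(3)[of n] by linarith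
  qed
  then have "(\<lambda>n. S_functional s \<omega> (u n)) \<longlonglongrightarrow> ?d" by (rule LIM_zero_cancel)
  then show ?thesis unfolding minimizing_sequence_def using u by blast
qed

lemma entropy_le_log_tail:
  fixes u :: "'a::euclidean_space \<Rightarrow> complex"
  assumes s: "s > 0" and u: "u \<in> Ws s" and l: "l > 0"
  shows "entropy u \<le> ln (l\<^sup>2) * mass u + (LINT x|lborel. log_tail l u x)"
proof -
  have li: "integrable lborel (log_tail l u)" using log_tail_bound[OF s, where 'a='a] Ws_Hs[OF u] l by metis
  have "entropy u \<le> (LINT x|lborel. ln (l\<^sup>2) * (cmod (u x))\<^sup>2 + log_tail l u x)"
    unfolding entropy_def using li L2_integrable[OF Ws_L2[OF u]] sq_log_le_log_tail[OF l]
    by (intro integral_mono Ws_sq_log_integrable[OF s u]) auto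
  also have "\<dots> = ln (l\<^sup>2) * mass u + (LINT x|lborel. log_tail l u x)"
    using li L2_integrable[OF Ws_L2[OF u]] by (simp add: mass_def L2_norm_sq)
  finally show ?thesis .
qed

lemma log_modular_integral_eq:
  fixes u :: "'a::euclidean_space \<Rightarrow> complex"
  assumes s: "s > 0" and u: "u \<in> Ws s"
  shows "(LINT x|lborel. log_modular (cmod (u x))) = 2 * (LINT x|lborel. log_tail 1 u x) - entropy u + mass u"
proof -
  have li: "integrable lborel (log_tail 1 u)" using log_tail_bound[OF s, where 'a='a] Ws_Hs[OF u] by (metis zero_less_one)
  have pt: "log_modular (cmod (u x)) = 2 * log_tail 1 u x - sq_log (cmod (u x)) + (cmod (u x))\<^sup>2" for x
  proof (cases "1 < cmod (u x)")
    case True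
    then have "0 \<le> sq_log (cmod (u x))" by (simp add: sq_log_def)
    then show ?thesis using True by (simp add: log_modular_def log_tail_def sq_log_def)
  next
    case False
    have "sq_log (cmod (u x)) \<le> 0"
      by (cases "u x = 0") (use False in \<open>auto simp: sq_log_def power_le_one intro!: mult_nonneg_nonpos\<close>)
    then show ?thesis using False by (simp add: log_modular_def log_tail_def)
  qed
  show ?thesis unfolding pt
    using li Ws_sq_log_integrable[OF s u] L2_integrable[OF Ws_L2[OF u]] by (simp add: entropy_def mass_def L2_norm_sq)
qed

text \<open>Apply \<open>log_tail_bound\<close> at a level proportional to \<open>||u||\<close>, with the factor \<open>a\<close> chosen so that the coefficient of
  the kinetic term is one half and can be absorbed.\<close>

lemma log_Sobolev:
  fixes s :: real
  assumes s: "s > 0"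
  obtains K where "K > 0" "\<And>u :: 'a::euclidean_space \<Rightarrow> complex. u \<in> Ws_nonzero s \<Longrightarrow> entropy u \<le> ln (K * mass u) * mass u + kinetic s u / 2"
proof -
  define p where "p = 4 * s / DIM('a)"
  have p: "p > 0" using s by (simp add: p_def)
  obtain C where C: "C > 0" "\<And>(u::'a \<Rightarrow> complex) l. u \<in> Hs s \<Longrightarrow> l > 0 \<Longrightarrow>
    (LINT x|lborel. log_tail l u x) \<le> C * (L2_norm u / l) powr p * (L2_norm (frac_symbol s u))\<^sup>2"
    using log_tail_bound[OF s, where 'a='a] unfolding p_def by metis
  define a where "a = (2 * C) powr (1 / p)"
  have a: "a > 0" using C(1) by (simp add: a_def)
  have ap: "C * (1 / a) powr p = 1 / 2"
    using C(1) p a by (simp add: powr_divide a_def powr_powr)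
  have "entropy u \<le> ln (a\<^sup>2 * mass u) * mass u + kinetic s u / 2" if u: "u \<in> Ws_nonzero s" for u :: "'a \<Rightarrow> complex"
  proof -
    have uW: "u \<in> Ws s" and m: "mass u > 0" using u mass_pos_iff[OF Ws_L2] by (auto simp: Ws_nonzero_def)
    then have n: "L2_norm u > 0" using L2_norm_nonneg[of u] by (auto simp: mass_def less_le)
    have "entropy u \<le> ln ((a * L2_norm u)\<^sup>2) * mass u + (LINT x|lborel. log_tail (a * L2_norm u) u x)"
      using a n by (intro entropy_le_log_tail[OF s uW]) simp
    also have "(LINT x|lborel. log_tail (a * L2_norm u) u x) \<le> C * (L2_norm u / (a * L2_norm u)) powr p * kinetic s u"
      unfolding kinetic_def using a n by (intro C(2) Ws_Hs uW) simp
    also have "L2_norm u / (a * L2_norm u) = 1 / a" using n by simp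
    also have "C * (1 / a) powr p * kinetic s u = kinetic s u / 2" unfolding ap by simp
    finally show ?thesis by (simp add: mass_def power_mult_distrib)
  qed
  then show ?thesis using that[of "a\<^sup>2"] a by simp
qed

text \<open>On the constraint the entropy equals \<open>k(u) + \<omega> m(u)\<close>, and \<open>log_Sobolev\<close> absorbs half of the kinetic term.
  The remaining half is nonnegative, which bounds the mass from below.\<close>

lemma constraint_bounds:
  fixes s \<omega> :: real
  assumes s: "s > 0"
  obtains K where "K > 0"
    "\<And>u :: 'a::euclidean_space \<Rightarrow> complex. u \<in> Ws_nonzero s \<Longrightarrow> I_functional s \<omega> u = 0 \<Longrightarrow> exp \<omega> / K \<le> mass u"
    "\<And>u :: 'a \<Rightarrow> complex. u \<in> Ws_nonzero s \<Longrightarrow> I_functional s \<omega> u = 0 \<Longrightarrow> kinetic s u \<le> 2 * mass u * (ln (K * mass u) - \<omega>)"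
proof -
  obtain K where K: "K > 0" "\<And>u :: 'a \<Rightarrow> complex. u \<in> Ws_nonzero s \<Longrightarrow> entropy u \<le> ln (K * mass u) * mass u + kinetic s u / 2"
    using log_Sobolev[OF s, where 'a='a] by metis
  have k: "kinetic s u \<le> 2 * mass u * (ln (K * mass u) - \<omega>)" if u: "u \<in> Ws_nonzero s" "I_functional s \<omega> u = 0" for u :: "'a \<Rightarrow> complex"
  proof -
    have "u \<in> Hs s" using u by (simp add: Ws_nonzero_def Ws_def)
    then have "kinetic s u + \<omega> * mass u = entropy u" using I_functional_eq[of u s \<omega>] u(2) by simp
    then show ?thesis using K(2)[OF u(1)] by (simp add: algebra_simps)
  qed
  have "exp \<omega> / K \<le> mass u" if u: "u \<in> Ws_nonzero s" "I_functional s \<omega> u = 0" for u :: "'a \<Rightarrow> complex"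
  proof -
    have m: "mass u > 0" using u mass_pos_iff[OF Ws_L2] by (auto simp: Ws_nonzero_def)
    have "0 \<le> 2 * mass u * (ln (K * mass u) - \<omega>)" using k[OF u] kinetic_nonneg[of s u] by linarith
    then have "\<omega> \<le> ln (K * mass u)" using m by (simp add: zero_le_mult_iff)
    then have "exp \<omega> \<le> K * mass u" using m K(1) by (simp add: ln_ge_iff)
    then show ?thesis using K(1) by (simp add: field_simps)
  qed
  then show ?thesis using that[OF K(1)] k by blast
qed

section \<open>Minimizing sequences do not vanish\<close>

lemma log_tail_split:
  assumes l: "0 < l" "l \<le> 1"
  shows "log_tail l u x \<le> ln (1 / l\<^sup>2) * tail l u x + log_tail 1 u x"
proof (cases "l < cmod (u x)")
  case True
  then have c: "cmod (u x) > 0" using l by linarith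
  have ln: "ln ((cmod (u x))\<^sup>2 / l\<^sup>2) = ln (1 / l\<^sup>2) + ln ((cmod (u x))\<^sup>2)" using c l by (simp add: ln_div)
  have "(cmod (u x))\<^sup>2 * ln ((cmod (u x))\<^sup>2) \<le> log_tail 1 u x"
  proof (cases "1 < cmod (u x)")
    case False
    then have "(cmod (u x))\<^sup>2 \<le> 1" by (simp add: power_le_one)
    then show ?thesis using False c by (auto simp: log_tail_def intro!: mult_nonneg_nonpos)
  qed (simp add: log_tail_def)
  then show ?thesis using True by (simp add: log_tail_def[of l] tail_def ln algebra_simps)
next
  case False
  have "0 \<le> log_tail 1 u x" by (rule log_tail_nonneg) simp
  then show ?thesis using False by (simp add: log_tail_def[of l] tail_def)
qed

text \<open>If the low-frequency part stays below \<open>l / 2\<close>, then \<open>tail_le_lowpass\<close> makes the mass above level \<open>l\<close> negligible and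
  the entropy is at most \<open>ln l\<^sup>2 m(u)\<close> plus a constant. With \<open>l = e\<^bsup>-Q\<^esup>\<close> this is at most \<open>- 2 Q \<delta>\<close> plus a constant, which
  for large \<open>Q\<close> is below the lower bound \<open>\<omega> m(u)\<close> that the constraint imposes.\<close>

lemma lowpass_nonvanishing:
  fixes s \<omega> :: real
  assumes s: "s > 0" and \<delta>: "\<delta> > 0"
  obtains R c where "R > 0" "c > 0"
    "\<And>u :: 'a::euclidean_space \<Rightarrow> complex. u \<in> Ws s \<Longrightarrow> I_functional s \<omega> u = 0 \<Longrightarrow> \<delta> \<le> mass u \<Longrightarrow> L2_norm u \<le> M \<Longrightarrow> L2_norm (frac_symbol s u) \<le> M
      \<Longrightarrow> \<exists>x. c < cmod (lowpass R u x)"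
proof -
  define p where "p = 4 * s / DIM('a)"
  have p: "p > 0" using s by (simp add: p_def)
  obtain C where C: "C > 0" "\<And>(u::'a \<Rightarrow> complex) l. u \<in> Hs s \<Longrightarrow> l > 0 \<Longrightarrow>
    (LINT x|lborel. log_tail l u x) \<le> C * (L2_norm u / l) powr p * (L2_norm (frac_symbol s u))\<^sup>2"
    using log_tail_bound[OF s, where 'a='a] unfolding p_def by metis
  have lti: "integrable lborel (log_tail l u)" if "u \<in> Hs s" "l > 0" for u :: "'a \<Rightarrow> complex" and l
    using log_tail_bound[OF s, where 'a='a] that by metis
  define M1 where "M1 = max M 0"
  define K0 where "K0 = C * M1 powr p * M1\<^sup>2 + \<bar>\<omega>\<bar> * M1\<^sup>2"
  have K0: "K0 \<ge> 0" using C(1) by (simp add: K0_def)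
  define Q where "Q = (K0 + 2) / (2 * \<delta>)"
  have Q: "Q > 0" using K0 \<delta> by (simp add: Q_def)
  define l where "l = exp (- Q)"
  have l: "0 < l" "l \<le> 1" using Q by (auto simp: l_def)
  have lnl: "ln (l\<^sup>2) = - 2 * Q" "ln (1 / l\<^sup>2) = 2 * Q" by (auto simp: l_def ln_realpow ln_div)
  \<comment> \<open>the value of \<open>R\<^bsup>-2s\<^esup>\<close> for which the mass above level \<open>l\<close>, times \<open>ln (1 / l\<^sup>2) = 2 Q\<close>, is at most one\<close>
  define b where "b = 1 / (8 * Q * (M1\<^sup>2 + 1))"
  have b: "b > 0" using Q by (simp add: b_def add_nonneg_pos)
  define R where "R = b powr (- (1 / (2 * s)))"
  have R: "R > 0" using b by (simp add: R_def)
  have Rb: "R powr (- (2 * s)) = b" using s b by (simp add: R_def powr_powr)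
  have "\<exists>x. l / 2 < cmod (lowpass R u x)"
    if u: "u \<in> Ws s" and I: "I_functional s \<omega> u = 0" and m: "\<delta> \<le> mass u" "L2_norm u \<le> M" and E: "L2_norm (frac_symbol s u) \<le> M" for u :: "'a \<Rightarrow> complex"
  proof (rule ccontr)
    assume "\<not> (\<exists>x. l / 2 < cmod (lowpass R u x))"
    then have small: "cmod (lowpass R u x) \<le> l / 2" for x by (simp add: not_less)
    have uH: "u \<in> Hs s" using u by (rule Ws_Hs)
    have M1: "L2_norm u \<le> M1" "L2_norm (frac_symbol s u) \<le> M1" using m E by (auto simp: M1_def)
    have E2: "(L2_norm (frac_symbol s u))\<^sup>2 \<le> M1\<^sup>2" and m2: "mass u \<le> M1\<^sup>2"
      unfolding mass_def using M1 by (auto intro: power_mono)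
    have "(LINT x|lborel. tail l u x) \<le> 4 * b * (L2_norm (frac_symbol s u))\<^sup>2"
      using tail_le_lowpass[OF uH R less_imp_le[OF s] small] unfolding Rb .
    also have "\<dots> \<le> 4 * b * (M1\<^sup>2 + 1)" using E2 b by (intro mult_left_mono) auto
    also have "\<dots> = 1 / (2 * Q)"
    proof -
      have "4 * (1 / (8 * Q * X)) * X = 1 / (2 * Q)" if "X > 0" for X using Q that by (simp add: field_simps)
      moreover have "0 < M1\<^sup>2 + 1" by (simp add: add_nonneg_pos)
      ultimately show ?thesis unfolding b_def by blast
    qed
    finally have T: "2 * Q * (LINT x|lborel. tail l u x) \<le> 1" using Q by (simp add: field_simps)
    have "(LINT x|lborel. log_tail 1 u x) \<le> C * (L2_norm u / 1) powr p * (L2_norm (frac_symbol s u))\<^sup>2"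
      by (rule C(2)[OF uH]) simp
    also have "\<dots> \<le> C * M1 powr p * M1\<^sup>2"
      using M1 E2 C(1) p by (intro mult_mono powr_mono2) auto
    finally have L1: "(LINT x|lborel. log_tail 1 u x) \<le> C * M1 powr p * M1\<^sup>2" .
    have "(LINT x|lborel. log_tail l u x) \<le> (LINT x|lborel. ln (1 / l\<^sup>2) * tail l u x + log_tail 1 u x)"
      using lti[OF uH] l tail_integrable[OF Ws_L2[OF u]] log_tail_split[OF l] by (intro integral_mono) auto
    also have "\<dots> = 2 * Q * (LINT x|lborel. tail l u x) + (LINT x|lborel. log_tail 1 u x)"
      using lti[OF uH] tail_integrable[OF Ws_L2[OF u]] lnl by simp
    finally have L: "(LINT x|lborel. log_tail l u x) \<le> 1 + C * M1 powr p * M1\<^sup>2" using T L1 by linarith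
    have "kinetic s u + \<omega> * mass u = entropy u" using I_functional_eq[OF uH, of \<omega>] I by simp
    then have "\<omega> * mass u \<le> entropy u" using kinetic_nonneg[of s u] by linarith
    moreover have "\<bar>\<omega> * mass u\<bar> \<le> \<bar>\<omega>\<bar> * M1\<^sup>2" using m2 by (simp add: abs_mult mult_left_mono)
    moreover have "entropy u \<le> - 2 * Q * mass u + (LINT x|lborel. log_tail l u x)"
      using entropy_le_log_tail[OF s u l(1)] unfolding lnl .
    moreover have "2 * Q * \<delta> \<le> 2 * Q * mass u" using m Q by (intro mult_left_mono) auto
    moreover have "2 * Q * \<delta> = K0 + 2" using \<delta> by (simp add: Q_def)
    ultimately show False using L unfolding K0_def by linarith
  qed
  then show ?thesis using that[OF R, of "l / 2"] l by simp
qed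

section \<open>Convergence of minimizing sequences\<close>

lemma mass_times_exp_limit:
  fixes m i :: "nat \<Rightarrow> real"
  assumes le: "eventually (\<lambda>n. D \<le> m n * exp (i n / m n)) sequentially"
    and m: "m \<longlonglongrightarrow> m0" and i: "i \<longlonglongrightarrow> i0" and m0: "m0 > 0"
  shows "D \<le> m0 * exp (i0 / m0)"
proof (rule tendsto_lowerbound[OF _ le])
  show "(\<lambda>n. m n * exp (i n / m n)) \<longlonglongrightarrow> m0 * exp (i0 / m0)"
    using m0 by (intro tendsto_intros m i) auto
qed simp

text \<open>The sequence is assumed to be translated already, so that its low-frequency parts do not vanish at the
  origin. The hypothesis on the masses replaces the one on the action, which is half the mass on the
  constraint.\<close>

lemma centred_minimizing_sequence_compact:
  fixes v :: "nat \<Rightarrow> 'a::euclidean_space \<Rightarrow> complex"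
  assumes s: "0 < s" "s < 1"
    and v: "\<And>n. v n \<in> Ws s" "\<And>n. I_functional s \<omega> (v n) = 0"
    and mlim: "(\<lambda>n. mass (v n)) \<longlonglongrightarrow> 2 * d_value TYPE('a) s \<omega>"
    and M: "\<And>n. L2_norm (v n) \<le> M" "\<And>n. L2_norm (frac_symbol s (v n)) \<le> M"
    and nv: "c > 0" "\<And>n. c < cmod (lowpass R (v n) 0)"
  obtains r \<phi> where "strict_mono (r :: nat \<Rightarrow> nat)" "\<phi> \<in> ground_states s \<omega>" "\<phi> \<in> Ws s"
    "(\<lambda>n. Ws_norm s (\<lambda>x. v (r n) x - \<phi> x)) \<longlonglongrightarrow> 0"
proof -
  let ?d = "d_value TYPE('a) s \<omega>"
  have vH: "v n \<in> Hs s" and v2: "v n \<in> L2" and vs: "frac_symbol s (v n) \<in> L2" for n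
    using v(1) by (auto simp: Ws_def Hs_iff)
  define p where "p = 4 * s / DIM('a)"
  have p: "p > 0" using s by (simp add: p_def)
  obtain C where C: "C > 0" "\<And>(u::'a \<Rightarrow> complex) l. u \<in> Hs s \<Longrightarrow> l > 0 \<Longrightarrow>
    (LINT x|lborel. log_tail l u x) \<le> C * (L2_norm u / l) powr p * (L2_norm (frac_symbol s u))\<^sup>2"
    using log_tail_bound[OF s(1), where 'a='a] unfolding p_def by metis
  have C1: "(LINT x|lborel. log_tail 1 u x) \<le> C * L2_norm u powr p * kinetic s u" if "u \<in> Hs s" for u :: "'a \<Rightarrow> complex"
    using C(2)[OF that, of 1] by (simp add: kinetic_def)
  have lt0: "0 \<le> (LINT x|lborel. log_tail 1 u x)" for u :: "'a \<Rightarrow> complex"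
    by (rule Bochner_Integration.integral_nonneg) (rule log_tail_nonneg, simp)

  obtain r \<phi> where r: "strict_mono (r :: nat \<Rightarrow> nat)" and \<phi>H: "\<phi> \<in> Hs s"
    and ae: "AE x in lborel. (\<lambda>n. v (r n) x) \<longlonglongrightarrow> \<phi> x"
    and weak: "\<forall>g\<in>L2. (\<lambda>n. L2_inner (v (r n)) g) \<longlonglongrightarrow> L2_inner \<phi> g"
    and Fweak: "\<forall>g\<in>L2. (\<lambda>n. L2_inner (fourier (v (r n))) g) \<longlonglongrightarrow> L2_inner (fourier \<phi>) g"
    and sweak: "\<forall>g\<in>L2. (\<lambda>n. L2_inner (frac_symbol s (v (r n))) g) \<longlonglongrightarrow> L2_inner (frac_symbol s \<phi>) g"
    by (rule Hs_local_compactness[of s v M, OF s(1) vH M])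
  have \<phi>2: "\<phi> \<in> L2" and \<phi>s: "frac_symbol s \<phi> \<in> L2" using \<phi>H by (auto simp: Hs_iff)
  have \<phi>m [measurable]: "\<phi> \<in> borel_measurable borel" using \<phi>2 by measurable
  have vm [measurable]: "\<And>n. v n \<in> borel_measurable borel" using v2 by (rule L2_measurable)

  \<comment> \<open>the value of the low-frequency part at the origin passes to the weak limit\<close>
  have "mass \<phi> > 0"
  proof -
    have "(\<lambda>n. lowpass R (v (r n)) 0) \<longlonglongrightarrow> lowpass R \<phi> 0"
      unfolding lowpass_def by (intro tendsto_mult tendsto_const Fweak[rule_format] freq_kernel_L2)
    then have "c \<le> cmod (lowpass R \<phi> 0)"
      by (intro LIMSEQ_le_const[OF tendsto_norm]) (use nv(2) in \<open>auto intro: less_imp_le\<close>)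
    also have "\<dots> \<le> (fourier_const TYPE('a) * cball_L2 TYPE('a) R) * L2_norm \<phi>" by (rule lowpass_bound[OF \<phi>2])
    finally have "L2_norm \<phi> \<noteq> 0" using nv(1) by auto
    then show ?thesis by (simp add: mass_def)
  qed

  define B where "B = 2 * (C * M powr p * M\<^sup>2) + \<bar>\<omega>\<bar> * M\<^sup>2 + M\<^sup>2"
  have vB: "(LINT x|lborel. log_modular (cmod (v n x))) \<le> B" for n
  proof -
    have mM: "mass (v n) \<le> M\<^sup>2" and kM: "kinetic s (v n) \<le> M\<^sup>2"
      unfolding mass_def kinetic_def using M by (auto intro: power_mono)
    have "C * L2_norm (v n) powr p * kinetic s (v n) \<le> C * M powr p * M\<^sup>2"
      using C(1) p M(1) kM by (intro mult_mono powr_mono2) auto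
    then have "(LINT x|lborel. log_tail 1 (v n) x) \<le> C * M powr p * M\<^sup>2" using C1[OF vH[of n]] by linarith
    moreover have "kinetic s (v n) + \<omega> * mass (v n) = entropy (v n)"
      using I_functional_eq[OF vH[of n], of \<omega>] v(2)[of n] by simp
    moreover have "\<bar>\<omega> * mass (v n)\<bar> \<le> \<bar>\<omega>\<bar> * M\<^sup>2" using mM by (simp add: abs_mult mult_left_mono)
    moreover note kinetic_nonneg[of s "v n"] mM
    ultimately show ?thesis
      unfolding log_modular_integral_eq[OF s(1) v(1)] B_def by linarith
  qed
  have vi: "integrable lborel (\<lambda>x. log_modular (cmod (v n x)))" for n using Ws_iff[OF s(1)] v(1) by blast
  have \<phi>i: "integrable lborel (\<lambda>x. log_modular (cmod (\<phi> x)))"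
  proof (rule integral_Fatou(1)[where f="\<lambda>n x. log_modular (cmod (v (r n) x))" and B=B])
    show "AE x in lborel. (\<lambda>n. log_modular (cmod (v (r n) x))) \<longlonglongrightarrow> log_modular (cmod (\<phi> x))"
      using ae by eventually_elim (intro isCont_tendsto_compose[OF log_modular_isCont] tendsto_norm)
  qed (use vi vB in auto)
  have \<phi>W: "\<phi> \<in> Ws s" using \<phi>H \<phi>i Ws_iff[OF s(1)] by blast

  define w where "w n = (\<lambda>x. v (r n) x - \<phi> x)" for n
  have wW: "w n \<in> Ws s" for n unfolding w_def by (rule Ws_diff[OF s(1) v(1) \<phi>W])
  have wH: "w n \<in> Hs s" for n using wW by (rule Ws_Hs)
  have mr: "(\<lambda>n. mass (v (r n))) \<longlonglongrightarrow> 2 * ?d"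
    using LIMSEQ_subseq_LIMSEQ[OF mlim r] by (simp add: o_def)
  have "(\<lambda>n. mass (w n) - mass (v (r n))) \<longlonglongrightarrow> - mass \<phi>"
    unfolding mass_def w_def by (rule L2_norm_diff_weak[OF v2 \<phi>2 weak[rule_format, OF \<phi>2]])
  from tendsto_add[OF this mr] have mw: "(\<lambda>n. mass (w n)) \<longlonglongrightarrow> 2 * ?d - mass \<phi>" by simp
  have kw: "(\<lambda>n. kinetic s (w n) - kinetic s (v (r n))) \<longlonglongrightarrow> - kinetic s \<phi>"
    unfolding kinetic_def w_def Hs_diff(2)[OF vH \<phi>H] by (rule L2_norm_diff_weak[OF vs \<phi>s sweak[rule_format, OF \<phi>s]])
  have ew: "(\<lambda>n. entropy (v (r n)) - entropy (w n)) \<longlonglongrightarrow> entropy \<phi>"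
    unfolding entropy_def w_def by (rule Brezis_Lieb_sq_log[OF vm \<phi>m vi \<phi>i vB ae])
  have Iw: "(\<lambda>n. I_functional s \<omega> (w n)) \<longlonglongrightarrow> - I_functional s \<omega> \<phi>"
  proof -
    have "(\<lambda>n. (kinetic s (w n) - kinetic s (v (r n))) + \<omega> * (mass (w n) - mass (v (r n))) + (entropy (v (r n)) - entropy (w n)))
      \<longlonglongrightarrow> - kinetic s \<phi> + \<omega> * (- mass \<phi>) + entropy \<phi>"
      by (intro tendsto_add tendsto_mult tendsto_const kw ew \<open>(\<lambda>n. mass (w n) - mass (v (r n))) \<longlonglongrightarrow> - mass \<phi>\<close>)
    moreover have "(kinetic s (w n) - kinetic s (v (r n))) + \<omega> * (mass (w n) - mass (v (r n))) + (entropy (v (r n)) - entropy (w n))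
      = I_functional s \<omega> (w n)" for n
      using v(2)[of "r n"] unfolding I_functional_eq[OF vH] I_functional_eq[OF wH] by (simp add: algebra_simps)
    ultimately show ?thesis unfolding I_functional_eq[OF \<phi>H] by (simp add: algebra_simps)
  qed

  \<comment> \<open>the inequality of \<open>d_value_le\<close>, for \<open>\<phi>\<close> and for the remainders, determines the mass of \<open>\<phi>\<close>\<close>
  have \<phi>N: "\<phi> \<in> Ws_nonzero s" using \<phi>W \<open>mass \<phi> > 0\<close> mass_pos_iff[OF \<phi>2] by (simp add: Ws_nonzero_def)
  have m_le: "mass \<phi> \<le> 2 * ?d" using LIMSEQ_le_const[OF mw, of 0] by simp
  have I_nonneg: "0 \<le> I_functional s \<omega> \<phi>"
  proof (rule ccontr)
    assume "\<not> 0 \<le> I_functional s \<omega> \<phi>"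
    then have "exp (I_functional s \<omega> \<phi> / mass \<phi>) < 1" using \<open>mass \<phi> > 0\<close> by (simp add: divide_neg_pos)
    then have "mass \<phi> * exp (I_functional s \<omega> \<phi> / mass \<phi>) < mass \<phi> * 1"
      using \<open>mass \<phi> > 0\<close> by (intro mult_strict_left_mono) auto
    then show False using d_value_le[OF s(1) \<phi>N, of \<omega>] m_le by linarith
  qed
  have m_eq: "mass \<phi> = 2 * ?d"
  proof (rule ccontr)
    assume "mass \<phi> \<noteq> 2 * ?d"
    then have pos: "2 * ?d - mass \<phi> > 0" using m_le by simp
    have "eventually (\<lambda>n. 2 * ?d \<le> mass (w n) * exp (I_functional s \<omega> (w n) / mass (w n))) sequentially"
      using order_tendstoD(1)[OF mw pos]
    proof eventually_elim
      case (elim n)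
      then have "w n \<in> Ws_nonzero s" using wW mass_pos_iff[OF Ws_L2[OF wW]] by (simp add: Ws_nonzero_def)
      then show ?case by (rule d_value_le[OF s(1)])
    qed
    from mass_times_exp_limit[OF this mw Iw pos]
    have "2 * ?d \<le> (2 * ?d - mass \<phi>) * exp (- I_functional s \<omega> \<phi> / (2 * ?d - mass \<phi>))" .
    also have "\<dots> \<le> (2 * ?d - mass \<phi>) * 1"
      using pos I_nonneg by (intro mult_left_mono) auto
    finally show False using \<open>mass \<phi> > 0\<close> by simp
  qed
  have mw0: "(\<lambda>n. mass (w n)) \<longlonglongrightarrow> 0" using mw m_eq by simp
  have Lw0: "(\<lambda>n. L2_norm (w n)) \<longlonglongrightarrow> 0"
    using tendsto_real_sqrt[OF mw0] by (simp add: mass_def)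
  have kwM: "kinetic s (w n) \<le> (M + L2_norm (frac_symbol s \<phi>))\<^sup>2" for n
  proof -
    have "L2_dist (frac_symbol s (v (r n))) (frac_symbol s \<phi>) \<le> M + L2_norm (frac_symbol s \<phi>)"
      using L2_norm_triangle[OF vs L2_scale(1)[OF \<phi>s, of "-1"], of "r n"] L2_scale(2)[OF \<phi>s, of "-1"] M(2)[of "r n"] by simp
    then show ?thesis unfolding kinetic_def w_def Hs_diff(2)[OF vH \<phi>H] by (intro power_mono) auto
  qed
  have ltw: "(\<lambda>n. LINT x|lborel. log_tail 1 (w n) x) \<longlonglongrightarrow> 0"
  proof (rule real_tendsto_zero_bound)
    have "(\<lambda>n. L2_norm (w n) powr p) \<longlonglongrightarrow> 0 powr p"
      using p by (intro tendsto_powr' Lw0 tendsto_const) auto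
    then have "(\<lambda>n. C * L2_norm (w n) powr p * (M + L2_norm (frac_symbol s \<phi>))\<^sup>2) \<longlonglongrightarrow> C * 0 powr p * (M + L2_norm (frac_symbol s \<phi>))\<^sup>2"
      by (intro tendsto_mult tendsto_const)
    then show "(\<lambda>n. C * L2_norm (w n) powr p * (M + L2_norm (frac_symbol s \<phi>))\<^sup>2) \<longlonglongrightarrow> 0" by simp
    show "(LINT x|lborel. log_tail 1 (w n) x) \<le> C * L2_norm (w n) powr p * (M + L2_norm (frac_symbol s \<phi>))\<^sup>2" for n
    proof -
      have "C * L2_norm (w n) powr p * kinetic s (w n) \<le> C * L2_norm (w n) powr p * (M + L2_norm (frac_symbol s \<phi>))\<^sup>2"
        using C(1) by (intro mult_left_mono kwM) simp
      then show ?thesis using C1[OF wH[of n]] by linarith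
    qed
  qed (rule lt0)
  \<comment> \<open>vanishing of the positive parts of the entropies, now that the masses vanish, bounds the limit of \<open>I(w)\<close> from below\<close>
  have ent_le: "entropy (w n) \<le> (LINT x|lborel. log_tail 1 (w n) x)" for n
    using entropy_le_log_tail[OF s(1) wW, of 1 n] by simp
  have low: "\<omega> * mass (w n) - (LINT x|lborel. log_tail 1 (w n) x) \<le> I_functional s \<omega> (w n)" for n
    unfolding I_functional_eq[OF wH] using ent_le[of n] kinetic_nonneg[of s "w n"] by linarith
  have "0 \<le> - I_functional s \<omega> \<phi>"
  proof (rule LIMSEQ_le[OF _ Iw])
    show "(\<lambda>n. \<omega> * mass (w n) - (LINT x|lborel. log_tail 1 (w n) x)) \<longlonglongrightarrow> 0"
      using tendsto_diff[OF tendsto_mult[OF tendsto_const[of \<omega>] mw0] ltw] by simp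
  qed (use low in auto)
  then have I0: "I_functional s \<omega> \<phi> = 0" using I_nonneg by linarith
  have Iw0: "(\<lambda>n. I_functional s \<omega> (w n)) \<longlonglongrightarrow> 0" using Iw I0 by simp
  have kw0: "(\<lambda>n. kinetic s (w n)) \<longlonglongrightarrow> 0"
  proof (rule real_tendsto_zero_bound)
    show "(\<lambda>n. I_functional s \<omega> (w n) - \<omega> * mass (w n) + (LINT x|lborel. log_tail 1 (w n) x)) \<longlonglongrightarrow> 0"
      using tendsto_add[OF tendsto_diff[OF Iw0 tendsto_mult[OF tendsto_const[of \<omega>] mw0]] ltw] by simp
    show "kinetic s (w n) \<le> I_functional s \<omega> (w n) - \<omega> * mass (w n) + (LINT x|lborel. log_tail 1 (w n) x)" for n
      unfolding I_functional_eq[OF wH] using ent_le[of n] by linarith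
  qed simp
  have ew0: "(\<lambda>n. entropy (w n)) \<longlonglongrightarrow> 0"
  proof -
    have "entropy (w n) = kinetic s (w n) + \<omega> * mass (w n) - I_functional s \<omega> (w n)" for n
      unfolding I_functional_eq[OF wH] by simp
    then show ?thesis using tendsto_diff[OF tendsto_add[OF kw0 tendsto_mult[OF tendsto_const[of \<omega>] mw0]] Iw0] by simp
  qed
  have "(\<lambda>n. LINT x|lborel. log_modular (cmod (w n x))) \<longlonglongrightarrow> 0"
    unfolding log_modular_integral_eq[OF s(1) wW]
    using tendsto_add[OF tendsto_diff[OF tendsto_mult[OF tendsto_const[of 2] ltw] ew0] mw0] by simp
  then have LA0: "(\<lambda>n. LA_norm (w n)) \<longlonglongrightarrow> 0"
    using Ws_iff[OF s(1)] wW by (intro LA_norm_tendsto_zero L2_measurable[OF Ws_L2[OF wW]]) auto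
  have "Hs_norm s (w n) = sqrt (mass (w n) + kinetic s (w n))" for n
    by (simp add: Hs_norm_def mass_def kinetic_def frac_laplacian_norm(2)[OF wH])
  then have "(\<lambda>n. Hs_norm s (w n)) \<longlonglongrightarrow> 0"
    using tendsto_real_sqrt[OF tendsto_add[OF mw0 kw0]] by simp
  from tendsto_add[OF this LA0] have "(\<lambda>n. Ws_norm s (w n)) \<longlonglongrightarrow> 0" by (simp add: Ws_norm_def)
  moreover have "\<phi> \<in> ground_states s \<omega>"
    using \<phi>N I0 m_eq by (simp add: ground_states_def S_functional_eq)
  ultimately show ?thesis using that[OF r _ \<phi>W] unfolding w_def by blast
qed

text \<open>Minimizing sequences are bounded by \<open>constraint_bounds\<close>; \<open>lowpass_nonvanishing\<close> provides the translations.\<close>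

theorem minimizing_sequence_compact:
  fixes u :: "nat \<Rightarrow> 'a::euclidean_space \<Rightarrow> complex"
  assumes s: "0 < s" "s < 1" and u: "minimizing_sequence s \<omega> u"
  obtains y :: "nat \<Rightarrow> 'a" and r :: "nat \<Rightarrow> nat" and \<phi> where "strict_mono r"
    "Ws_converges s (\<lambda>k x. u (r k) (x - y (r k))) \<phi>" "\<phi> \<in> ground_states s \<omega>"
proof -
  let ?d = "d_value TYPE('a) s \<omega>"
  have uN: "u n \<in> Ws_nonzero s" and uI: "I_functional s \<omega> (u n) = 0" for n
    using u by (auto simp: minimizing_sequence_def)
  have uS: "(\<lambda>n. S_functional s \<omega> (u n)) \<longlonglongrightarrow> ?d"
    using u by (simp add: minimizing_sequence_def)
  have uW: "u n \<in> Ws s" for n using uN by (simp add: Ws_nonzero_def)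
  have mlim: "(\<lambda>n. mass (u n)) \<longlonglongrightarrow> 2 * ?d"
    using tendsto_mult[OF tendsto_const[of 2] uS] by (simp add: S_functional_eq uI)
  obtain M1 where M1: "\<And>n. mass (u n) \<le> M1"
  proof -
    obtain K where "\<And>n. norm (mass (u n)) \<le> K"
      using Bseq_eq_bounded convergent_imp_Bseq[OF convergentI[OF mlim]] unfolding Bseq_def by blast
    then show ?thesis using that[of K] by simp
  qed
  obtain K where K: "K > 0"
    "\<And>u :: 'a \<Rightarrow> complex. u \<in> Ws_nonzero s \<Longrightarrow> I_functional s \<omega> u = 0 \<Longrightarrow> exp \<omega> / K \<le> mass u"
    "\<And>u :: 'a \<Rightarrow> complex. u \<in> Ws_nonzero s \<Longrightarrow> I_functional s \<omega> u = 0 \<Longrightarrow> kinetic s u \<le> 2 * mass u * (ln (K * mass u) - \<omega>)"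
    using constraint_bounds[OF s(1), where 'a='a] by metis
  define \<delta> where "\<delta> = exp \<omega> / K"
  have \<delta>: "\<delta> > 0" using K(1) by (simp add: \<delta>_def)
  have m\<delta>: "\<delta> \<le> mass (u n)" for n unfolding \<delta>_def by (rule K(2)[OF uN uI])
  have mpos: "mass (u n) > 0" for n using m\<delta>[of n] \<delta> by linarith
  define M2 where "M2 = 2 * M1 * (ln (K * M1) - \<omega>)"
  have kM: "kinetic s (u n) \<le> M2" for n
  proof -
    have lnle: "ln (K * mass (u n)) \<le> ln (K * M1)" 
      using M1[of n] K(1) mpos[of n] by (intro ln_mono mult_left_mono mult_pos_pos) auto
    have "exp \<omega> \<le> K * mass (u n)" using m\<delta>[of n] K(1) by (simp add: \<delta>_def field_simps)
    then have "\<omega> \<le> ln (K * mass (u n))" using K(1) mpos[of n] by (simp add: ln_ge_iff)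
    then have "2 * mass (u n) * (ln (K * mass (u n)) - \<omega>) \<le> M2"
      unfolding M2_def using M1[of n] mpos[of n] lnle by (intro mult_mono) auto
    then show ?thesis using K(3)[OF uN uI, of n] by linarith
  qed
  define M where "M = max (sqrt M1) (sqrt M2)"
  have M: "L2_norm (u n) \<le> M" "L2_norm (frac_symbol s (u n)) \<le> M" for n
    using real_sqrt_le_mono[OF M1[of n]] real_sqrt_le_mono[OF kM[of n]] by (auto simp: M_def mass_def kinetic_def)
  obtain R c where Rc: "R > 0" "c > 0"
    "\<And>u :: 'a \<Rightarrow> complex. u \<in> Ws s \<Longrightarrow> I_functional s \<omega> u = 0 \<Longrightarrow> \<delta> \<le> mass u \<Longrightarrow> L2_norm u \<le> M \<Longrightarrow> L2_norm (frac_symbol s u) \<le> M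
      \<Longrightarrow> \<exists>x. c < cmod (lowpass R u x)"
    using lowpass_nonvanishing[OF s(1) \<delta>, where M=M and \<omega>=\<omega> and 'a='a] by metis
  have "\<exists>x. c < cmod (lowpass R (u n) x)" for n by (rule Rc(3)[OF uW uI m\<delta> M])
  then obtain z where z: "\<And>n. c < cmod (lowpass R (u n) (z n))" by metis
  define y where "y n = - z n" for n
  define v where "v n = (\<lambda>x. u n (x - y n))" for n
  have vW: "v n \<in> Ws s" and vI: "I_functional s \<omega> (v n) = 0" and vm: "mass (v n) = mass (u n)" and vk: "kinetic s (v n) = kinetic s (u n)" for n
    using Ws_translate(1-4)[OF s(1) uW[of n], where y="y n"] Ws_translate(5)[OF s(1) uW[of n], where y="y n" and \<omega>=\<omega>] uI[of n] by (auto simp: v_def)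
  have vM: "L2_norm (v n) \<le> M" "L2_norm (frac_symbol s (v n)) \<le> M" for n
    using M[of n] vm[of n] vk[of n] by (simp_all add: mass_def kinetic_def)
  have vz: "c < cmod (lowpass R (v n) 0)" for n
    using z[of n] lowpass_translate[OF Ws_L2[OF uW[of n]], where R=R and y="y n" and x=0] by (simp add: v_def y_def)
  obtain r \<phi> where r: "strict_mono (r :: nat \<Rightarrow> nat)" "\<phi> \<in> ground_states s \<omega>" "\<phi> \<in> Ws s"
    "(\<lambda>n. Ws_norm s (\<lambda>x. v (r n) x - \<phi> x)) \<longlonglongrightarrow> 0"
    using centred_minimizing_sequence_compact[of s v \<omega> M c R, OF s vW vI _ vM Rc(2) vz] mlim vm by auto
  have "Ws_converges s (\<lambda>k x. u (r k) (x - y (r k))) \<phi>"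
    using r(3,4) vW unfolding Ws_converges_def v_def by blast
  then show ?thesis using that[OF r(1) _ r(2)] by blast
qed

theorem theorem1p2:
  fixes s \<omega> :: real
  assumes "CARD('n::finite) \<ge> 2" and "0 < s" and "s < 1"
  shows "(\<forall>u :: nat \<Rightarrow> real ^ 'n \<Rightarrow> complex. minimizing_sequence s \<omega> u \<longrightarrow>
            (\<exists>(y :: nat \<Rightarrow> real ^ 'n) (r :: nat \<Rightarrow> nat) \<phi>. strict_mono r \<and>
               Ws_converges s (\<lambda>k x. u (r k) (x - y (r k))) \<phi>))
         \<and> (ground_states s \<omega> :: (real ^ 'n \<Rightarrow> complex) set) \<noteq> {}"
proof (intro conjI allI impI)
  fix u :: "nat \<Rightarrow> real ^ 'n \<Rightarrow> complex" assume u: "minimizing_sequence s \<omega> u"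
  obtain y :: "nat \<Rightarrow> real ^ 'n" and r :: "nat \<Rightarrow> nat" and \<phi> where
    "strict_mono r" "Ws_converges s (\<lambda>k x. u (r k) (x - y (r k))) \<phi>"
    by (rule minimizing_sequence_compact[OF assms(2,3) u])
  then show "\<exists>(y :: nat \<Rightarrow> real ^ 'n) (r :: nat \<Rightarrow> nat) \<phi>. strict_mono r \<and> Ws_converges s (\<lambda>k x. u (r k) (x - y (r k))) \<phi>"
    by blast
next
  obtain u :: "nat \<Rightarrow> real ^ 'n \<Rightarrow> complex" where "minimizing_sequence s \<omega> u"
    using minimizing_sequence_exists[OF assms(2,3)] by blast
  then obtain \<phi> :: "real ^ 'n \<Rightarrow> complex" where "\<phi> \<in> ground_states s \<omega>"
    by (rule minimizing_sequence_compact[OF assms(2,3)])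
  then show "(ground_states s \<omega> :: (real ^ 'n \<Rightarrow> complex) set) \<noteq> {}" by blast
qed

end
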